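(* For any $\epsilon>0$ there exists a rectifiable quasicircle $\hat\Gamma$ (a bounded Jordan curve in $\mathbb C$), with a Riemann mapping $\hat\Phi$ from the unit disk $\mathbb D$ onto the bounded component of $\hat{\mathbb C}\setminus\hat\Gamma$, for which $\log\hat\Phi'\in\mathrm{BMOA}(\mathbb D)$ with $\|\log\hat\Phi'\|_{\mathcal B}<\epsilon$, such that $\hat\Gamma$ is not a chord-arc curve.
   Context: $\mathbb D$ is the open unit disk, $\mathbb S$ the unit circle, and $\hat{\mathbb C}$ the extended complex plane. Quasicircle: a bounded Jordan curve $\Gamma$ for which there is a constant $C>0$ such that $\mathrm{diam}(\gamma)\le C|z-\zeta|$ for all $z,\zeta\in\Gamma$, where $\gamma$ is the smaller of the two subarcs of $\Gamma$ joining $z$ and $\zeta$. Chord-arc curve: a rectifiable Jordan curve $\Gamma$ for which there is a constant $C>0$ such that for all $z,\zeta\in\Gamma$ the shorter of the two subarcs of $\Gamma$ joining $z$ and $\zeta$ has length at most $C|z-\zeta|$. Bloch norm: for a holomorphic function $\varphi$ in $\mathbb D$, $\|\varphi\|_{\mathcal B}=\sup_{z\in\mathbb D}(1-|z|^2)|\varphi'(z)|$. BMO and BMOA: an integrable function $u$ on $\mathbb S$ belongs to $\mathrm{BMO}(\mathbb S)$ if $\sup_{I\subset\mathbb S}\frac1{|I|}\int_I|u(z)-u_I|\,|dz|<\infty$, where the supremum is over all intervals (arcs) $I\subset\mathbb S$, $|I|$ is the length of $I$, and $u_I$ is the integral mean of $u$ over $I$. $\mathrm{BMOA}(\mathbb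 D)=H^2\cap\mathrm{BMO}(\mathbb S)$, i.e. the functions in the Hardy space $H^2(\mathbb D)$ whose boundary function on $\mathbb S$ lies in $\mathrm{BMO}(\mathbb S)$. $\log\hat\Phi'$ is a holomorphic branch on $\mathbb D$. *)

theory Defs
  imports "HOL-Analysis.Analysis"
begin

definition jordan_curve :: "complex set \<Rightarrow> bool" where
  "jordan_curve \<Gamma> \<longleftrightarrow> (\<exists>g. simple_path g \<and> pathfinish g = pathstart g \<and> path_image g = \<Gamma>)"

definition path_length :: "(real \<Rightarrow> complex) \<Rightarrow> ennreal" where
  "path_length g =
     (SUP (n, t) \<in> {(n :: nat, t :: nat \<Rightarrow> real).
                      (\<forall>i\<le>n. t i \<in> {0..1}) \<and> (\<forall>i<n. t i \<le> t (Suc i))}.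
        \<Sum>i<n. ennreal (dist (g (t i)) (g (t (Suc i)))))"

(* The length of a simple closed path depends only on its image, so the choice of the
   parametrization g is immaterial. *)
definition rectifiable_jordan_curve :: "complex set \<Rightarrow> bool" where
  "rectifiable_jordan_curve \<Gamma> \<longleftrightarrow>
     (\<exists>g. simple_path g \<and> pathfinish g = pathstart g \<and> path_image g = \<Gamma> \<and> path_length g < \<infinity>)"

(* h1 and h2 parametrize the two subarcs of \<Gamma> that join z and \<zeta>. As arcs are injective, this
   is only possible for z \<noteq> \<zeta>. For distinct points of a Jordan curve such a pair exists and the
   images are unique up to order. The degenerate case z = \<zeta> imposes no condition on the curve. *)
definition complementary_subarcs ::
  "complex set \<Rightarrow> complex \<Rightarrow> complex \<Rightarrow> (real \<Rightarrow> complex) \<Rightarrow> (real \<Rightarrow> complex) \<Rightarrow> bool" where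
  "complementary_subarcs \<Gamma> z \<zeta> h1 h2 \<longleftrightarrow>
     arc h1 \<and> pathstart h1 = z \<and> pathfinish h1 = \<zeta> \<and>
     arc h2 \<and> pathstart h2 = z \<and> pathfinish h2 = \<zeta> \<and>
     path_image h1 \<union> path_image h2 = \<Gamma> \<and>
     path_image h1 \<inter> path_image h2 = {z, \<zeta>}"

definition quasicircle :: "complex set \<Rightarrow> bool" where
  "quasicircle \<Gamma> \<longleftrightarrow> jordan_curve \<Gamma> \<and>
     (\<exists>C>0. \<forall>z\<in>\<Gamma>. \<forall>\<zeta>\<in>\<Gamma>. \<forall>h1 h2. complementary_subarcs \<Gamma> z \<zeta> h1 h2 \<longrightarrow>
        min (diameter (path_image h1)) (diameter (path_image h2)) \<le> C * dist z \<zeta>)"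

definition chord_arc_curve :: "complex set \<Rightarrow> bool" where
  "chord_arc_curve \<Gamma> \<longleftrightarrow> rectifiable_jordan_curve \<Gamma> \<and>
     (\<exists>C>0. \<forall>z\<in>\<Gamma>. \<forall>\<zeta>\<in>\<Gamma>. \<forall>h1 h2. complementary_subarcs \<Gamma> z \<zeta> h1 h2 \<longrightarrow>
        min (path_length h1) (path_length h2) \<le> ennreal (C * dist z \<zeta>))"

definition riemann_mapping :: "(complex \<Rightarrow> complex) \<Rightarrow> complex set \<Rightarrow> bool" where
  "riemann_mapping \<Phi> \<Omega> \<longleftrightarrow>
     \<Phi> holomorphic_on ball 0 1 \<and> inj_on \<Phi> (ball 0 1) \<and> \<Phi> ` ball 0 1 = \<Omega>"

definition log_deriv_branch :: "(complex \<Rightarrow> complex) \<Rightarrow> (complex \<Rightarrow> complex) \<Rightarrow> bool" where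
  "log_deriv_branch \<Phi> L \<longleftrightarrow>
     L holomorphic_on ball 0 1 \<and> (\<forall>z\<in>ball 0 1. exp (L z) = deriv \<Phi> z)"

definition bloch_norm :: "(complex \<Rightarrow> complex) \<Rightarrow> ennreal" where
  "bloch_norm \<phi> = (SUP z\<in>ball 0 1. ennreal ((1 - (norm z)\<^sup>2) * norm (deriv \<phi> z)))"

definition arc_mean :: "(complex \<Rightarrow> complex) \<Rightarrow> real \<Rightarrow> real \<Rightarrow> complex" where
  "arc_mean u a b = (LINT t:{a..b}|lebesgue. u (cis t)) / of_real (b - a)"

(* Arcs of the unit circle are written as the images of [a, b] under cis, with a < b and
   b \<le> a + 2 pi; arc length becomes Lebesgue measure in t. Endpoints are irrelevant. *)
definition bmo_circle :: "(complex \<Rightarrow> complex) \<Rightarrow> bool" where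
  "bmo_circle u \<longleftrightarrow>
     set_integrable lebesgue {0..2*pi} (\<lambda>t. u (cis t)) \<and>
     bdd_above {(LINT t:{a..b}|lebesgue. norm (u (cis t) - arc_mean u a b)) / (b - a) | a b.
                  a < b \<and> b \<le> a + 2*pi}"

definition hardy_H2 :: "(complex \<Rightarrow> complex) \<Rightarrow> bool" where
  "hardy_H2 f \<longleftrightarrow> f holomorphic_on ball 0 1 \<and>
     bdd_above ((\<lambda>r. LINT t:{0..2*pi}|lebesgue. (norm (f (of_real r * cis t)))\<^sup>2) ` {0..<1})"

definition boundary_function :: "(complex \<Rightarrow> complex) \<Rightarrow> (complex \<Rightarrow> complex) \<Rightarrow> bool" where
  "boundary_function f u \<longleftrightarrow>
     (AE t in lebesgue. ((\<lambda>r. f (of_real r * cis t)) \<longlongrightarrow> u (cis t)) (at_left 1))"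

definition bmoa :: "(complex \<Rightarrow> complex) \<Rightarrow> bool" where
  "bmoa f \<longleftrightarrow> hardy_H2 f \<and> (\<exists>u. boundary_function f u \<and> bmo_circle u)"

end

theory Submission
  imports Defs "HOL-Complex_Analysis.Complex_Analysis"
begin

text \<open>
  The branch \<open>L\<close> of the logarithm of \<open>\<Phi>'\<close> is constructed first, and \<open>\<Phi>\<close> is the primitive of
  \<open>exp L\<close>.

  \<^emph>\<open>Geometry from a small Bloch norm.\<close>  If \<open>(1 - |z|) |L' z|\<close> is small, then \<open>L\<close> varies along a
  segment from \<open>a\<close> to a boundary point at distance comparable to \<open>1 - |a|\<close> at most like a small
  multiple of \<open>ln (1 / (1 - s))\<close>, which is exponentially integrable.  So \<open>\<Phi>\<close> is close to the affine
  map with slope \<open>exp (L a)\<close> on the part of the closed disc that is seen from \<open>a\<close>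
  (\<open>distortion_from_interior_point\<close>).  Taking for \<open>a\<close> the point at height \<open>|z - w|\<close> below two boundary
  points \<open>z\<close> and \<open>w\<close> shows that \<open>|\<Phi> z - \<Phi> w|\<close> is comparable to \<open>|exp (L a)| |z - w|\<close>.  Injectivity on
  the closed disc and the quasicircle property follow at once.

  \<^emph>\<open>BMOA from a bounded imaginary part.\<close>  The Poisson mean of \<open>(L - L z)\<^sup>2\<close> at \<open>z\<close> is zero, so the real
  and imaginary parts of \<open>L\<close> have the same quadratic oscillation; the latter is bounded as soon as
  \<open>Im L\<close> is (\<open>oscillation_of_bounded_Im\<close>).

  \<^emph>\<open>Long arcs.\<close>  The image of an arc \<open>J\<close> has length equal to the integral of \<open>|exp L|\<close> over \<open>J\<close>, while its
  chord is at most about \<open>|J| |exp (L a)|\<close> with \<open>a\<close> at height \<open>|J|\<close> below \<open>J\<close>.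
  The ratio is made large by a random walk in a strip.  Replace an entire function \<open>F\<close> by \<open>F + \<alpha> A z^n\<close>, with \<open>n\<close> very large.  On the circle the values of \<open>z^n\<close> become
  independent of \<open>F\<close> and \<open>A\<close>.  The Bloch bound of \<open>F\<close> lives away from the circle and that of the new
  term close to it, so they do not add up.  The integral of \<open>exp F\<close> over \<open>J\<close> hardly changes, because
  the perturbation of \<open>exp F\<close> is holomorphic and tiny inside the disc, but the integral of
  \<open>|exp F|\<close> grows by a multiple of \<open>\<alpha>\<^sup>2\<close> times the integral of \<open>|exp F| |A|\<^sup>2\<close>.  The modulus of \<open>A\<close> on
  the circle can be prescribed (\<open>entire_with_modulus_on_circle\<close>).  It is at least \<open>1 / 2\<close> on the part of \<open>J\<close>
  where \<open>|Im F| \<le> 2\<close>, and tiny where \<open>|Im F| \<ge> 3\<close> or away from \<open>J\<close>.  Then \<open>|Im F| < 4\<close> persists, and since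
  \<open>4 < 3 pi / 2\<close> the whole positive part of the real part of \<open>exp F\<close> (times \<open>z\<close>, which is near 1 on
  \<open>J\<close>) comes from points with \<open>|Im F| \<le> 2\<close>, where \<open>A\<close> is large.  As the integral of \<open>exp F\<close> is
  preserved, every step adds a fixed multiple of it to the length (\<open>admissible_step\<close>), and the length
  becomes as large as desired.  The underlying fact is that \<open>exp\<close> of the real part of
  Brownian motion, stopped when it leaves a strip of width more than \<open>pi\<close>, is not integrable.

  \<^emph>\<open>Infinitely many arcs.\<close>  The block of steps is carried out on arcs \<open>{cis t | r \<le> t \<le> 2 r}\<close> with
  \<open>r = r j\<close> decreasing rapidly to 0.  The \<open>j\<close>-th block makes the image of its arc at least \<open>j\<close> times
  \<open>r j\<close> long, and \<open>r j\<close> is so small that the total length increases by at most \<open>2^(-j)\<close>.  The functions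
  converge on the closed disc off the point 1.  The limit curve is rectifiable, but the \<open>j\<close>-th arc has
  a chord of order at most \<open>r j\<close>, so that no chord-arc constant exists.
\<close>

section \<open>The exponential parametrisation of the circle\<close>

lemma cis_has_vector_derivative:
  "(cis has_vector_derivative \<i> * cis t) (at t within S)"
  unfolding has_vector_derivative_def
  by (rule has_derivative_eq_rhs[OF has_derivative_cis[OF has_derivative_ident]])
     (simp add: fun_eq_iff scaleR_conv_of_real)

lemma norm_cis_diff: "norm (cis s - cis t) = 2 * \<bar>sin ((s - t) / 2)\<bar>"
proof -
  have "(norm (cis s - cis t))\<^sup>2 = (cos s - cos t)\<^sup>2 + (sin s - sin t)\<^sup>2" by (simp add: cmod_power2)
  also have "\<dots> = (sin s ^ 2 + cos s ^ 2) + (sin t ^ 2 + cos t ^ 2) - 2 * (cos s * cos t + sin s * sin t)"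
    by (simp add: power2_eq_square algebra_simps)
  also have "\<dots> = 2 - 2 * cos (s - t)" by (simp only: sin_cos_squared_add cos_diff)
  also have "cos (s - t) = 1 - 2 * (sin ((s - t) / 2))\<^sup>2"
  proof -
    have "2 * ((s - t) / 2) = s - t" by simp
    then show ?thesis using cos_double_sin[of "(s - t) / 2"] by (simp only:)
  qed
  finally have "(norm (cis s - cis t))\<^sup>2 = (2 * \<bar>sin ((s - t) / 2)\<bar>)\<^sup>2" by (simp add: power2_eq_square)
  then show ?thesis by (rule power2_eq_imp_eq) auto
qed

lemma norm_cis_diff_le: "norm (cis s - cis t) \<le> \<bar>s - t\<bar>"
  using abs_sin_x_le_abs_x[of "(s - t) / 2"] by (simp add: norm_cis_diff)

lemma half_le_sin:
  fixes x :: real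
  assumes "0 \<le> x" "x \<le> 1"
  shows "x / 2 \<le> sin x"
proof -
  have "(\<lambda>y. sin y - y / 2) 0 \<le> (\<lambda>y. sin y - y / 2) x"
  proof (rule DERIV_nonneg_imp_nondecreasing[OF assms(1)])
    fix y assume y: "0 \<le> y" "y \<le> x"
    have "cos (pi / 3) \<le> cos y" using y assms pi_gt3 by (intro cos_monotone_0_pi_le) auto
    then have "0 \<le> cos y - 1 / 2" by (simp add: cos_60)
    moreover have "((\<lambda>y. sin y - y / 2) has_real_derivative (cos y - 1 / 2)) (at y)"
      by (auto intro!: derivative_eq_intros)
    ultimately show "\<exists>d. ((\<lambda>y. sin y - y / 2) has_real_derivative d) (at y) \<and> 0 \<le> d" by blast
  qed
  then show ?thesis by simp
qed

lemma norm_cis_diff_ge: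
  assumes r: "0 \<le> r" "r \<le> 1" and st: "r \<le> t - s" "t - s \<le> 2 * pi - r"
  shows "r / 2 \<le> norm (cis t - cis s)"
proof -
  define y where "y = (t - s) / 2"
  have y: "r / 2 \<le> y" "y \<le> pi - r / 2" using st by (auto simp: y_def)
  have "sin (r / 2) \<le> sin y"
  proof (cases "y \<le> pi / 2")
    case True
    then show ?thesis using y r by (intro sin_monotone_2pi_le) auto
  next
    case False
    then have "sin (r / 2) \<le> sin (pi - y)" using y r by (intro sin_monotone_2pi_le) auto
    then show ?thesis by simp
  qed
  moreover have "r / 2 / 2 \<le> sin (r / 2)" using r by (intro half_le_sin) auto
  ultimately show ?thesis using abs_ge_self[of "sin y"] unfolding norm_cis_diff y_def[symmetric] by linarith
qed

lemma norm_cis_diff_mono: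
  assumes "s \<le> u" "u \<le> t" "t - s \<le> pi"
  shows "dist (cis u) (cis s) \<le> dist (cis t) (cis s)" "dist (cis u) (cis t) \<le> dist (cis t) (cis s)"
proof -
  have m: "\<bar>sin (x / 2)\<bar> \<le> \<bar>sin (y / 2)\<bar>" if "0 \<le> x" "x \<le> y" "y \<le> pi" for x y :: real
  proof -
    have "sin (x / 2) \<le> sin (y / 2)" using that by (intro sin_monotone_2pi_le) auto
    moreover have "0 \<le> sin (x / 2)" using that by (intro sin_ge_zero) auto
    ultimately show ?thesis by simp
  qed
  show "dist (cis u) (cis s) \<le> dist (cis t) (cis s)"
    using m[of "u - s" "t - s"] assms by (simp add: dist_norm norm_cis_diff)
  have "norm (cis u - cis t) = norm (cis t - cis u)" by (rule norm_minus_commute)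
  then show "dist (cis u) (cis t) \<le> dist (cis t) (cis s)"
    using m[of "t - u" "t - s"] assms by (simp add: dist_norm norm_cis_diff)
qed

lemma cis_eq_imp_eq:
  assumes "cis s = cis t" "\<bar>s - t\<bar> < 2 * pi" shows "s = t"
proof -
  have "sin ((s - t) / 2) = 0" using norm_cis_diff[of s t] assms(1) by simp
  moreover have "- pi < (s - t) / 2" "(s - t) / 2 < pi" using assms(2) by auto
  ultimately have "(s - t) / 2 = 0" using sin_eq_0_pi by blast
  then show ?thesis by simp
qed

lemma cis_add_2pi: "cis (t + 2 * pi) = cis t"
  by (simp add: cis.ctr)

lemma sphere_eq_cis_image: "sphere 0 1 = cis ` {a..a + 2 * pi}"
proof (intro equalityI subsetI)
  fix z :: complex assume "z \<in> sphere 0 1"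
  then have z: "norm z = 1" by simp
  then obtain \<theta> where th: "z = cis \<theta>"
    by (metis cis_Arg norm_zero sgn_div_norm scaleR_one div_by_1 inverse_1 zero_neq_one)
  define k where "k = \<lfloor>(\<theta> - a) / (2 * pi)\<rfloor>"
  have k: "of_int k \<le> (\<theta> - a) / (2 * pi)" "(\<theta> - a) / (2 * pi) < of_int k + 1"
    unfolding k_def by linarith+
  have "a \<le> \<theta> - 2 * pi * of_int k" "\<theta> - 2 * pi * of_int k \<le> a + 2 * pi"
    using k pi_gt_zero by (auto simp: field_simps)
  moreover have "cis (\<theta> - 2 * pi * of_int k) = z"
    using cis_divide[of \<theta> "2 * pi * of_int k"] th by simp
  ultimately show "z \<in> cis ` {a..a + 2 * pi}" by (metis atLeastAtMost_iff image_eqI)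
qed auto

lemma cos_quadratic_lower: "1 - x\<^sup>2 / 2 \<le> cos (x::real)"
proof -
  have "\<bar>sin (x / 2)\<bar>\<^sup>2 \<le> \<bar>x / 2\<bar>\<^sup>2" by (intro power_mono abs_sin_x_le_abs_x) auto
  then have "(sin (x / 2))\<^sup>2 \<le> x\<^sup>2 / 4" by (simp add: power_divide)
  then show ?thesis using cos_double_sin[of "x / 2"] by simp
qed

lemma cos_nonpos_middle:
  assumes "pi / 2 \<le> \<bar>x\<bar>" "\<bar>x\<bar> \<le> 3 * pi / 2"
  shows "cos x \<le> 0"
proof -
  have "cos \<bar>x\<bar> = - cos (\<bar>x\<bar> - pi)" by simp
  moreover have "0 \<le> cos (\<bar>x\<bar> - pi)" using assms by (intro cos_ge_zero) auto
  ultimately show ?thesis by (simp add: cos_abs_real)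
qed

lemma AE_cis_neq_1: "AE t in lebesgue. cis t \<noteq> 1"
proof (rule AE_I')
  show "{t. cis t = 1} \<in> null_sets lebesgue"
  proof -
    have "{t. cis t = 1} \<subseteq> range (\<lambda>n::int. real_of_int n * (2 * pi))"
    proof
      fix t assume "t \<in> {t. cis t = 1}"
      then have "cos t = 1" by (simp add: complex_eq_iff)
      then obtain n :: int where "t = real_of_int n * 2 * pi" using cos_one_2pi_int by blast
      then show "t \<in> range (\<lambda>n::int. real_of_int n * (2 * pi))" by simp
    qed
    then have "countable {t. cis t = 1}" by (rule countable_subset) simp
    then have "{t. cis t = 1} \<in> null_sets lborel" by (rule countable_imp_null_set_lborel)
    then show ?thesis by (rule null_sets_completionI)
  qed
qed auto

section \<open>Entire functions on the closed disc\<close>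

lemma entire_continuous:
  fixes f :: "complex \<Rightarrow> complex"
  assumes "f holomorphic_on UNIV" shows "continuous_on S f"
  by (rule continuous_on_subset[OF holomorphic_on_imp_continuous_on[OF assms]]) simp

lemma entire_bounded_on_disc:
  fixes f :: "complex \<Rightarrow> complex"
  assumes "f holomorphic_on UNIV"
  obtains C where "0 < C" "\<And>z. z \<in> cball 0 1 \<Longrightarrow> norm (f z) \<le> C"
proof -
  have "continuous_on (cball 0 1) f"
    by (rule entire_continuous[OF assms])
  then have "bounded (f ` cball 0 1)"
    by (intro compact_imp_bounded compact_continuous_image) auto
  then show ?thesis using that by (auto simp: bounded_pos)
qed

lemma entire_cis_vector_derivative:
  assumes "f holomorphic_on UNIV"
  shows "((\<lambda>t. f (cis t)) has_vector_derivative deriv f (cis t) * (\<i> * cis t)) (at t within S)"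
proof -
  from field_vector_diff_chain_within[OF cis_has_vector_derivative has_field_derivative_at_within[OF holomorphic_derivI[OF assms open_UNIV]]]
  show ?thesis by (simp add: o_def mult_ac)
qed

lemma entire_cis_continuous [continuous_intros]:
  fixes f :: "complex \<Rightarrow> complex"
  assumes "f holomorphic_on UNIV" shows "continuous_on S (\<lambda>t. f (cis t))"
  by (rule continuous_on_compose2[OF entire_continuous[OF assms, of UNIV]]) (auto intro!: continuous_intros)

section \<open>Distortion of primitives of an exponential of a Bloch function\<close>

text \<open>
  Comparison of the two power series term by term.
\<close>

lemma norm_exp_minus_one_le:
  fixes w :: complex
  shows "norm (exp w - 1) \<le> exp (norm w) - 1"
proof -
  have "(\<lambda>n. w ^ Suc n /\<^sub>R fact (Suc n)) sums (exp w - 1)"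
    using exp_converges[of w] by (subst sums_Suc_iff) simp
  moreover have "(\<lambda>n. norm w ^ Suc n /\<^sub>R fact (Suc n)) sums (exp (norm w) - 1)"
    using exp_converges[of "norm w"] by (subst sums_Suc_iff) simp
  ultimately show ?thesis
    by (rule norm_sums_le) (simp add: norm_power norm_mult norm_divide divide_simps power_Suc[symmetric] del: power_Suc)
qed

text \<open>
  At parameter \<open>s\<close> the segment from \<open>a\<close> to \<open>p\<close> is still at distance \<open>(1 - s) (1 - |a|)\<close> from the circle,
  by convexity of the norm, so the derivative along it is at most \<open>M \<beta> / (1 - s)\<close>.
\<close>

lemma bloch_growth_along_segment:
  fixes F :: "complex \<Rightarrow> complex"
  assumes F: "F holomorphic_on UNIV"
    and bloch: "\<And>z. z \<in> ball 0 1 \<Longrightarrow> (1 - norm z) * norm (deriv F z) \<le> \<beta>"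
    and a: "a \<in> ball 0 1" and p: "p \<in> cball 0 1"
    and close: "norm (p - a) \<le> M * (1 - norm a)" and M: "0 \<le> M"
    and s: "0 \<le> s" "s < 1"
  shows "norm (F (a + of_real s * (p - a)) - F a) \<le> - (M * \<beta>) * ln (1 - s)"
proof -
  define \<gamma> where "\<gamma> = M * \<beta>"
  define q where "q = (\<lambda>s::real. a + of_real s * (p - a))"
  have q': "(q has_vector_derivative (p - a)) (at s within S)" for s S
    unfolding q_def by (auto intro!: derivative_eq_intros)
  have F': "(F has_field_derivative deriv F z) (at z)" for z
    using F by (simp add: holomorphic_derivI)
  have qball: "(1 - s) * (1 - norm a) \<le> 1 - norm (q s)" if "0 \<le> s" "s \<le> 1" for s
  proof -
    have "q s = of_real (1 - s) * a + of_real s * p" by (simp add: q_def algebra_simps)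
    then have "norm (q s) \<le> norm (of_real (1 - s) * a) + norm (of_real s * p)"
      by (simp only: norm_triangle_ineq)
    also have "\<dots> \<le> (1 - s) * norm a + s * 1"
      unfolding norm_mult norm_of_real using that p by (simp add: mult_left_le)
    finally show ?thesis by (simp add: algebra_simps)
  qed
  have "norm (F (q s) - F a) \<le> - \<gamma> * ln (1 - s)"
  proof (cases "s = 0")
    case True then show ?thesis by (simp add: q_def)
  next
    case False
    have d: "((\<lambda>x. F (q x)) has_vector_derivative (p - a) * deriv F (q x)) (at x within S)" for x S
      using field_vector_diff_chain_within[OF q' has_field_derivative_at_within[OF F']]
      by (simp add: o_def)
    have "norm (F (q s) - F (q 0)) \<le> - \<gamma> * ln (1 - s) - (- \<gamma> * ln (1 - 0))"
    proof (rule differentiable_bound_general)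
      show "0 < s" using False s by simp
      show "continuous_on {0..s} (\<lambda>x. F (q x))"
        by (rule continuous_on_vector_derivative[OF d])
      show "continuous_on {0..s} (\<lambda>x. - \<gamma> * ln (1 - x))"
        using s by (auto intro!: continuous_intros)
      show "((\<lambda>x. F (q x)) has_vector_derivative (p - a) * deriv F (q x)) (at x)" for x by (rule d)
      show "((\<lambda>x. - \<gamma> * ln (1 - x)) has_vector_derivative \<gamma> / (1 - x)) (at x)" if "0 < x" "x < s" for x
        unfolding has_real_derivative_iff_has_vector_derivative[symmetric]
        using s that by (auto intro!: derivative_eq_intros simp: field_simps)
      show "norm ((p - a) * deriv F (q x)) \<le> \<gamma> / (1 - x)" if x: "0 < x" "x < s" for x
      proof -
        have a1: "0 < 1 - norm a" using a by simp
        have pos: "0 < (1 - x) * (1 - norm a)" using x s a1 by simp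
        have le: "(1 - x) * (1 - norm a) \<le> 1 - norm (q x)" using x s qball by simp
        have "(1 - x) * (1 - norm a) * norm (deriv F (q x)) \<le> (1 - norm (q x)) * norm (deriv F (q x))"
          using le by (intro mult_right_mono) auto
        also have "\<dots> \<le> \<beta>" using bloch[of "q x"] pos le by simp
        finally have b: "(1 - x) * (1 - norm a) * norm (deriv F (q x)) \<le> \<beta>" .
        have "norm ((p - a) * deriv F (q x)) * (1 - x)
               \<le> M * (1 - norm a) * norm (deriv F (q x)) * (1 - x)"
          using close x s by (simp add: norm_mult mult_right_mono)
        also have "\<dots> = M * ((1 - x) * (1 - norm a) * norm (deriv F (q x)))" by (simp add: mult_ac)
        also have "\<dots> \<le> \<gamma>" unfolding \<gamma>_def by (intro mult_left_mono b M)
        finally show ?thesis using x s by (simp add: pos_le_divide_eq)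
      qed
    qed
    then show ?thesis by (simp add: q_def)
  qed
  then show ?thesis by (simp add: q_def \<gamma>_def)
qed

text \<open>
  With \<open>\<gamma> = M \<beta>\<close>, the quotient \<open>exp (F q - F a)\<close> differs from 1 by at most \<open>(1 - s) powr (- \<gamma>) - 1\<close> at the point \<open>q\<close>
  of the segment with parameter \<open>s\<close>, and the integral of this bound over \<open>[0, 1]\<close> is \<open>\<gamma> / (1 - \<gamma>)\<close>.
  The point \<open>p\<close> may lie on the circle; this is what makes boundary estimates possible.
\<close>

lemma distortion_from_interior_point:
  fixes \<Psi> F :: "complex \<Rightarrow> complex"
  assumes \<Psi>: "\<And>z. (\<Psi> has_field_derivative exp (F z)) (at z)"
    and F: "F holomorphic_on UNIV"
    and bloch: "\<And>z. z \<in> ball 0 1 \<Longrightarrow> (1 - norm z) * norm (deriv F z) \<le> \<beta>"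
    and a: "a \<in> ball 0 1" and p: "p \<in> cball 0 1"
    and close: "norm (p - a) \<le> M * (1 - norm a)"
    and M: "0 \<le> M" and \<beta>: "0 \<le> \<beta>" "M * \<beta> < 1"
  shows "norm (\<Psi> p - \<Psi> a - exp (F a) * (p - a))
           \<le> norm (exp (F a)) * norm (p - a) * (M * \<beta> / (1 - M * \<beta>))"
proof -
  define \<gamma> where "\<gamma> = M * \<beta>"
  have \<gamma>: "0 \<le> \<gamma>" "\<gamma> < 1" using M \<beta> by (auto simp: \<gamma>_def)
  define q where "q = (\<lambda>s::real. a + of_real s * (p - a))"
  have q': "(q has_vector_derivative (p - a)) (at s within S)" for s S
    unfolding q_def by (auto intro!: derivative_eq_intros)
  have Fdiff: "norm (F (q s) - F a) \<le> - \<gamma> * ln (1 - s)" if "0 \<le> s" "s < 1" for s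
    using bloch_growth_along_segment[OF F bloch a p close M(1) that] by (simp add: q_def \<gamma>_def)
  define g where "g = (\<lambda>s::real. \<Psi> (q s) - of_real s * (exp (F a) * (p - a)))"
  define C where "C = norm (exp (F a)) * norm (p - a)"
  define \<phi> where "\<phi> = (\<lambda>s::real. C * (- ((1 - s) powr (1 - \<gamma>)) / (1 - \<gamma>) - s))"
  have \<Psi>d: "((\<lambda>x. \<Psi> (q x)) has_vector_derivative (p - a) * exp (F (q x))) (at x within S)" for x S
    using field_vector_diff_chain_within[OF q' has_field_derivative_at_within[OF \<Psi>]]
    by (simp add: o_def)
  have gd: "(g has_vector_derivative (exp (F (q x)) - exp (F a)) * (p - a)) (at x within S)" for x S
    unfolding g_def by (rule derivative_eq_intros \<Psi>d refl)+ (auto simp: algebra_simps)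
  have "norm (g 1 - g 0) \<le> \<phi> 1 - \<phi> 0"
  proof (rule differentiable_bound_general[where f' = "\<lambda>x. (exp (F (q x)) - exp (F a)) * (p - a)"
        and \<phi>' = "\<lambda>x. C * ((1 - x) powr (- \<gamma>) - 1)"])
    show "continuous_on {0..1} g" by (rule continuous_on_vector_derivative[OF gd])
    show "continuous_on {0..1} \<phi>" unfolding \<phi>_def using \<gamma>
      by (auto intro!: continuous_intros continuous_on_powr')
    show "(g has_vector_derivative (exp (F (q x)) - exp (F a)) * (p - a)) (at x)" for x by (rule gd)
    show "(\<phi> has_vector_derivative C * ((1 - x) powr (- \<gamma>) - 1)) (at x)" if x: "0 < x" "x < 1" for x
    proof -
      have "((\<lambda>s. 1 - s) has_real_derivative - 1) (at x)" by (auto intro!: derivative_eq_intros)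
      from DERIV_chain2[OF has_real_derivative_powr this, of "1 - \<gamma>"]
      have "((\<lambda>s. (1 - s) powr (1 - \<gamma>)) has_real_derivative - ((1 - \<gamma>) * (1 - x) powr (- \<gamma>))) (at x)"
        using x by simp
      from DERIV_cmult[OF DERIV_diff[OF DERIV_cdivide[OF DERIV_minus[OF this], of "1 - \<gamma>"] DERIV_ident], of C]
      show ?thesis
        unfolding has_real_derivative_iff_has_vector_derivative[symmetric] \<phi>_def using \<gamma> by simp
    qed
    show "norm ((exp (F (q x)) - exp (F a)) * (p - a)) \<le> C * ((1 - x) powr (- \<gamma>) - 1)"
      if x: "0 < x" "x < 1" for x
    proof -
      have "norm (exp (F (q x)) - exp (F a)) = norm (exp (F a)) * norm (exp (F (q x) - F a) - 1)"
        unfolding norm_mult[symmetric] by (simp add: algebra_simps exp_diff)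
      also have "\<dots> \<le> norm (exp (F a)) * (exp (norm (F (q x) - F a)) - 1)"
        by (intro mult_left_mono norm_exp_minus_one_le) auto
      also have "\<dots> \<le> norm (exp (F a)) * (exp (- \<gamma> * ln (1 - x)) - 1)"
        using Fdiff[of x] x by (intro mult_left_mono) auto
      also have "exp (- \<gamma> * ln (1 - x)) = (1 - x) powr (- \<gamma>)" using x by (simp add: powr_def)
      finally have "norm (exp (F (q x)) - exp (F a)) * norm (p - a)
          \<le> norm (exp (F a)) * ((1 - x) powr (- \<gamma>) - 1) * norm (p - a)"
        by (rule mult_right_mono) simp
      then show ?thesis by (simp only: C_def norm_mult mult_ac)
    qed
  qed simp
  moreover have "g 1 - g 0 = \<Psi> p - \<Psi> a - exp (F a) * (p - a)" by (simp add: g_def q_def)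
  moreover have "\<phi> 1 - \<phi> 0 = C * (\<gamma> / (1 - \<gamma>))"
  proof -
    have "\<phi> 1 - \<phi> 0 = C * (1 / (1 - \<gamma>) - 1)" by (simp add: \<phi>_def right_diff_distrib)
    also have "1 / (1 - \<gamma>) - 1 = \<gamma> / (1 - \<gamma>)" using \<gamma> by (simp add: field_simps)
    finally show ?thesis .
  qed
  ultimately show ?thesis by (simp add: C_def \<gamma>_def)
qed

text \<open>
  For \<open>z\<close> and \<open>w\<close> on the circle, a point whose distances to \<open>z\<close>, to \<open>w\<close> and to the circle are all
  comparable to \<open>|z - w|\<close>; the centre of the disc if they are antipodal.
\<close>

definition whitney_point :: "complex \<Rightarrow> complex \<Rightarrow> complex" where
  "whitney_point z w = of_real (1 - dist z w / 2) * ((z + w) / 2)"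

lemma whitney_point_props:
  assumes zw: "z \<in> cball 0 1" "w \<in> cball 0 1" "z \<noteq> w"
  shows "whitney_point z w \<in> ball 0 1"
    and "dist z w \<le> 2 * (1 - norm (whitney_point z w))"
    and "norm (z - whitney_point z w) \<le> dist z w"
    and "norm (w - whitney_point z w) \<le> dist z w"
proof -
  define d where "d = dist z w"
  define m where "m = (z + w) / 2"
  have nz: "norm z \<le> 1" "norm w \<le> 1" using zw by auto
  have d: "0 < d" "d \<le> 2" using zw norm_triangle_ineq4[of z w] by (auto simp: d_def dist_norm)
  have m1: "norm m \<le> 1"
    using norm_triangle_ineq[of z w] nz by (simp add: m_def norm_divide)
  have eq: "whitney_point z w = of_real (1 - d / 2) * m" by (simp add: whitney_point_def d_def m_def)
  have "norm (whitney_point z w) = \<bar>1 - d / 2\<bar> * norm m" by (simp only: eq norm_mult norm_of_real)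
  also have "\<dots> = (1 - d/2) * norm m" using d by simp
  also have "\<dots> \<le> (1 - d/2) * 1" using d m1 by (intro mult_left_mono) auto
  finally have n: "norm (whitney_point z w) \<le> 1 - d / 2" by simp
  show "whitney_point z w \<in> ball 0 1" using n d by simp
  show "dist z w \<le> 2 * (1 - norm (whitney_point z w))" using n by (simp add: d_def)
  have mm: "norm (m - whitney_point z w) \<le> d / 2"
  proof -
    have "m - whitney_point z w = of_real (d / 2) * m" by (simp add: eq algebra_simps)
    then have "norm (m - whitney_point z w) = \<bar>d / 2\<bar> * norm m"
      by (simp only: norm_mult norm_of_real)
    also have "\<dots> = d / 2 * norm m" using d by simp
    also have "d / 2 * norm m \<le> d / 2 * 1" using d m1 by (intro mult_left_mono) auto
    finally show ?thesis by simp
  qed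
  have zm: "z - m = (z - w) / 2" "w - m = (w - z) / 2" by (auto simp: m_def field_simps)
  have half: "norm ((z - w) / 2) = d / 2" "norm ((w - z) / 2) = d / 2"
    by (auto simp: d_def dist_norm norm_divide norm_minus_commute)
  have "norm (z - m) = d / 2" "norm (w - m) = d / 2" by (simp_all only: zm half)
  then show "norm (z - whitney_point z w) \<le> dist z w" "norm (w - whitney_point z w) \<le> dist z w"
    using mm norm_triangle_ineq[of "z - m" "m - whitney_point z w"]
      norm_triangle_ineq[of "w - m" "m - whitney_point z w"] by (auto simp: d_def[symmetric])
qed

text \<open>
  Two applications of the distortion estimate with \<open>M = 2\<close> and \<open>\<beta> = 1 / 20\<close>, each with relative error \<open>1 / 9\<close>.
\<close>

lemma chord_distortion:
  fixes \<Psi> F :: "complex \<Rightarrow> complex"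
  assumes \<Psi>: "\<And>z. (\<Psi> has_field_derivative exp (F z)) (at z)"
    and F: "F holomorphic_on UNIV"
    and bloch: "\<And>z. z \<in> ball 0 1 \<Longrightarrow> (1 - norm z) * norm (deriv F z) \<le> 1 / 20"
    and zw: "z \<in> cball 0 1" "w \<in> cball 0 1" "z \<noteq> w"
  shows "norm (\<Psi> z - \<Psi> w - exp (F (whitney_point z w)) * (z - w))
           \<le> norm (exp (F (whitney_point z w))) * dist z w / 2"
proof -
  define a where "a = whitney_point z w"
  note wp = whitney_point_props[OF zw, folded a_def]
  have e: "norm (\<Psi> p - \<Psi> a - exp (F a) * (p - a)) \<le> norm (exp (F a)) * dist z w * (1 / 9)"
    if "p \<in> cball 0 1" "norm (p - a) \<le> dist z w" for p
  proof -
    have "norm (\<Psi> p - \<Psi> a - exp (F a) * (p - a))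
            \<le> norm (exp (F a)) * norm (p - a) * (2 * (1/20) / (1 - 2 * (1/20)))"
      by (rule distortion_from_interior_point[OF \<Psi> F bloch wp(1)]) (use that wp in auto)
    also have "\<dots> = norm (exp (F a)) * norm (p - a) * (1/9)" by simp
    also have "\<dots> \<le> norm (exp (F a)) * dist z w * (1/9)"
      using that by (intro mult_right_mono mult_left_mono) auto
    finally show ?thesis .
  qed
  have "\<Psi> z - \<Psi> w - exp (F a) * (z - w)
        = (\<Psi> z - \<Psi> a - exp (F a) * (z - a)) - (\<Psi> w - \<Psi> a - exp (F a) * (w - a))"
    by (simp add: algebra_simps)
  then have "norm (\<Psi> z - \<Psi> w - exp (F a) * (z - w))
     \<le> norm (\<Psi> z - \<Psi> a - exp (F a) * (z - a)) + norm (\<Psi> w - \<Psi> a - exp (F a) * (w - a))"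
    by (simp only: norm_triangle_ineq4)
  also have "\<dots> \<le> norm (exp (F a)) * dist z w * (1 / 9) + norm (exp (F a)) * dist z w * (1 / 9)"
    using zw wp by (intro add_mono e) auto
  also have "\<dots> \<le> norm (exp (F a)) * dist z w / 2" by (simp add: field_simps)
  finally show ?thesis by (simp add: a_def)
qed

text \<open>
  Distortion with \<open>M = 4\<close>: the point \<open>p\<close> stands for a point of the shorter arc between \<open>z\<close> and \<open>w\<close>.
\<close>

lemma near_point_distortion:
  fixes \<Psi> F :: "complex \<Rightarrow> complex"
  assumes \<Psi>: "\<And>z. (\<Psi> has_field_derivative exp (F z)) (at z)"
    and F: "F holomorphic_on UNIV"
    and bloch: "\<And>z. z \<in> ball 0 1 \<Longrightarrow> (1 - norm z) * norm (deriv F z) \<le> 1 / 20"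
    and zw: "z \<in> cball 0 1" "w \<in> cball 0 1" "z \<noteq> w"
    and p: "p \<in> cball 0 1" "dist p z \<le> dist z w"
  shows "norm (\<Psi> p - \<Psi> (whitney_point z w)) \<le> 3 * norm (exp (F (whitney_point z w))) * dist z w"
proof -
  define a where "a = whitney_point z w"
  note wp = whitney_point_props[OF zw, folded a_def]
  have pa: "norm (p - a) \<le> 2 * dist z w"
    using norm_triangle_ineq[of "p - z" "z - a"] p(2) wp(3) by (simp add: dist_norm)
  have "norm (\<Psi> p - \<Psi> a - exp (F a) * (p - a))
            \<le> norm (exp (F a)) * norm (p - a) * (4 * (1/20) / (1 - 4 * (1/20)))"
    by (rule distortion_from_interior_point[OF \<Psi> F bloch wp(1)]) (use p pa wp in auto)
  then have "norm (\<Psi> p - \<Psi> a - exp (F a) * (p - a)) + norm (exp (F a) * (p - a))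
       \<le> norm (exp (F a)) * norm (p - a) * (5/4)" by (simp add: norm_mult mult_ac)
  then have "norm (\<Psi> p - \<Psi> a) \<le> norm (exp (F a)) * norm (p - a) * (5/4)"
    using norm_triangle_ineq[of "\<Psi> p - \<Psi> a - exp (F a) * (p - a)" "exp (F a) * (p - a)"] by simp
  also have "\<dots> \<le> norm (exp (F a)) * (2 * dist z w) * (5/4)"
    using pa by (intro mult_right_mono mult_left_mono) auto
  also have "\<dots> \<le> 3 * norm (exp (F a)) * dist z w" by simp
  finally show ?thesis by (simp add: a_def)
qed

section \<open>Entire functions with prescribed modulus on the circle\<close>

text \<open>
  On the circle the conjugate of \<open>z\<close> is its inverse, so \<open>z^i\<close> times the conjugate of \<open>z^j\<close> is a
  power of \<open>z\<close> or of its conjugate, and the real part does not distinguish the two.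
\<close>

lemma Re_monomials_mult:
  fixes c d :: complex
  shows "\<exists>p. \<forall>z\<in>sphere 0 1. Re (c * z ^ i) * Re (d * z ^ j) = Re (poly p z)"
proof -
  define s where "s = (if j \<le> i then monom (c * cnj d) (i - j) else monom (cnj c * d) (j - i))"
  define p where "p = smult (1/2) (monom (c * d) (i + j) + s)"
  have "Re (c * z ^ i) * Re (d * z ^ j) = Re (poly p z)" if z: "norm z = 1" for z
  proof -
    have zz: "z ^ k * cnj z ^ k = 1" for k
      using z complex_norm_square[of z] by (simp add: power_mult_distrib[symmetric])
    have s: "Re (poly s z) = Re (c * z ^ i * cnj (d * z ^ j))"
    proof (cases "j \<le> i")
      case True
      then have "z ^ i = z ^ (i - j) * z ^ j" by (simp add: power_add[symmetric])
      then have "c * z ^ i * cnj (d * z ^ j) = c * cnj d * z ^ (i - j) * (z ^ j * cnj z ^ j)" by simp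
      then show ?thesis using True by (simp only: zz s_def poly_monom if_True) simp
    next
      case False
      then have "z ^ j = z ^ (j - i) * z ^ i" by (simp add: power_add[symmetric])
      then have "cnj c * cnj z ^ i * (d * z ^ j) = cnj c * d * z ^ (j - i) * (z ^ i * cnj z ^ i)" by simp
      then have "cnj (c * z ^ i * cnj (d * z ^ j)) = cnj c * d * z ^ (j - i)"
        by (simp only: zz) simp
      then show ?thesis using False by (metis cnj.simps(1) poly_monom s_def)
    qed
    have "Re (poly p z) = (Re (c * d * z ^ (i + j)) + Re (poly s z)) / 2"
      by (simp add: p_def poly_monom)
    also have "\<dots> = (Re ((c * z ^ i) * (d * z ^ j)) + Re ((c * z ^ i) * cnj (d * z ^ j))) / 2"
      unfolding s by (simp only: power_add mult_ac)
    also have "\<dots> = Re (c * z ^ i) * Re (d * z ^ j)"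
      by (simp only: times_complex.simps cnj.simps) (simp add: field_simps)
    finally show ?thesis by simp
  qed
  then show ?thesis by auto
qed

lemma Re_polys_mult:
  fixes p q :: "complex poly"
  shows "\<exists>r. \<forall>z\<in>sphere 0 1. Re (poly p z) * Re (poly q z) = Re (poly r z)"
proof -
  define r where "r = (\<lambda>i j. SOME r. \<forall>z\<in>sphere 0 1.
      Re (coeff p i * z ^ i) * Re (coeff q j * z ^ j) = Re (poly r z))"
  have r: "Re (coeff p i * z ^ i) * Re (coeff q j * z ^ j) = Re (poly (r i j) z)"
    if "z \<in> sphere 0 1" for i j z
    using someI_ex[OF Re_monomials_mult[of "coeff p i" i "coeff q j" j]] that
    unfolding r_def by blast
  have "Re (poly p z) * Re (poly q z) = Re (poly (\<Sum>i\<le>degree p. \<Sum>j\<le>degree q. r i j) z)"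
    if "z \<in> sphere 0 1" for z
    by (simp only: poly_altdef[of p] poly_altdef[of q] Re_sum sum_product r[OF that] poly_sum)
  then show ?thesis by blast
qed

text \<open>
  Stone-Weierstrass: the real parts of polynomials form an algebra on the circle that separates points.
\<close>

lemma entire_Re_approximation_on_circle:
  fixes h :: "complex \<Rightarrow> real"
  assumes h: "continuous_on (sphere 0 1) h" and e: "0 < e"
  obtains P where "P holomorphic_on UNIV" "\<And>z. z \<in> sphere 0 1 \<Longrightarrow> \<bar>Re (P z) - h z\<bar> < e"
proof -
  define R where "R = {f :: complex \<Rightarrow> real. \<exists>p. \<forall>z\<in>sphere 0 1. f z = Re (poly p z)}"
  interpret function_ring_on R "sphere (0::complex) 1"
  proof
    show "compact (sphere (0::complex) 1)" by simp
    show "continuous_on (sphere 0 1) f" if f: "f \<in> R" for f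
    proof -
      obtain p where p: "\<forall>z\<in>sphere 0 1. f z = Re (poly p z)" using f by (auto simp: R_def)
      have "continuous_on (sphere 0 1) (\<lambda>z. Re (poly p z))" by (intro continuous_intros)
      then show ?thesis using p by (metis continuous_on_cong)
    qed
    show "(\<lambda>x. f x + g x) \<in> R" if fg: "f \<in> R" "g \<in> R" for f g
    proof -
      obtain p q where "\<forall>z\<in>sphere 0 1. f z = Re (poly p z)" "\<forall>z\<in>sphere 0 1. g z = Re (poly q z)"
        using fg by (auto simp: R_def)
      then show ?thesis unfolding R_def by (auto intro!: exI[of _ "p + q"])
    qed
    show "(\<lambda>x. f x * g x) \<in> R" if fg: "f \<in> R" "g \<in> R" for f g
    proof -
      obtain p q where "\<forall>z\<in>sphere 0 1. f z = Re (poly p z)" "\<forall>z\<in>sphere 0 1. g z = Re (poly q z)"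
        using fg by (auto simp: R_def)
      then show ?thesis unfolding R_def using Re_polys_mult[of p q] by auto
    qed
    show "(\<lambda>_. c) \<in> R" for c
      unfolding R_def by (auto intro!: exI[of _ "[:complex_of_real c:]"])
    show "\<exists>f\<in>R. f x \<noteq> f y" if xy: "x \<in> sphere 0 1" "y \<in> sphere 0 1" "x \<noteq> y" for x y :: complex
    proof -
      have "Re \<in> R" unfolding R_def by (auto intro!: exI[of _ "[:0, 1:]"])
      moreover have "Im \<in> R" unfolding R_def by (auto intro!: exI[of _ "[:0, -\<i>:]"])
      ultimately show ?thesis using xy(3) complex_eqI by metis
    qed
  qed
  obtain f where f: "f \<in> R" "\<forall>x\<in>sphere 0 1. \<bar>h x - f x\<bar> < e"
    using Stone_Weierstrass_basic[OF h e] by auto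
  then obtain p where p: "\<forall>z\<in>sphere 0 1. f z = Re (poly p z)" by (auto simp: R_def)
  show ?thesis
  proof (rule that[of "poly p"])
    show "\<bar>Re (poly p z) - h z\<bar> < e" if "z \<in> sphere 0 1" for z
      using f(2) p that by (metis abs_minus_commute)
  qed (intro holomorphic_intros)
qed

text \<open>
  An entire substitute for the outer function with boundary modulus \<open>exp h\<close>: the exponential of a
  function whose real part is close to \<open>h\<close>.
\<close>

lemma entire_with_modulus_on_circle:
  fixes h :: "complex \<Rightarrow> real"
  assumes h: "continuous_on (sphere 0 1) h" and h0: "\<And>z. z \<in> sphere 0 1 \<Longrightarrow> h z \<le> 0"
  obtains A where "A holomorphic_on UNIV"
    "\<And>z. z \<in> cball 0 1 \<Longrightarrow> norm (A z) \<le> 1"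
    "\<And>z. z \<in> sphere 0 1 \<Longrightarrow> norm (A z) \<le> exp (h z)"
    "\<And>z. z \<in> sphere 0 1 \<Longrightarrow> exp (h z) / 2 \<le> norm (A z)"
proof -
  obtain P where P: "P holomorphic_on UNIV" "\<And>z. z \<in> sphere 0 1 \<Longrightarrow> \<bar>Re (P z) - h z\<bar> < 1/4"
    using entire_Re_approximation_on_circle[OF h, of "1/4"] by auto
  define A where "A = (\<lambda>z. exp (P z - 1/4))"
  have hol: "A holomorphic_on UNIV" unfolding A_def by (intro holomorphic_intros P)
  have n: "norm (A z) = exp (Re (P z) - 1/4)" for z by (simp add: A_def)
  have up: "norm (A z) \<le> exp (h z)" if "z \<in> sphere 0 1" for z
  proof -
    have "Re (P z) - 1/4 \<le> h z" using P(2)[OF that] by linarith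
    then show ?thesis by (simp add: n)
  qed
  have lo: "exp (h z) / 2 \<le> norm (A z)" if "z \<in> sphere 0 1" for z
  proof -
    have "exp (h z) * (1/2) \<le> exp (h z) * exp (- (1/2))"
      using exp_ge_add_one_self[of "-(1/2)::real"] by (intro mult_left_mono) auto
    also have "\<dots> = exp (h z - 1/2)" by (simp add: exp_add[symmetric])
    also have "\<dots> \<le> norm (A z)"
    proof -
      have "h z - 1/2 \<le> Re (P z) - 1/4" using P(2)[OF that] by linarith
      then show ?thesis by (simp add: n)
    qed
    finally show ?thesis by simp
  qed
  have bound: "norm (A z) \<le> 1" if z: "z \<in> cball 0 1" for z
  proof (rule maximum_modulus_frontier[of A "cball 0 1"])
    show "A holomorphic_on interior (cball 0 1)" using hol holomorphic_on_subset by blast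
    show "continuous_on (closure (cball 0 1)) A"
      using hol holomorphic_on_imp_continuous_on continuous_on_subset by blast
    show "norm (A w) \<le> 1" if "w \<in> frontier (cball 0 1)" for w
    proof -
      have w: "w \<in> sphere 0 1" using that by simp
      have "exp (h w) \<le> 1" using h0[OF w] by simp
      then show ?thesis using up[OF w] by linarith
    qed
  qed (use z in auto)
  show ?thesis by (rule that[OF hol bound up lo])
qed

section \<open>Adding one lacunary term: size, Bloch bound and imaginary part\<close>

text \<open>
  The sum of \<open>x^i\<close> for \<open>i < n\<close> is at least \<open>n x^(n-1)\<close>, and it is at most \<open>1 / (1 - x)\<close>.
\<close>

lemma power_times_one_minus_le:
  fixes x :: real
  assumes "0 \<le> x" "x \<le> 1"
  shows "real n * x ^ (n - 1) * (1 - x) \<le> 1"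
proof -
  have "real n * x ^ (n - 1) = (\<Sum>i<n. x ^ (n - 1))" by simp
  also have "\<dots> \<le> (\<Sum>i<n. x ^ i)" using assms by (intro sum_mono power_decreasing) auto
  finally have "real n * x ^ (n - 1) * (1 - x) \<le> (\<Sum>i<n. x ^ i) * (1 - x)"
    using assms by (intro mult_right_mono) auto
  also have "\<dots> = 1 - x ^ n" using one_diff_power_eq[of x n] by (simp add: mult.commute)
  finally show ?thesis using assms by (simp add: order_trans)
qed

text \<open>
  The weight \<open>1 - |z|\<^sup>2\<close> makes \<open>F'\<close> negligible outside a disc of some radius \<open>s < 1\<close>, where \<open>F'\<close> is
  bounded.  For large \<open>n\<close> the derivative of \<open>z^n\<close> is negligible inside this disc, and its weighted size
  never exceeds 2.  So the new bound is the maximum of \<open>b\<close> and \<open>2 \<alpha>\<close> up to an arbitrarily small error;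
  the number \<open>3 \<alpha>\<close> leaves room for it, and the same bound can serve for all later steps.
\<close>

lemma bloch_bound_lacunary_step:
  fixes F A :: "complex \<Rightarrow> complex" and \<alpha> b :: real
  assumes F: "F holomorphic_on UNIV" and A: "A holomorphic_on UNIV"
    and A1: "\<And>z. z \<in> cball 0 1 \<Longrightarrow> norm (A z) \<le> 1"
    and \<alpha>: "0 < \<alpha>" and b: "b < 3 * \<alpha>"
    and bl: "\<And>z. z \<in> ball 0 1 \<Longrightarrow> (1 - (norm z)\<^sup>2) * norm (deriv F z) \<le> b"
  shows "\<exists>b'<3 * \<alpha>. \<forall>\<^sub>F n in sequentially. \<forall>z\<in>ball 0 1.
           (1 - (norm z)\<^sup>2) * norm (deriv (\<lambda>z. F z + \<alpha> * A z * z ^ n) z) \<le> b'"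
proof -
  obtain C1 where C1: "0 < C1" "\<And>z. z \<in> cball 0 1 \<Longrightarrow> norm (deriv F z) \<le> C1"
    using entire_bounded_on_disc[of "deriv F"] F holomorphic_deriv by blast
  obtain C2 where C2: "0 < C2" "\<And>z. z \<in> cball 0 1 \<Longrightarrow> norm (deriv A z) \<le> C2"
    using entire_bounded_on_disc[of "deriv A"] A holomorphic_deriv by blast
  define \<eta> where "\<eta> = (3 * \<alpha> - max b (2 * \<alpha>)) / 4"
  define b' where "b' = max b (2 * \<alpha>) + 2 * \<eta>"
  have \<eta>: "0 < \<eta>" "b' < 3 * \<alpha>" using b \<alpha> by (auto simp: \<eta>_def b'_def max_def field_simps)
  define s where "s = max 0 (1 - \<eta> / (2 * C1))"
  have s: "0 \<le> s" "s < 1" using \<eta> C1 by (auto simp: s_def max_def)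
  have lim1: "(\<lambda>n. 2 * \<alpha> * C2 / real (Suc n)) \<longlonglongrightarrow> 0"
    by (intro tendsto_divide_0[OF tendsto_const] filterlim_compose[OF filterlim_real_sequentially filterlim_Suc]
        filterlim_at_top_imp_at_infinity)
  have "(\<lambda>n. real n * s ^ n) \<longlonglongrightarrow> 0"
    using powser_times_n_limit_0[of s] s by simp
  then have lim2': "(\<lambda>n. real n * s ^ (n - 1)) \<longlonglongrightarrow> 0"
  proof (cases "s = 0")
    case True
    then have "\<forall>\<^sub>F n in sequentially. real n * s ^ (n - 1) = 0"
      by (intro eventually_mono[OF eventually_gt_at_top[of 1]]) simp
    then show ?thesis by (simp add: tendsto_eventually)
  next
    case False
    assume "(\<lambda>n. real n * s ^ n) \<longlonglongrightarrow> 0"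
    then have "(\<lambda>n. real n * s ^ n / s) \<longlonglongrightarrow> 0 / s" by (intro tendsto_divide tendsto_const False)
    moreover have "real n * s ^ n / s = real n * s ^ (n - 1)" for n
      using False by (cases n) auto
    ultimately show ?thesis by simp
  qed
  then have lim2: "(\<lambda>n. 2 * \<alpha> * (real n * s ^ (n - 1))) \<longlonglongrightarrow> 0"
    using tendsto_mult_right_zero by blast
  have "\<forall>\<^sub>F n in sequentially. \<forall>z\<in>ball 0 1.
           (1 - (norm z)\<^sup>2) * norm (deriv (\<lambda>z. F z + \<alpha> * A z * z ^ n) z) \<le> b'"
    using order_tendstoD(2)[OF lim1 \<eta>(1)] order_tendstoD(2)[OF lim2 \<eta>(1)]
  proof eventually_elim
    case (elim n)
    show ?case
    proof
      fix z :: complex assume z: "z \<in> ball 0 1"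
      define x where "x = norm z"
      have x: "0 \<le> x" "x < 1" using z by (auto simp: x_def)
      have zc: "z \<in> cball 0 1" using z by simp
      have "1 - x\<^sup>2 = (1 - x) * (1 + x)" by (simp add: power2_eq_square algebra_simps)
      moreover have "(1 - x) * (1 + x) \<le> (1 - x) * 2" using x by (intro mult_left_mono) auto
      ultimately have wt: "0 \<le> 1 - x\<^sup>2" "1 - x\<^sup>2 \<le> 2 * (1 - x)" using x by auto
      have "((\<lambda>z. F z + \<alpha> * A z * z ^ n) has_field_derivative
              deriv F z + \<alpha> * (deriv A z * z ^ n + A z * (of_nat n * z ^ (n - 1)))) (at z)"
        using holomorphic_derivI[OF F, of z] holomorphic_derivI[OF A, of z]
        by (auto intro!: derivative_eq_intros simp: algebra_simps)
      then have d: "deriv (\<lambda>z. F z + \<alpha> * A z * z ^ n) z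
              = deriv F z + \<alpha> * (deriv A z * z ^ n + A z * (of_nat n * z ^ (n - 1)))"
        by (rule DERIV_imp_deriv)
      have "norm (deriv (\<lambda>z. F z + \<alpha> * A z * z ^ n) z)
              \<le> norm (deriv F z) + norm (\<alpha> * (deriv A z * z ^ n + A z * (of_nat n * z ^ (n - 1))))"
        unfolding d by (rule norm_triangle_ineq)
      also have "norm (\<alpha> * (deriv A z * z ^ n + A z * (of_nat n * z ^ (n - 1))))
              \<le> \<alpha> * (norm (deriv A z) * x ^ n + norm (A z) * (real n * x ^ (n - 1)))"
        using \<alpha> norm_triangle_ineq[of "deriv A z * z ^ n" "A z * (of_nat n * z ^ (n - 1))"]
        by (simp add: norm_mult norm_power x_def)
      also have "\<dots> \<le> \<alpha> * (C2 * x ^ n + 1 * (real n * x ^ (n - 1)))"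
        using \<alpha> x C2(2)[OF zc] A1[OF zc] by (intro mult_left_mono add_mono mult_right_mono) auto
      finally have "(1 - x\<^sup>2) * norm (deriv (\<lambda>z. F z + \<alpha> * A z * z ^ n) z)
         \<le> (1 - x\<^sup>2) * (norm (deriv F z) + \<alpha> * (C2 * x ^ n + 1 * (real n * x ^ (n - 1))))"
        using wt by (simp add: mult_left_mono)
      also have "\<dots> = (1 - x\<^sup>2) * norm (deriv F z) + (1 - x\<^sup>2) * (\<alpha> * (C2 * x ^ n))
            + (1 - x\<^sup>2) * (\<alpha> * (real n * x ^ (n - 1)))" by (simp add: algebra_simps)
      finally have main: "(1 - x\<^sup>2) * norm (deriv (\<lambda>z. F z + \<alpha> * A z * z ^ n) z)
          \<le> (1 - x\<^sup>2) * norm (deriv F z) + (1 - x\<^sup>2) * (\<alpha> * (C2 * x ^ n))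
            + (1 - x\<^sup>2) * (\<alpha> * (real n * x ^ (n - 1)))" .
      have T1: "(1 - x\<^sup>2) * (\<alpha> * (C2 * x ^ n)) \<le> \<eta>"
      proof -
        have p: "x ^ n * (1 - x) \<le> 1 / real (Suc n)"
          using power_times_one_minus_le[of x "Suc n"] x by (simp add: field_simps)
        have "(1 - x\<^sup>2) * (\<alpha> * (C2 * x ^ n)) \<le> (2 * (1 - x)) * (\<alpha> * (C2 * x ^ n))"
          using wt \<alpha> C2 x by (intro mult_right_mono) auto
        also have "\<dots> = 2 * \<alpha> * C2 * (x ^ n * (1 - x))" by simp
        also have "\<dots> \<le> 2 * \<alpha> * C2 * (1 / real (Suc n))"
          using \<alpha> C2 by (intro mult_left_mono p) auto
        finally show ?thesis using elim(1) by simp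
      qed
      have T2: "(1 - x\<^sup>2) * (\<alpha> * (real n * x ^ (n - 1))) \<le> 2 * \<alpha>"
      proof -
        have "(1 - x\<^sup>2) * (\<alpha> * (real n * x ^ (n - 1))) \<le> (2 * (1 - x)) * (\<alpha> * (real n * x ^ (n - 1)))"
          using wt \<alpha> x by (intro mult_right_mono) auto
        also have "\<dots> = 2 * \<alpha> * (real n * x ^ (n - 1) * (1 - x))" by simp
        also have "\<dots> \<le> 2 * \<alpha> * 1"
          using \<alpha> x by (intro mult_left_mono power_times_one_minus_le) auto
        finally show ?thesis by simp
      qed
      have "(1 - x\<^sup>2) * norm (deriv F z) + (1 - x\<^sup>2) * (\<alpha> * (real n * x ^ (n - 1))) \<le> max b (2 * \<alpha>) + \<eta>"
      proof (cases "x \<le> s")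
        case True
        have "(1 - x\<^sup>2) * (\<alpha> * (real n * x ^ (n - 1))) \<le> 2 * (\<alpha> * (real n * x ^ (n - 1)))"
          using wt \<alpha> x by (intro mult_right_mono) auto
        also have "\<dots> \<le> 2 * (\<alpha> * (real n * s ^ (n - 1)))"
          using True x \<alpha> by (intro mult_left_mono power_mono) auto
        also have "\<dots> \<le> \<eta>" using elim(2) by simp
        finally show ?thesis using bl[OF z] by (simp add: x_def)
      next
        case False
        then have s1: "1 - x \<le> \<eta> / (2 * C1)" by (simp add: s_def)
        have "(1 - x\<^sup>2) * norm (deriv F z) \<le> (2 * (1 - x)) * C1"
          using wt x C1(2)[OF zc] by (intro mult_mono) auto
        also have "\<dots> \<le> (2 * (\<eta> / (2 * C1))) * C1"
          using s1 C1 by (intro mult_right_mono mult_left_mono) auto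
        also have "\<dots> = \<eta>" using C1 by simp
        finally show ?thesis using T2 by simp
      qed
      with main T1 show "(1 - (norm z)\<^sup>2) * norm (deriv (\<lambda>z. F z + \<alpha> * A z * z ^ n) z) \<le> b'"
        by (simp add: x_def b'_def)
    qed
  qed
  with \<eta>(2) show ?thesis by blast
qed


text \<open>
  The maximum modulus principle for \<open>exp (-\<i> G)\<close> and \<open>exp (\<i> G)\<close>.
\<close>

lemma Im_maximum_principle:
  fixes G :: "complex \<Rightarrow> complex"
  assumes G: "G holomorphic_on UNIV" and B: "\<And>z. z \<in> sphere 0 1 \<Longrightarrow> \<bar>Im (G z)\<bar> \<le> B"
    and z: "z \<in> cball 0 1"
  shows "\<bar>Im (G z)\<bar> \<le> B"
proof -
  have *: "c * Im (G z) \<le> B" if c: "c = 1 \<or> c = -1" for c :: real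
  proof -
    define E where "E = (\<lambda>w. exp (- \<i> * of_real c * G w))"
    have n: "norm (E w) = exp (c * Im (G w))" for w by (simp add: E_def)
    have hol: "E holomorphic_on UNIV" unfolding E_def by (intro holomorphic_intros G)
    have "norm (E z) \<le> exp B"
    proof (rule maximum_modulus_frontier[of E "cball 0 1"])
      show "E holomorphic_on interior (cball 0 1)" using hol holomorphic_on_subset by blast
      show "continuous_on (closure (cball 0 1)) E"
        by (rule entire_continuous[OF hol])
      show "norm (E w) \<le> exp B" if "w \<in> frontier (cball 0 1)" for w
        using B[of w] that c by (auto simp: n)
    qed (use z in auto)
    then show ?thesis by (simp add: n)
  qed
  from *[of 1] *[of "-1"] show ?thesis by (simp add: abs_le_iff)
qed

text \<open>
  Near the circle \<open>A\<close> is small by uniform continuity, and away from it the factor \<open>z^n\<close> is small.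
\<close>

lemma lacunary_term_small_off_set:
  fixes A :: "complex \<Rightarrow> complex"
  assumes A: "A holomorphic_on UNIV" and A1: "\<And>z. z \<in> cball 0 1 \<Longrightarrow> norm (A z) \<le> 1"
    and \<delta>: "0 < \<delta>" and \<tau>: "0 < \<tau>"
    and small: "\<And>z. \<lbrakk>z \<in> sphere 0 1; \<tau> / 2 \<le> infdist z J\<rbrakk> \<Longrightarrow> norm (A z) \<le> \<delta>"
  shows "\<forall>\<^sub>F n in sequentially. \<forall>z\<in>cball 0 1. \<tau> \<le> infdist z J \<longrightarrow> norm (A z * z ^ n) \<le> 2 * \<delta>"
proof -
  have "uniformly_continuous_on (cball 0 1) A"
    by (intro compact_uniformly_continuous entire_continuous[OF A]) simp
  then obtain d where d: "0 < d"
    "\<And>z w. \<lbrakk>z \<in> cball 0 1; w \<in> cball 0 1; dist w z < d\<rbrakk> \<Longrightarrow> dist (A w) (A z) < \<delta>"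
    using \<delta> unfolding uniformly_continuous_on_def by metis
  define e where "e = min (d / 2) (min (\<tau> / 2) (1 / 2))"
  have e: "0 < e" "e < d" "e \<le> \<tau> / 2" "e < 1" using d \<tau> by (auto simp: e_def)
  have "(\<lambda>n. (1 - e) ^ n) \<longlonglongrightarrow> 0" using e by (intro LIMSEQ_realpow_zero) auto
  then have "\<forall>\<^sub>F n in sequentially. (1 - e) ^ n < \<delta>" using \<delta> by (rule order_tendstoD)
  then show ?thesis
  proof eventually_elim
    case (elim n)
    show ?case
    proof (intro ballI impI)
      fix z :: complex assume z: "z \<in> cball 0 1" and far: "\<tau> \<le> infdist z J"
      show "norm (A z * z ^ n) \<le> 2 * \<delta>"
      proof (cases "norm z \<le> 1 - e")
        case True
        have "norm (A z * z ^ n) \<le> 1 * (1 - e) ^ n"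
          unfolding norm_mult norm_power using A1[OF z] True by (intro mult_mono power_mono) auto
        then show ?thesis using elim \<delta> by simp
      next
        case False
        define w where "w = sgn z"
        have z0: "z \<noteq> 0" using False e by auto
        have w: "w \<in> sphere 0 1" using z0 by (simp add: w_def norm_sgn)
        have "w - z = of_real (1 - norm z) * w"
        proof -
          have "of_real (norm z) * w = z" using z0 by (simp add: w_def sgn_eq)
          then show ?thesis by (simp only: of_real_diff left_diff_distrib) simp
        qed
        then have dwz: "dist w z = 1 - norm z" using z w
          by (simp add: dist_norm norm_mult del: of_real_diff)
        have "\<tau> / 2 \<le> infdist w J"
          using infdist_triangle[of z J w] far dwz False e by (simp add: dist_commute)
        then have "norm (A w) \<le> \<delta>" using small w by blast
        moreover have "dist (A w) (A z) < \<delta>" using d(2)[OF z, of w] w dwz False e by simp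
        ultimately have "norm (A z) \<le> 2 * \<delta>"
          using norm_triangle_ineq2[of "A z" "A w"] by (simp add: dist_norm norm_minus_commute)
        moreover have "norm (A z * z ^ n) \<le> norm (A z) * 1"
          unfolding norm_mult norm_power using z by (intro mult_left_mono power_le_one) auto
        ultimately show ?thesis by simp
      qed
    qed
  qed
qed

section \<open>Adding one lacunary term: arc integrals\<close>

text \<open>
  The arc is deformed to the two radii that lead to its endpoints: a primitive \<open>K\<close> of \<open>k\<close> satisfies
  \<open>|K p - K 0| \<le> C / (n + 1)\<close> for \<open>|p| = 1\<close>.  The factor \<open>cis t\<close> is \<open>dz / (\<i> dt)\<close>.
\<close>

lemma arc_integral_of_small_entire:
  fixes k :: "complex \<Rightarrow> complex"
  assumes k: "k holomorphic_on UNIV" and C: "\<And>z. z \<in> cball 0 1 \<Longrightarrow> norm (k z) \<le> C * norm z ^ n"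
    and ab: "a \<le> b"
  shows "norm (integral {a..b} (\<lambda>t. k (cis t) * cis t)) \<le> 2 * C / real (Suc n)"
proof -
  obtain K where K: "\<And>z. (K has_field_derivative k z) (at z)"
    using holomorphic_convex_primitive'[OF convex_UNIV open_UNIV k] by auto
  have C0: "0 \<le> C" using C[of 1] by simp (metis norm_ge_zero order_trans)
  have K0: "norm (K p - K 0) \<le> C / real (Suc n)" if p: "p \<in> sphere 0 1" for p
  proof -
    have d: "((\<lambda>s. K (of_real s * p)) has_vector_derivative p * k (of_real s * p)) (at s within S)" for s S
    proof -
      have "((\<lambda>s. of_real s * p) has_vector_derivative p) (at s within S)"
        by (auto intro!: derivative_eq_intros)
      from field_vector_diff_chain_within[OF this has_field_derivative_at_within[OF K]]
      show ?thesis by (simp add: o_def)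
    qed
    have "norm (K (of_real 1 * p) - K (of_real 0 * p))
            \<le> C * 1 ^ Suc n / real (Suc n) - C * 0 ^ Suc n / real (Suc n)"
    proof (rule differentiable_bound_general)
      show "continuous_on {0..1} (\<lambda>s. K (of_real s * p))"
        by (rule continuous_on_vector_derivative[OF d])
      show "continuous_on {0..1} (\<lambda>s. C * s ^ Suc n / real (Suc n))"
        by (intro continuous_intros) auto
      show "((\<lambda>s. K (of_real s * p)) has_vector_derivative p * k (of_real s * p)) (at s)" for s by (rule d)
      show "((\<lambda>s. C * s ^ Suc n / real (Suc n)) has_vector_derivative C * s ^ n) (at s)" for s
        unfolding has_real_derivative_iff_has_vector_derivative[symmetric]
        by (rule derivative_eq_intros refl | simp)+
      show "norm (p * k (of_real s * p)) \<le> C * s ^ n" if "0 < s" "s < 1" for s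
        using C[of "of_real s * p"] that p by (simp add: norm_mult)
    qed simp
    then show ?thesis by simp
  qed
  have "((\<lambda>t. k (cis t) * (\<i> * cis t)) has_integral (K (cis b) - K (cis a))) {a..b}"
  proof (rule fundamental_theorem_of_calculus[OF ab])
    fix t
    from field_vector_diff_chain_within[OF cis_has_vector_derivative has_field_derivative_at_within[OF K]]
    show "((\<lambda>t. K (cis t)) has_vector_derivative k (cis t) * (\<i> * cis t)) (at t within {a..b})"
      by (simp add: o_def mult_ac)
  qed
  from has_integral_mult_right[OF this, of "- \<i>"]
  have "((\<lambda>t. k (cis t) * cis t) has_integral (- \<i> * (K (cis b) - K (cis a)))) {a..b}"
    by (simp add: algebra_simps)
  then have "integral {a..b} (\<lambda>t. k (cis t) * cis t) = - \<i> * (K (cis b) - K (cis a))"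
    by (rule integral_unique)
  then have "norm (integral {a..b} (\<lambda>t. k (cis t) * cis t)) = norm ((K (cis b) - K 0) - (K (cis a) - K 0))"
    by (simp add: norm_mult)
  also have "\<dots> \<le> norm (K (cis b) - K 0) + norm (K (cis a) - K 0)" by (rule norm_triangle_ineq4)
  also have "\<dots> \<le> C / real (Suc n) + C / real (Suc n)" by (intro add_mono K0) auto
  finally show ?thesis by simp
qed

text \<open>
  Integration by parts gives the rate \<open>1 / n\<close>.
\<close>

lemma Riemann_Lebesgue_C1:
  fixes g g' :: "real \<Rightarrow> complex"
  assumes g: "\<And>t. (g has_vector_derivative g' t) (at t)" and g': "continuous_on {a..b} g'"
    and ab: "a \<le> b"
  shows "(\<lambda>n. integral {a..b} (\<lambda>t. g t * cis t ^ n)) \<longlonglongrightarrow> 0"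
proof -
  have "bounded (g' ` {a..b})" by (intro compact_imp_bounded compact_continuous_image g') auto
  then obtain C where C: "\<And>t. t \<in> {a..b} \<Longrightarrow> norm (g' t) \<le> C"
    by (meson bounded_iff imageI)
  define M where "M = norm (g a) + norm (g b) + C * (b - a)"
  have bnd: "norm (integral {a..b} (\<lambda>t. g t * cis t ^ n)) \<le> M / real n" if n: "0 < n" for n
  proof -
    have e: "((\<lambda>t. cis t ^ n) has_vector_derivative (\<i> * of_nat n) * cis t ^ n) (at t within S)" for t S
    proof -
      have "((\<lambda>t. cis (real n * t)) has_vector_derivative (\<i> * of_nat n) * cis (real n * t)) (at t within S)"
        unfolding has_vector_derivative_def
        by (rule has_derivative_eq_rhs[OF has_derivative_cis[OF has_derivative_mult_right[OF has_derivative_ident]]])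
          (simp add: fun_eq_iff scaleR_conv_of_real)
      then show ?thesis by (simp add: Complex.DeMoivre)
    qed
    have i0: "((\<lambda>t. g' t * cis t ^ n + g t * ((\<i> * of_nat n) * cis t ^ n)) has_integral
              (g b * cis b ^ n - g a * cis a ^ n)) {a..b}"
    proof (rule fundamental_theorem_of_calculus[OF ab])
      fix t
      show "((\<lambda>t. g t * cis t ^ n) has_vector_derivative
              g' t * cis t ^ n + g t * ((\<i> * of_nat n) * cis t ^ n)) (at t within {a..b})"
        using has_vector_derivative_mult[OF has_vector_derivative_at_within[OF g] e]
        by (simp add: add.commute)
    qed
    have i1: "(\<lambda>t. g' t * cis t ^ n) integrable_on {a..b}"
      by (intro integrable_continuous_interval continuous_intros g')
    then have "((\<lambda>t. g' t * cis t ^ n) has_integral integral {a..b} (\<lambda>t. g' t * cis t ^ n)) {a..b}"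
      by (rule integrable_integral)
    note i2 = this
    have "((\<lambda>t. g t * ((\<i> * of_nat n) * cis t ^ n)) has_integral
        (g b * cis b ^ n - g a * cis a ^ n - integral {a..b} (\<lambda>t. g' t * cis t ^ n))) {a..b}"
      using has_integral_diff[OF i0 i2] by simp
    from has_integral_mult_right[OF this, of "1 / (\<i> * of_nat n)"]
    have "((\<lambda>t. g t * cis t ^ n) has_integral
        1 / (\<i> * of_nat n) * (g b * cis b ^ n - g a * cis a ^ n - integral {a..b} (\<lambda>t. g' t * cis t ^ n))) {a..b}"
      using n by simp
    then have eq: "integral {a..b} (\<lambda>t. g t * cis t ^ n) =
        1 / (\<i> * of_nat n) * (g b * cis b ^ n - g a * cis a ^ n - integral {a..b} (\<lambda>t. g' t * cis t ^ n))"
      by (rule integral_unique)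
    have "norm (integral {a..b} (\<lambda>t. g' t * cis t ^ n)) \<le> integral {a..b} (\<lambda>t. C)"
      by (rule integral_norm_bound_integral[OF i1]) (auto simp: norm_mult norm_power C)
    also have "\<dots> = C * (b - a)" using ab by simp
    finally have "norm (integral {a..b} (\<lambda>t. g' t * cis t ^ n)) \<le> C * (b - a)" .
    moreover have "norm (g b * cis b ^ n - g a * cis a ^ n - integral {a..b} (\<lambda>t. g' t * cis t ^ n))
       \<le> norm (g b * cis b ^ n) + norm (g a * cis a ^ n) + norm (integral {a..b} (\<lambda>t. g' t * cis t ^ n))"
      by (meson add_right_mono norm_triangle_ineq4 order_trans)
    ultimately have "norm (g b * cis b ^ n - g a * cis a ^ n - integral {a..b} (\<lambda>t. g' t * cis t ^ n)) \<le> M"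
      by (simp add: M_def norm_mult norm_power)
    then show ?thesis using n by (simp add: eq norm_mult norm_divide divide_right_mono)
  qed
  have "\<forall>\<^sub>F n in sequentially. norm (integral {a..b} (\<lambda>t. g t * cis t ^ n)) \<le> M / real n"
    by (rule eventually_mono[OF eventually_gt_at_top[of 0]]) (rule bnd)
  moreover have "(\<lambda>n. M / real n) \<longlonglongrightarrow> 0" by (rule lim_const_over_n)
  ultimately show ?thesis by (rule Lim_null_comparison)
qed

text \<open>
  For \<open>x = Re w \<ge> -1\<close> one has \<open>exp x = (exp (x / 2))\<^sup>2 \<ge> (1 + x / 2)\<^sup>2 = 1 + x + x\<^sup>2 / 4\<close>, and
  \<open>2 x\<^sup>2 = |w|\<^sup>2 + Re (w\<^sup>2)\<close>.  This form separates the part of \<open>x\<^sup>2\<close> that survives averaging over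
  rotations of \<open>w\<close>.
\<close>

lemma one_plus_Re_le_norm_exp:
  fixes w :: complex
  assumes "norm w \<le> 1"
  shows "1 + Re w + ((norm w)\<^sup>2 + Re (w\<^sup>2)) / 8 \<le> norm (exp w)"
proof -
  have x: "\<bar>Re w\<bar> \<le> 1" using abs_Re_le_cmod[of w] assms by linarith
  have "(norm w)\<^sup>2 + Re (w\<^sup>2) = 2 * (Re w)\<^sup>2"
    by (simp add: cmod_power2) (simp add: power2_eq_square)
  then have "1 + Re w + ((norm w)\<^sup>2 + Re (w\<^sup>2)) / 8 = (1 + Re w / 2)\<^sup>2"
    by (simp add: power2_eq_square algebra_simps)
  also have "\<dots> \<le> (exp (Re w / 2))\<^sup>2"
    using x exp_ge_add_one_self[of "Re w / 2"] by (intro power_mono) auto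
  also have "\<dots> = norm (exp w)" by (simp add: power2_eq_square exp_add[symmetric])
  finally show ?thesis .
qed

text \<open>
  Densities of the form \<open>p cnj q\<close> cover \<open>|exp F|\<close>, which is not holomorphic but equals
  \<open>E cnj E\<close> for \<open>E = exp (F / 2)\<close>.
\<close>

lemma Riemann_Lebesgue_entire:
  fixes p q :: "complex \<Rightarrow> complex"
  assumes p: "p holomorphic_on UNIV" and q: "q holomorphic_on UNIV" and ab: "a \<le> b"
  shows "(\<lambda>n. integral {a..b} (\<lambda>t. p (cis t) * cnj (q (cis t)) * cis t ^ n)) \<longlonglongrightarrow> 0"
proof (rule Riemann_Lebesgue_C1[OF _ _ ab])
  show "((\<lambda>t. p (cis t) * cnj (q (cis t))) has_vector_derivative
          p (cis t) * cnj (deriv q (cis t) * (\<i> * cis t)) + deriv p (cis t) * (\<i> * cis t) * cnj (q (cis t))) (at t)" for t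
    by (intro has_vector_derivative_mult entire_cis_vector_derivative p q
        has_vector_derivative_cnj)
  have "deriv p holomorphic_on UNIV" "deriv q holomorphic_on UNIV"
    using p q holomorphic_deriv by blast+
  then show "continuous_on {a..b} (\<lambda>t. p (cis t) * cnj (deriv q (cis t) * (\<i> * cis t)) + deriv p (cis t) * (\<i> * cis t) * cnj (q (cis t)))"
    by (intro continuous_intros p q)
qed

text \<open>
  Put \<open>w = \<alpha> A z^n\<close> in the lower bound for \<open>|exp w|\<close>.  The terms \<open>Re w\<close> and \<open>Re (w\<^sup>2)\<close> oscillate with
  frequencies \<open>n\<close> and \<open>2 n\<close> and disappear in the limit; \<open>|w|\<^sup>2 / 8 = \<alpha>\<^sup>2 |A|\<^sup>2 / 8\<close> remains.
\<close>

lemma arc_length_gain: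
  fixes F A :: "complex \<Rightarrow> complex" and \<alpha> \<delta> :: real
  assumes F: "F holomorphic_on UNIV" and A: "A holomorphic_on UNIV"
    and A1: "\<And>z. z \<in> cball 0 1 \<Longrightarrow> norm (A z) \<le> 1"
    and \<alpha>: "0 < \<alpha>" "\<alpha> \<le> 1" and ab: "a \<le> b" and \<delta>: "0 < \<delta>"
  shows "\<forall>\<^sub>F n in sequentially.
     integral {a..b} (\<lambda>t. norm (exp (F (cis t))))
       + \<alpha>\<^sup>2 / 8 * integral {a..b} (\<lambda>t. norm (exp (F (cis t))) * (norm (A (cis t)))\<^sup>2) - \<delta>
     \<le> integral {a..b} (\<lambda>t. norm (exp (F (cis t) + \<alpha> * A (cis t) * cis t ^ n)))"
proof -
  define E where "E = (\<lambda>z. exp (F z / 2))"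
  define N where "N = (\<lambda>t. norm (exp (F (cis t))))"
  have E: "E holomorphic_on UNIV" unfolding E_def by (intro holomorphic_intros F) simp
  have EA: "(\<lambda>z. E z * A z) holomorphic_on UNIV" "(\<lambda>z. E z * (A z)\<^sup>2) holomorphic_on UNIV"
    by (intro holomorphic_intros E A)+
  have EE: "E (cis t) * cnj (E (cis t)) = of_real (N t)" for t
  proof -
    have "(norm (E (cis t)))\<^sup>2 = N t" by (simp add: E_def N_def power2_eq_square exp_add[symmetric])
    then show ?thesis using complex_norm_square by metis
  qed
  define J1 where "J1 = (\<lambda>n. integral {a..b} (\<lambda>t. of_real (N t) * A (cis t) * cis t ^ n))"
  define J2 where "J2 = (\<lambda>n. integral {a..b} (\<lambda>t. of_real (N t) * (A (cis t))\<^sup>2 * cis t ^ n))"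
  have J1: "J1 \<longlonglongrightarrow> 0"
    using Riemann_Lebesgue_entire[OF EA(1) E ab] unfolding J1_def EE[symmetric] by (simp add: mult_ac)
  have J2: "J2 \<longlonglongrightarrow> 0"
    using Riemann_Lebesgue_entire[OF EA(2) E ab] unfolding J2_def EE[symmetric] by (simp add: mult_ac)
  have "(\<lambda>n. J2 (2 * n)) \<longlonglongrightarrow> 0"
    using LIMSEQ_subseq_LIMSEQ[OF J2, of "\<lambda>n. 2 * n"] by (simp add: o_def strict_mono_def)
  then have "(\<lambda>n. \<alpha> * norm (J1 n) + \<alpha>\<^sup>2 / 8 * norm (J2 (2 * n))) \<longlonglongrightarrow> \<alpha> * norm (0::complex) + \<alpha>\<^sup>2 / 8 * norm (0::complex)"
    using J1 by (intro tendsto_intros) auto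
  then have "\<forall>\<^sub>F n in sequentially. \<alpha> * norm (J1 n) + \<alpha>\<^sup>2 / 8 * norm (J2 (2 * n)) < \<delta>"
    using order_tendstoD(2)[where a = \<delta>] \<delta> by fastforce
  then show ?thesis
  proof eventually_elim
    case (elim n)
    have Nc: "continuous_on {a..b} N" unfolding N_def by (intro continuous_intros F)
    have Re_mult: "Re (of_real x * y) = x * Re y" for x y by simp
    have ptw: "N t + \<alpha> * Re (of_real (N t) * A (cis t) * cis t ^ n)
             + \<alpha>\<^sup>2 / 8 * (N t * (norm (A (cis t)))\<^sup>2)
             + \<alpha>\<^sup>2 / 8 * Re (of_real (N t) * (A (cis t))\<^sup>2 * cis t ^ (2 * n))
        \<le> norm (exp (F (cis t) + \<alpha> * A (cis t) * cis t ^ n))" for t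
    proof -
      define w where "w = \<alpha> * A (cis t) * cis t ^ n"
      have nw: "norm w = \<alpha> * norm (A (cis t))" using \<alpha> by (simp add: w_def norm_mult norm_power)
      have "norm (A (cis t)) \<le> 1" using A1[of "cis t"] by simp
      then have w1: "norm w \<le> 1" unfolding nw using \<alpha> by (intro mult_le_one) auto
      have w2: "w\<^sup>2 = of_real (\<alpha>\<^sup>2) * ((A (cis t))\<^sup>2 * cis t ^ (2 * n))"
        by (simp add: w_def power_mult_distrib power_mult[symmetric] mult.commute mult.left_commute)
      have r1: "Re w = \<alpha> * Re (A (cis t) * cis t ^ n)" by (simp add: w_def mult.assoc del: times_complex.sel) simp
      have r2: "Re (w\<^sup>2) = \<alpha>\<^sup>2 * Re ((A (cis t))\<^sup>2 * cis t ^ (2 * n))" unfolding w2 by (rule Re_mult)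
      have "N t * (1 + Re w + ((norm w)\<^sup>2 + Re (w\<^sup>2)) / 8) \<le> N t * norm (exp w)"
        by (intro mult_left_mono one_plus_Re_le_norm_exp w1) (simp add: N_def)
      also have "\<dots> = norm (exp (F (cis t) + \<alpha> * A (cis t) * cis t ^ n))"
        by (simp only: w_def exp_add N_def norm_mult)
      finally have fin: "N t * (1 + \<alpha> * Re (A (cis t) * cis t ^ n)
           + ((\<alpha> * norm (A (cis t)))\<^sup>2 + \<alpha>\<^sup>2 * Re ((A (cis t))\<^sup>2 * cis t ^ (2 * n))) / 8)
         \<le> norm (exp (F (cis t) + \<alpha> * A (cis t) * cis t ^ n))"
        unfolding r1 r2 nw .
      have alg: "x * (1 + \<alpha> * y + ((\<alpha> * z)\<^sup>2 + \<alpha>\<^sup>2 * v) / 8)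
          = x + \<alpha> * (x * y) + \<alpha>\<^sup>2 / 8 * (x * z\<^sup>2) + \<alpha>\<^sup>2 / 8 * (x * v)" for x y z v
        by (simp add: power_mult_distrib field_simps)
      show ?thesis using fin unfolding alg by (simp only: mult.assoc Re_mult)
    qed
    have c1: "continuous_on {a..b} (\<lambda>t. of_real (N t) * A (cis t) * cis t ^ n)"
      by (intro continuous_intros Nc A)
    have c2: "continuous_on {a..b} (\<lambda>t. of_real (N t) * (A (cis t))\<^sup>2 * cis t ^ (2 * n))"
      by (intro continuous_intros Nc A)
    have I1: "((\<lambda>t. Re (of_real (N t) * A (cis t) * cis t ^ n)) has_integral Re (J1 n)) {a..b}"
      unfolding J1_def by (rule has_integral_Re) (intro integrable_integral integrable_continuous_interval c1)
    have I2: "((\<lambda>t. Re (of_real (N t) * (A (cis t))\<^sup>2 * cis t ^ (2 * n))) has_integral Re (J2 (2 * n))) {a..b}"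
      unfolding J2_def by (rule has_integral_Re) (intro integrable_integral integrable_continuous_interval c2)
    have I3: "(N has_integral integral {a..b} N) {a..b}"
      by (intro integrable_integral integrable_continuous_interval Nc)
    have I4: "((\<lambda>t. N t * (norm (A (cis t)))\<^sup>2) has_integral integral {a..b} (\<lambda>t. N t * (norm (A (cis t)))\<^sup>2)) {a..b}"
      by (intro integrable_integral integrable_continuous_interval continuous_intros Nc A)
    have I5: "((\<lambda>t. norm (exp (F (cis t) + \<alpha> * A (cis t) * cis t ^ n))) has_integral
        integral {a..b} (\<lambda>t. norm (exp (F (cis t) + \<alpha> * A (cis t) * cis t ^ n)))) {a..b}"
      by (intro integrable_integral integrable_continuous_interval continuous_intros F A)
    have "integral {a..b} N + \<alpha> * Re (J1 n) + \<alpha>\<^sup>2 / 8 * integral {a..b} (\<lambda>t. N t * (norm (A (cis t)))\<^sup>2)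
             + \<alpha>\<^sup>2 / 8 * Re (J2 (2 * n))
        \<le> integral {a..b} (\<lambda>t. norm (exp (F (cis t) + \<alpha> * A (cis t) * cis t ^ n)))"
      by (rule has_integral_le[OF has_integral_add[OF has_integral_add[OF has_integral_add[OF I3
              has_integral_mult_right[OF I1]] has_integral_mult_right[OF I4]] has_integral_mult_right[OF I2]] I5 ptw])
    moreover have "- \<alpha> * norm (J1 n) \<le> \<alpha> * Re (J1 n)"
      using \<alpha> abs_Re_le_cmod[of "J1 n"] mult_left_mono[of "- norm (J1 n)" "Re (J1 n)" \<alpha>] by simp
    moreover have "- (\<alpha>\<^sup>2 / 8) * norm (J2 (2 * n)) \<le> \<alpha>\<^sup>2 / 8 * Re (J2 (2 * n))"
      using \<alpha> abs_Re_le_cmod[of "J2 (2 * n)"]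
        mult_left_mono[of "- norm (J2 (2 * n))" "Re (J2 (2 * n))" "\<alpha>\<^sup>2 / 8"] by simp
    ultimately show ?case using elim unfolding N_def by linarith
  qed
qed

text \<open>
  The change \<open>exp F (exp (\<alpha> A z^n) - 1)\<close> of the integrand is entire and at most a constant times
  \<open>|z|^n\<close> on the disc.
\<close>

lemma arc_integral_exp_almost_unchanged:
  fixes F A :: "complex \<Rightarrow> complex" and \<alpha> \<delta> :: real
  assumes F: "F holomorphic_on UNIV" and A: "A holomorphic_on UNIV"
    and A1: "\<And>z. z \<in> cball 0 1 \<Longrightarrow> norm (A z) \<le> 1"
    and \<alpha>: "0 < \<alpha>" "\<alpha> \<le> 1" and ab: "a \<le> b" and \<delta>: "0 < \<delta>"
  shows "\<forall>\<^sub>F n in sequentially.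
     norm (integral {a..b} (\<lambda>t. exp (F (cis t) + \<alpha> * A (cis t) * cis t ^ n) * cis t)
           - integral {a..b} (\<lambda>t. exp (F (cis t)) * cis t)) \<le> \<delta>"
proof -
  have "(\<lambda>z. exp (F z)) holomorphic_on UNIV" by (intro holomorphic_intros F)
  then obtain C where C: "0 < C" "\<And>z. z \<in> cball 0 1 \<Longrightarrow> norm (exp (F z)) \<le> C"
    using entire_bounded_on_disc by blast
  have "(\<lambda>n. 2 * (C * 2) / real (Suc n)) \<longlonglongrightarrow> 0"
    by (intro tendsto_divide_0[OF tendsto_const] filterlim_compose[OF filterlim_real_sequentially filterlim_Suc]
        filterlim_at_top_imp_at_infinity)
  then have "\<forall>\<^sub>F n in sequentially. 2 * (C * 2) / real (Suc n) < \<delta>" using \<delta> by (rule order_tendstoD)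
  then show ?thesis
  proof eventually_elim
    case (elim n)
    define k where "k = (\<lambda>z. exp (F z) * (exp (\<alpha> * A z * z ^ n) - 1))"
    have k: "k holomorphic_on UNIV" unfolding k_def by (intro holomorphic_intros F A)
    have kb: "norm (k z) \<le> (C * 2) * norm z ^ n" if z: "z \<in> cball 0 1" for z
    proof -
      define w where "w = \<alpha> * A z * z ^ n"
      have "norm w = \<alpha> * norm (A z) * norm z ^ n" using \<alpha> by (simp add: w_def norm_mult norm_power)
      also have "\<dots> \<le> 1 * norm z ^ n"
        using \<alpha> A1[OF z] by (intro mult_right_mono mult_le_one) auto
      finally have nw: "norm w \<le> norm z ^ n" by simp
      then have w1: "norm w \<le> 1" using z power_le_one[of "norm z" n] by simp
      have "exp (norm w) \<le> 1 + norm w + (norm w)\<^sup>2" using w1 by (intro exp_bound) auto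
      also have "(norm w)\<^sup>2 \<le> norm w" using w1 by (simp add: power2_eq_square mult_left_le)
      finally have "exp (norm w) - 1 \<le> 2 * norm w" by simp
      then have "norm (exp w - 1) \<le> 2 * norm z ^ n" using norm_exp_minus_one_le[of w] nw by linarith
      then have "norm (exp (F z)) * norm (exp w - 1) \<le> C * (2 * norm z ^ n)"
        using C(2)[OF z] C(1) by (intro mult_mono) auto
      then show ?thesis by (simp only: k_def w_def norm_mult mult.assoc)
    qed
    have i: "(\<lambda>t. exp (F (cis t) + \<alpha> * A (cis t) * cis t ^ n) * cis t) integrable_on {a..b}"
      "(\<lambda>t. exp (F (cis t)) * cis t) integrable_on {a..b}"
      by (intro integrable_continuous_interval continuous_intros F A)+
    have "integral {a..b} (\<lambda>t. exp (F (cis t) + \<alpha> * A (cis t) * cis t ^ n) * cis t)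
           - integral {a..b} (\<lambda>t. exp (F (cis t)) * cis t) = integral {a..b} (\<lambda>t. k (cis t) * cis t)"
      by (subst integral_diff[OF i, symmetric]) (simp add: k_def exp_add algebra_simps)
    then show ?case
      using arc_integral_of_small_entire[OF k kb ab] elim by simp
  qed
qed

section \<open>Raising the length over a fixed arc\<close>

text \<open>
  The class of entire functions that the construction moves in.  The Bloch bound is required with a
  margin, which each step may consume in part.  The number 4 lies between \<open>pi / 2 + 1 / 4\<close> and
  \<open>3 pi / 2 - 1 / 4\<close>; the summand \<open>1 / 4\<close> accounts for the arguments of the points of the arc.
\<close>

definition admissible :: "real \<Rightarrow> (complex \<Rightarrow> complex) \<Rightarrow> bool" where
  "admissible \<alpha> F \<longleftrightarrow> F holomorphic_on UNIV \<and>
     (\<exists>b<3 * \<alpha>. \<forall>z\<in>ball 0 1. (1 - (norm z)\<^sup>2) * norm (deriv F z) \<le> b) \<and>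
     (\<forall>z\<in>cball 0 1. \<bar>Im (F z)\<bar> < 4)"

text \<open>
  The length of the image of an arc, and (up to the factor \<open>\<i>\<close>) its chord, under a primitive of \<open>exp F\<close>.
\<close>

definition image_length :: "real \<Rightarrow> real \<Rightarrow> (complex \<Rightarrow> complex) \<Rightarrow> real" where
  "image_length a b F = integral {a..b} (\<lambda>t. norm (exp (F (cis t))))"

definition image_chord :: "real \<Rightarrow> real \<Rightarrow> (complex \<Rightarrow> complex) \<Rightarrow> complex" where
  "image_chord a b F = integral {a..b} (\<lambda>t. exp (F (cis t)) * cis t)"

text \<open>
  One step of the walk.  The modulus of \<open>A\<close> is \<open>exp h\<close> up to a factor between \<open>1 / 2\<close> and 1, with \<open>h = 0\<close> on the part of
  the arc where \<open>|Im F| \<le> 2\<close>, and \<open>exp h\<close> at most the tolerance \<open>\<delta>'\<close> where \<open>|Im F| \<ge> 3\<close> or the distance to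
  the arc is at least \<open>\<tau> / 2\<close>.  Points with \<open>|Im F| < 3\<close> move by at most \<open>\<alpha> \<le> 1 / 2\<close> and points beyond
  by at most \<open>\<delta>'\<close>, so the bound 4 on the imaginary part is never reached.
\<close>

lemma admissible_step:
  fixes \<alpha> \<delta> \<tau> a b :: real
  assumes F: "admissible \<alpha> F" and \<alpha>: "0 < \<alpha>" "\<alpha> \<le> 1 / 2"
    and ab: "0 \<le> a" "a \<le> b" "b \<le> 1 / 4" and \<tau>: "0 < \<tau>" and \<delta>: "0 < \<delta>"
  shows "\<exists>F'. admissible \<alpha> F' \<and>
     (\<forall>z\<in>cball 0 1. \<tau> \<le> infdist z (cis ` {a..b}) \<longrightarrow> norm (F' z - F z) \<le> \<delta>) \<and>
     (\<forall>z\<in>cball 0 1. norm (F' z - F z) \<le> \<alpha>) \<and>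
     norm (image_chord a b F' - image_chord a b F) \<le> \<delta> \<and>
     image_length a b F + \<alpha>\<^sup>2 / 32 * Re (image_chord a b F) - \<delta> \<le> image_length a b F'"
proof -
  have hol: "F holomorphic_on UNIV" using F by (simp add: admissible_def)
  obtain b0 where b0: "b0 < 3 * \<alpha>" "\<And>z. z \<in> ball 0 1 \<Longrightarrow> (1 - (norm z)\<^sup>2) * norm (deriv F z) \<le> b0"
    using F by (auto simp: admissible_def)
  define J where "J = cis ` {a..b}"
  have "\<exists>x\<in>cball 0 1. \<forall>y\<in>cball 0 1. \<bar>Im (F y)\<bar> \<le> \<bar>Im (F x)\<bar>"
    by (rule continuous_attains_sup) (auto intro!: continuous_intros entire_continuous[OF hol])
  then obtain m where m: "m < 4" "\<And>z. z \<in> cball 0 1 \<Longrightarrow> \<bar>Im (F z)\<bar> \<le> m"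
    using F by (auto simp: admissible_def)
  \<comment> \<open>the second entry keeps the imaginary part below 4 where it is already large\<close>
  define \<delta>' where "\<delta>' = min (\<delta> / 2) ((4 - m) / 2)"
  have \<delta>': "0 < \<delta>'" "\<delta>' \<le> \<delta> / 2" "m + \<delta>' < 4" using \<delta> m(1) by (auto simp: \<delta>'_def min_def field_simps)
  define K where "K = max 0 (- ln \<delta>')"
  have K: "0 \<le> K" "exp (- K) \<le> \<delta>'"
  proof -
    have "exp (- K) \<le> exp (ln \<delta>')" by (simp add: K_def)
    then show "exp (- K) \<le> \<delta>'" using \<delta>' by simp
  qed (simp add: K_def)
  \<comment> \<open>the first summand is the barrier in the imaginary part, the second localises to the arc\<close>
  define h where "h = (\<lambda>z. - K * (max 0 (\<bar>Im (F z)\<bar> - 2) + 2 / \<tau> * infdist z J))"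
  have hc: "continuous_on (sphere 0 1) h" unfolding h_def
    by (intro continuous_intros entire_continuous[OF hol])
  have h0: "h z \<le> 0" for z using K \<tau> by (auto simp: h_def infdist_nonneg)
  obtain A where A: "A holomorphic_on UNIV"
    and A1: "\<And>z. z \<in> cball 0 1 \<Longrightarrow> norm (A z) \<le> 1"
    and Aup: "\<And>z. z \<in> sphere 0 1 \<Longrightarrow> norm (A z) \<le> exp (h z)"
    and Alo: "\<And>z. z \<in> sphere 0 1 \<Longrightarrow> exp (h z) / 2 \<le> norm (A z)"
    using entire_with_modulus_on_circle[OF hc h0] by blast
  have tiny: "norm (A z) \<le> \<delta>'" if z: "z \<in> sphere 0 1" and or: "3 \<le> \<bar>Im (F z)\<bar> \<or> \<tau> / 2 \<le> infdist z J" for z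
  proof -
    have "1 \<le> max 0 (\<bar>Im (F z)\<bar> - 2) + 2 / \<tau> * infdist z J"
      using or
    proof
      assume "3 \<le> \<bar>Im (F z)\<bar>"
      then show ?thesis using \<tau> infdist_nonneg[of z J] by (auto intro: add_increasing2)
    next
      assume "\<tau> / 2 \<le> infdist z J"
      then have "1 \<le> 2 / \<tau> * infdist z J" using \<tau> by (simp add: field_simps)
      then show ?thesis by simp
    qed
    then have "h z \<le> - K" unfolding h_def using K(1) mult_left_mono[of 1 _ K] by simp
    then have "exp (h z) \<le> exp (- K)" by simp
    then show ?thesis using Aup[OF z] K(2) by linarith
  qed
  obtain b' where b': "b' < 3 * \<alpha>" "\<forall>\<^sub>F n in sequentially. \<forall>z\<in>ball 0 1.
           (1 - (norm z)\<^sup>2) * norm (deriv (\<lambda>z. F z + \<alpha> * A z * z ^ n) z) \<le> b'"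
    using bloch_bound_lacunary_step[OF hol A A1 \<alpha>(1) b0] by blast
  have ev2: "\<forall>\<^sub>F n in sequentially. \<forall>z\<in>cball 0 1. \<tau> \<le> infdist z J \<longrightarrow> norm (A z * z ^ n) \<le> 2 * \<delta>'"
    by (rule lacunary_term_small_off_set[OF A A1 \<delta>'(1) \<tau>]) (use tiny in auto)
  have a1: "\<alpha> \<le> 1" using \<alpha> by simp
  note ev3 = arc_integral_exp_almost_unchanged[OF hol A A1 \<alpha>(1) a1 ab(2) \<delta>]
  note ev4 = arc_length_gain[OF hol A A1 \<alpha>(1) a1 ab(2) \<delta>]
  obtain n where n1: "\<forall>z\<in>ball 0 1. (1 - (norm z)\<^sup>2) * norm (deriv (\<lambda>z. F z + \<alpha> * A z * z ^ n) z) \<le> b'"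
    and n2: "\<forall>z\<in>cball 0 1. \<tau> \<le> infdist z J \<longrightarrow> norm (A z * z ^ n) \<le> 2 * \<delta>'"
    and n3: "norm (integral {a..b} (\<lambda>t. exp (F (cis t) + \<alpha> * A (cis t) * cis t ^ n) * cis t)
           - integral {a..b} (\<lambda>t. exp (F (cis t)) * cis t)) \<le> \<delta>"
    and n4: "integral {a..b} (\<lambda>t. norm (exp (F (cis t))))
       + \<alpha>\<^sup>2 / 8 * integral {a..b} (\<lambda>t. norm (exp (F (cis t))) * (norm (A (cis t)))\<^sup>2) - \<delta>
     \<le> integral {a..b} (\<lambda>t. norm (exp (F (cis t) + \<alpha> * A (cis t) * cis t ^ n)))"
    using eventually_happens[OF eventually_conj[OF b'(2) eventually_conj[OF ev2 eventually_conj[OF ev3 ev4]]]]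
    by auto
  define G where "G = (\<lambda>z. F z + \<alpha> * A z * z ^ n)"
  have G: "G holomorphic_on UNIV" unfolding G_def by (intro holomorphic_intros hol A)
  have diff: "norm (G z - F z) = \<alpha> * norm (A z * z ^ n)" for z
    using \<alpha> by (simp add: G_def norm_mult)
  have zn: "norm (A z * z ^ n) \<le> norm (A z)" if "z \<in> cball 0 1" for z
  proof -
    have "norm (A z * z ^ n) \<le> norm (A z) * 1"
      unfolding norm_mult norm_power using that by (intro mult_left_mono power_le_one) auto
    then show ?thesis by simp
  qed
  have small: "norm (G z - F z) \<le> \<alpha>" if "z \<in> cball 0 1" for z
    unfolding diff using \<alpha> zn[OF that] A1[OF that] by (simp add: mult_left_le)
  define B where "B = max (m + \<delta>') (3 + \<alpha>)"
  have B: "B < 4" using \<delta>' \<alpha> by (simp add: B_def)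
  have Imdiff: "\<bar>Im (G z)\<bar> \<le> \<bar>Im (F z)\<bar> + norm (G z - F z)" for z
    using abs_Im_le_cmod[of "G z - F z"] by simp
  have "\<bar>Im (G z)\<bar> \<le> B" if z: "z \<in> sphere 0 1" for z
  proof (cases "3 \<le> \<bar>Im (F z)\<bar>")
    case True
    have "norm (G z - F z) \<le> 1 * \<delta>'" unfolding diff
      using zn[of z] tiny[OF z] True z a1 \<alpha> by (intro mult_mono) auto
    then show ?thesis using Imdiff[of z] m(2)[of z] z by (simp add: B_def)
  next
    case False
    then show ?thesis using Imdiff[of z] small[of z] z by (simp add: B_def)
  qed
  then have ImB: "\<bar>Im (G z)\<bar> < 4" if "z \<in> cball 0 1" for z
    using Im_maximum_principle[OF G _ that, of B] B by fastforce
  have adm: "admissible \<alpha> G"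
    unfolding admissible_def using G b'(1) n1 ImB unfolding G_def[symmetric] by blast
  have off: "norm (G z - F z) \<le> \<delta>" if "z \<in> cball 0 1" "\<tau> \<le> infdist z (cis ` {a..b})" for z
  proof -
    have "norm (A z * z ^ n) \<le> 2 * \<delta>'" using n2 that by (simp add: J_def)
    then have "\<alpha> * norm (A z * z ^ n) \<le> 1 * (2 * \<delta>')" using \<alpha> by (intro mult_mono) auto
    then show ?thesis using \<delta>' by (simp add: diff)
  qed
  have chord: "norm (image_chord a b G - image_chord a b F) \<le> \<delta>"
    using n3 by (simp add: image_chord_def G_def)
  \<comment> \<open>where \<open>Re (exp (F z) * z) > 0\<close> on the arc, \<open>|Im F| \<le> 2\<close> and hence \<open>|A| \<ge> 1 / 2\<close>\<close>
  have ptw: "Re (exp (F (cis t)) * cis t) \<le> 4 * (norm (exp (F (cis t))) * (norm (A (cis t)))\<^sup>2)"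
    if t: "t \<in> {a..b}" for t
  proof -
    define w where "w = F (cis t)"
    have w4: "\<bar>Im w\<bar> < 4" using F by (auto simp: w_def admissible_def)
    have "exp w * cis t = of_real (exp (Re w)) * cis (Im w + t)"
      by (simp add: exp_eq_polar cis_mult[symmetric])
    then have re: "Re (exp w * cis t) = exp (Re w) * cos (Im w + t)" by simp
    show ?thesis
    proof (cases "pi / 2 \<le> \<bar>Im w + t\<bar>")
      case True
      have "cos (Im w + t) \<le> 0"
        by (rule cos_nonpos_middle[OF True]) (use abs_triangle_ineq[of "Im w" t] w4 t ab pi_gt3 in auto)
      then have "Re (exp w * cis t) \<le> 0" unfolding re by (simp add: mult_nonneg_nonpos)
      also have "0 \<le> 4 * (norm (exp w) * (norm (A (cis t)))\<^sup>2)" by simp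
      finally show ?thesis by (simp only: w_def)
    next
      case False
      then have "\<bar>Im w\<bar> \<le> 2" using abs_triangle_ineq[of "Im w + t" "- t"] t ab pi_approx(2) by auto
      moreover have "infdist (cis t) J = 0" using t by (simp add: J_def)
      ultimately have "h (cis t) = 0" by (simp add: h_def w_def)
      then have "1 / 2 \<le> norm (A (cis t))" using Alo[of "cis t"] by simp
      then have "(1 / 2)\<^sup>2 \<le> (norm (A (cis t)))\<^sup>2" by (intro power_mono) auto
      then have q: "1 \<le> 4 * (norm (A (cis t)))\<^sup>2" by (simp add: power2_eq_square)
      have "Re (exp w * cis t) \<le> norm (exp w) * 1" unfolding re by simp
      also have "\<dots> \<le> norm (exp w) * (4 * (norm (A (cis t)))\<^sup>2)" by (intro mult_left_mono q) simp
      finally show ?thesis by (simp add: w_def)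
    qed
  qed
  have "Re (image_chord a b F) = integral {a..b} (\<lambda>t. Re (exp (F (cis t)) * cis t))"
    unfolding image_chord_def
    by (rule integral_unique[symmetric], rule has_integral_Re, rule integrable_integral)
      (intro integrable_continuous_interval continuous_intros hol)
  also have "\<dots> \<le> integral {a..b} (\<lambda>t. 4 * (norm (exp (F (cis t))) * (norm (A (cis t)))\<^sup>2))"
    by (rule integral_le[OF _ _ ptw])
       (intro integrable_continuous_interval continuous_intros hol A)+
  also have "\<dots> = 4 * integral {a..b} (\<lambda>t. norm (exp (F (cis t))) * (norm (A (cis t)))\<^sup>2)" by simp
  finally have "\<alpha>\<^sup>2 / 32 * Re (image_chord a b F)
      \<le> \<alpha>\<^sup>2 / 32 * (4 * integral {a..b} (\<lambda>t. norm (exp (F (cis t))) * (norm (A (cis t)))\<^sup>2))"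
    by (rule mult_left_mono) simp
  also have "\<dots> = \<alpha>\<^sup>2 / 8 * integral {a..b} (\<lambda>t. norm (exp (F (cis t))) * (norm (A (cis t)))\<^sup>2)"
    by (simp only: times_divide_eq_left mult.left_commute)
  finally have "\<alpha>\<^sup>2 / 32 * Re (image_chord a b F)
      \<le> \<alpha>\<^sup>2 / 8 * integral {a..b} (\<lambda>t. norm (exp (F (cis t))) * (norm (A (cis t)))\<^sup>2)" .
  then have "image_length a b F + \<alpha>\<^sup>2 / 32 * Re (image_chord a b F) - \<delta> \<le> image_length a b G"
    using n4 unfolding image_length_def G_def by linarith
  with adm off small chord show ?thesis by blast
qed

text \<open>
  The gain per step is proportional to the real part of the chord, which the steps do not change
  noticeably.  Hence \<open>m\<close> steps gain \<open>m\<close> times as much, where \<open>m\<close> is arbitrary.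
\<close>

lemma admissible_iterate:
  fixes \<alpha> \<tau> a b :: real
  assumes F: "admissible \<alpha> F" and \<alpha>: "0 < \<alpha>" "\<alpha> \<le> 1 / 2"
    and ab: "0 \<le> a" "a \<le> b" "b \<le> 1 / 4" and \<tau>: "0 < \<tau>" and \<delta>: "0 < \<delta>"
  shows "\<exists>F'. admissible \<alpha> F' \<and>
     (\<forall>z\<in>cball 0 1. \<tau> \<le> infdist z (cis ` {a..b}) \<longrightarrow> norm (F' z - F z) \<le> \<delta>) \<and>
     (\<forall>z\<in>cball 0 1. norm (F' z - F z) \<le> real m * \<alpha>) \<and>
     norm (image_chord a b F' - image_chord a b F) \<le> \<delta> \<and>
     image_length a b F + real m * (\<alpha>\<^sup>2 / 32) * Re (image_chord a b F) - \<delta> \<le> image_length a b F'"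
  using \<delta>
proof (induction m arbitrary: \<delta>)
  case 0
  then show ?case using F by (intro exI[of _ F]) auto
next
  case (Suc m)
  define c where "c = \<alpha>\<^sup>2 / 32"
  have "\<alpha>\<^sup>2 \<le> 1\<^sup>2" using \<alpha> by (intro power_mono) auto
  then have c: "0 \<le> c" "c \<le> 1" by (auto simp: c_def)
  define e where "e = \<delta> / 4"
  have e: "0 < e" "\<delta> = 4 * e" using Suc.prems by (auto simp: e_def)
  obtain G where G: "admissible \<alpha> G"
    "\<And>z. \<lbrakk>z\<in>cball 0 1; \<tau> \<le> infdist z (cis ` {a..b})\<rbrakk> \<Longrightarrow> norm (G z - F z) \<le> e"
    "\<And>z. z\<in>cball 0 1 \<Longrightarrow> norm (G z - F z) \<le> real m * \<alpha>"
    "norm (image_chord a b G - image_chord a b F) \<le> e"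
    "image_length a b F + real m * c * Re (image_chord a b F) - e \<le> image_length a b G"
    using Suc.IH[OF e(1)] unfolding c_def by blast
  obtain H where H: "admissible \<alpha> H"
    "\<And>z. \<lbrakk>z\<in>cball 0 1; \<tau> \<le> infdist z (cis ` {a..b})\<rbrakk> \<Longrightarrow> norm (H z - G z) \<le> e"
    "\<And>z. z\<in>cball 0 1 \<Longrightarrow> norm (H z - G z) \<le> \<alpha>"
    "norm (image_chord a b H - image_chord a b G) \<le> e"
    "image_length a b G + c * Re (image_chord a b G) - e \<le> image_length a b H"
    using admissible_step[OF G(1) \<alpha> ab \<tau> e(1)] unfolding c_def by blast
  have tri: "norm (x - z) \<le> norm (x - y) + norm (y - z)" for x y z :: complex
    using norm_triangle_ineq[of "x - y" "y - z"] by simp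
  have "Re (image_chord a b F) - e \<le> Re (image_chord a b G)"
    using G(4) abs_Re_le_cmod[of "image_chord a b G - image_chord a b F"] by simp
  then have "c * (Re (image_chord a b F) - e) \<le> c * Re (image_chord a b G)"
    using c by (intro mult_left_mono)
  moreover have "c * e \<le> 1 * e" using c e by (intro mult_right_mono) auto
  ultimately have ce: "c * Re (image_chord a b F) - e \<le> c * Re (image_chord a b G)"
    by (simp add: algebra_simps)
  show ?case unfolding c_def[symmetric]
  proof (intro exI[of _ H] conjI ballI impI)
    show "norm (H z - F z) \<le> \<delta>" if "z\<in>cball 0 1" "\<tau> \<le> infdist z (cis ` {a..b})" for z
      using tri[of "H z" "F z" "G z"] G(2)[OF that] H(2)[OF that] e by simp
    show "norm (H z - F z) \<le> real (Suc m) * \<alpha>" if "z\<in>cball 0 1" for z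
      using tri[of "H z" "F z" "G z"] G(3)[OF that] H(3)[OF that] by (simp add: algebra_simps)
    show "norm (image_chord a b H - image_chord a b F) \<le> \<delta>"
      using tri[of "image_chord a b H" "image_chord a b F" "image_chord a b G"] G(4) H(4) e by simp
    show "image_length a b F + real (Suc m) * c * Re (image_chord a b F) - \<delta> \<le> image_length a b H"
      using G(5) H(5) ce e by (simp add: algebra_simps)
  qed (rule H(1))
qed

section \<open>Arcs shrinking to the point 1\<close>

text \<open>
  The number \<open>m\<close> of steps depends only on \<open>K\<close> and \<open>\<alpha>\<close>: for small \<open>r\<close> the function \<open>F\<close> is nearly constant on the
  arc \<open>{cis t | r \<le> t \<le> 2 r}\<close>, so that its chord is at least \<open>r / 200\<close>, and \<open>m\<close> is chosen so that
  \<open>m \<alpha>\<^sup>2 / 32 \<ge> 200 (K + 1)\<close>.  Therefore \<open>|F' - F| \<le> m \<alpha>\<close> is known before \<open>r\<close> is chosen, and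
  \<open>r\<close> can be taken so small that the increase of length near the arc is negligible.  The point \<open>1 - r\<close>
  has distance \<open>r\<close> from the circle and at least \<open>r\<close> from the arc; the value there controls the chord of
  the limit curve.
\<close>

lemma admissible_block:
  fixes \<alpha> \<rho> \<delta> K :: real
  assumes F: "admissible \<alpha> F" and \<alpha>: "0 < \<alpha>" "\<alpha> \<le> 1 / 2" and F1: "norm (F 1) \<le> 1"
    and \<rho>: "0 < \<rho>" and \<delta>: "0 < \<delta>" and K: "0 \<le> K"
  shows "\<exists>r F'. 0 < r \<and> r < \<rho> \<and> r \<le> 1 / 8 \<and> admissible \<alpha> F' \<and>
     (\<forall>z\<in>cball 0 1 - ball 1 \<rho>. norm (F' z - F z) \<le> \<delta>) \<and>
     norm (F' 1 - F 1) \<le> \<delta> \<and> norm (F' (of_real (1 - r)) - F 1) \<le> \<delta> \<and>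
     K * r \<le> image_length r (2 * r) F' \<and>
     image_length 0 (2 * pi) F' \<le> image_length 0 (2 * pi) F + \<delta>"
proof -
  have hol: "F holomorphic_on UNIV" using F by (simp add: admissible_def)
  define c where "c = \<alpha>\<^sup>2 / 32"
  have c: "0 < c" using \<alpha> by (simp add: c_def)
  \<comment> \<open>the chord of \<open>F\<close> over the arc will be at least \<open>r / 200\<close>\<close>
  obtain m :: nat where m: "(K + 1) * 200 / c \<le> real m" using real_arch_simple by blast
  then have m: "K + 1 \<le> real m * c / 200" using c by (simp add: field_simps)
  define \<kappa> where "\<kappa> = min (\<delta> / 2) (1 / 8)"
  have \<kappa>: "0 < \<kappa>" "\<kappa> \<le> \<delta> / 2" "\<kappa> \<le> 1 / 8" using \<delta> by (auto simp: \<kappa>_def)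
  have "continuous (at 1) F" using entire_continuous[OF hol, of UNIV] by (simp add: continuous_on_eq_continuous_at)
  then obtain \<eta> where \<eta>: "0 < \<eta>" "\<And>z. dist z 1 < \<eta> \<Longrightarrow> dist (F z) (F 1) < \<kappa>"
    using \<kappa>(1) unfolding continuous_at_eps_delta by blast
  \<comment> \<open>bounds \<open>|exp G|\<close> near the arc, after all \<open>m\<close> steps\<close>
  define X where "X = exp (2 + real m * \<alpha>)"
  have X: "0 < X" by (simp add: X_def)
  define r where "r = min (\<rho> / 4) (min (1 / 8) (min (\<eta> / 4) (\<delta> / (6 * X))))"
  have r: "0 < r" "r < \<rho>" "4 * r \<le> \<rho>" "r \<le> 1 / 8" "4 * r \<le> \<eta>"
    using \<rho> \<eta> \<delta> X by (auto simp: r_def)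
  have rX: "3 * r * X \<le> \<delta> / 2"
  proof -
    have "r \<le> \<delta> / (6 * X)" by (simp add: r_def)
    then show ?thesis using X by (simp add: field_simps)
  qed
  define L0 where "L0 = image_length 0 (2 * pi) F"
  have int: "(\<lambda>t. norm (exp (G (cis t)))) integrable_on {a..b}" if "G holomorphic_on UNIV" for G a b
    by (intro integrable_continuous_interval continuous_intros that)
  have L0: "0 \<le> L0" unfolding L0_def image_length_def by (intro integral_nonneg int hol) auto
  define e where "e = min (min 1 (\<delta> / 2)) (min r (\<delta> / (4 * L0 + 4)))"
  have e: "0 < e" "e \<le> 1" "e \<le> \<delta> / 2" "e \<le> r" "e \<le> \<delta> / (4 * L0 + 4)"
  proof -
    show "0 < e" using \<delta> r L0 by (simp add: e_def add_nonneg_pos)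
    show "e \<le> 1" "e \<le> \<delta> / 2" "e \<le> r" "e \<le> \<delta> / (4 * L0 + 4)" unfolding e_def by linarith+
  qed
  have ab: "0 \<le> r" "r \<le> 2 * r" "2 * r \<le> 1 / 4" and \<tau>: "0 < r / 2" using r by auto
  obtain G where G: "admissible \<alpha> G"
    "\<And>z. \<lbrakk>z\<in>cball 0 1; r / 2 \<le> infdist z (cis ` {r..2*r})\<rbrakk> \<Longrightarrow> norm (G z - F z) \<le> e"
    "\<And>z. z\<in>cball 0 1 \<Longrightarrow> norm (G z - F z) \<le> real m * \<alpha>"
    "norm (image_chord r (2*r) G - image_chord r (2*r) F) \<le> e"
    "image_length r (2*r) F + real m * c * Re (image_chord r (2*r) F) - e \<le> image_length r (2*r) G"
    using admissible_iterate[OF F \<alpha> ab \<tau> e(1), of m] unfolding c_def by blast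
  have Ghol: "G holomorphic_on UNIV" using G by (simp add: admissible_def)
  have far: "r / 2 \<le> infdist z (cis ` {r..2*r})" if "\<And>s. s \<in> {r..2*r} \<Longrightarrow> r / 2 \<le> norm (z - cis s)" for z
  proof -
    have ne: "cis ` {r..2*r} \<noteq> {}" using r by auto
    show ?thesis unfolding infdist_notempty[OF ne]
      by (rule cINF_greatest[OF ne]) (use that in \<open>auto simp: dist_norm\<close>)
  qed
  have cis1: "norm (cis t - 1) \<le> \<bar>t\<bar>" for t using norm_cis_diff_le[of t 0] by simp
  have p1: "norm (G z - F z) \<le> \<delta>" if z: "z\<in>cball 0 1 - ball 1 \<rho>" for z
  proof -
    have "r / 2 \<le> norm (z - cis s)" if "s \<in> {r..2*r}" for s
    proof -
      have "\<rho> \<le> norm (z - 1)" using z by (simp add: dist_norm norm_minus_commute)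
      moreover have "norm (z - 1) \<le> norm (z - cis s) + norm (cis s - 1)"
        using norm_triangle_ineq[of "z - cis s" "cis s - 1"] by simp
      ultimately show ?thesis using cis1[of s] that r by simp
    qed
    then show ?thesis using G(2)[of z] far z e by fastforce
  qed
  have p2: "norm (G 1 - F 1) \<le> e"
  proof (rule G(2)[OF _ far])
    show "r / 2 \<le> norm (1 - cis s)" if "s \<in> {r..2*r}" for s
      using norm_cis_diff_ge[of r s 0] that r pi_gt3 by (simp add: norm_minus_commute)
  qed simp
  have p3: "norm (G (of_real (1 - r)) - F 1) \<le> \<delta>"
  proof -
    have "norm (G (of_real (1 - r)) - F (of_real (1 - r))) \<le> e"
    proof (rule G(2)[OF _ far])
      show "complex_of_real (1 - r) \<in> cball 0 1" using r by (simp del: of_real_diff)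
      show "r / 2 \<le> norm (of_real (1 - r) - cis s)" for s
        using norm_triangle_ineq2[of "cis s" "of_real (1 - r)"] r
        by (simp add: norm_minus_commute del: of_real_diff)
    qed
    moreover have "norm (F (of_real (1 - r)) - F 1) < \<kappa>"
    proof -
      have "dist (of_real (1 - r)) (1::complex) < \<eta>" using r by (simp add: dist_norm)
      then show ?thesis using \<eta>(2) by (simp add: dist_norm)
    qed
    ultimately show ?thesis using e \<kappa>
        norm_triangle_ineq[of "G (of_real (1 - r)) - F (of_real (1 - r))" "F (of_real (1 - r)) - F 1"] by simp
  qed
  have Fnear: "norm (F (cis t) - F 1) \<le> \<kappa>" if "0 \<le> t" "t \<le> 3 * r" for t
    using \<eta>(2)[of "cis t"] cis1[of t] that r by (simp add: dist_norm)
  have p4: "K * r \<le> image_length r (2 * r) G"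
  proof -
    have lower: "1 / 200 \<le> Re (exp (F (cis t)) * cis t)" if t: "t \<in> {r..2*r}" for t
    proof -
      define w where "w = F (cis t)"
      have nw: "norm w \<le> 9 / 8"
        using norm_triangle_ineq2[of w "F 1"] Fnear[of t] t r F1 \<kappa> unfolding w_def by auto
      have "\<bar>Im w + t\<bar> \<le> 11 / 8" using abs_triangle_ineq[of "Im w" t] abs_Im_le_cmod[of w] nw t r by auto
      then have "\<bar>Im w + t\<bar>\<^sup>2 \<le> (11 / 8)\<^sup>2" by (intro power_mono) auto
      then have "1 / 20 \<le> cos (Im w + t)" using cos_quadratic_lower[of "Im w + t"]
        by (simp add: power2_eq_square)
      moreover have "1 / 9 \<le> exp (Re w)"
      proof -
        have "exp (2::real) = exp 1 * exp 1" by (simp add: exp_add[symmetric])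
        also have "\<dots> \<le> 3 * 3" by (intro mult_mono exp_le) auto
        finally have "inverse 9 \<le> inverse (exp (2::real))" by (intro le_imp_inverse_le) auto
        also have "\<dots> = exp (- 2)" by (simp add: exp_minus)
        also have "\<dots> \<le> exp (Re w)" using abs_Re_le_cmod[of w] nw by simp
        finally show ?thesis by simp
      qed
      ultimately have "1 / 9 * (1 / 20) \<le> exp (Re w) * cos (Im w + t)" by (intro mult_mono) auto
      moreover have "exp w * cis t = of_real (exp (Re w)) * cis (Im w + t)"
        by (simp add: exp_eq_polar cis_mult[symmetric])
      then have "Re (exp w * cis t) = exp (Re w) * cos (Im w + t)" by simp
      ultimately show ?thesis by (simp add: w_def)
    qed
    have "r / 200 = integral {r..2*r} (\<lambda>t. 1 / 200 :: real)" using r by simp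
    also have "\<dots> \<le> integral {r..2*r} (\<lambda>t. Re (exp (F (cis t)) * cis t))"
      by (rule integral_le[OF _ _ lower])
       (intro integrable_continuous_interval continuous_intros hol)+
    also have "\<dots> = Re (image_chord r (2*r) F)"
      unfolding image_chord_def
      by (rule integral_unique, rule has_integral_Re, rule integrable_integral)
        (intro integrable_continuous_interval continuous_intros hol)
    finally have "real m * c * (r / 200) \<le> real m * c * Re (image_chord r (2*r) F)"
      using c by (intro mult_left_mono) auto
    moreover have "(K + 1) * r \<le> real m * c / 200 * r" using m r by (intro mult_right_mono) auto
    moreover have "0 \<le> image_length r (2*r) F"
      unfolding image_length_def by (intro integral_nonneg int hol) auto
    ultimately show ?thesis using G(5) e by (simp add: algebra_simps)
  qed
  have p5: "image_length 0 (2 * pi) G \<le> L0 + \<delta>"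
  proof -
    have r3: "0 \<le> 3 * r" "3 * r \<le> 2 * pi" using r pi_gt3 by auto
    have spl: "integral {0..3*r} f + integral {3*r..2*pi} f = integral {0..2*pi} f"
      if "f integrable_on {0..2*pi}" for f :: "real \<Rightarrow> real"
      by (rule Henstock_Kurzweil_Integration.integral_combine[OF r3 that])
    have "integral {0..3*r} (\<lambda>t. norm (exp (G (cis t)))) \<le> integral {0..3*r} (\<lambda>t. X)"
    proof (rule integral_le[OF int[OF Ghol] integrable_const_ivl])
      fix t assume t: "t \<in> {0..3*r}"
      have "Re (G (cis t)) \<le> norm (G (cis t))" by (rule complex_Re_le_cmod)
      also have "\<dots> \<le> norm (G (cis t) - F (cis t)) + norm (F (cis t) - F 1) + norm (F 1)"
        using norm_triangle_ineq[of "G (cis t) - F (cis t)" "F (cis t)"]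
          norm_triangle_ineq[of "F (cis t) - F 1" "F 1"] by simp
      also have "\<dots> \<le> 2 + real m * \<alpha>" using G(3)[of "cis t"] Fnear[of t] t F1 \<kappa> by simp
      finally show "norm (exp (G (cis t))) \<le> X" by (simp add: X_def)
    qed
    also have "\<dots> \<le> \<delta> / 2" using rX r by simp
    finally have a1: "integral {0..3*r} (\<lambda>t. norm (exp (G (cis t)))) \<le> \<delta> / 2" .
    have "integral {3*r..2*pi} (\<lambda>t. norm (exp (G (cis t)))) \<le> integral {3*r..2*pi} (\<lambda>t. exp e * norm (exp (F (cis t))))"
    proof (rule integral_le[OF int[OF Ghol]])
      show "(\<lambda>t. exp e * norm (exp (F (cis t)))) integrable_on {3*r..2*pi}"
        by (intro integrable_continuous_interval continuous_intros hol)
      fix t assume t: "t \<in> {3*r..2*pi}"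
      have "norm (G (cis t) - F (cis t)) \<le> e"
      proof (rule G(2)[OF _ far])
        show "r / 2 \<le> norm (cis t - cis s)" if "s \<in> {r..2*r}" for s
          by (rule norm_cis_diff_ge) (use that t r in auto)
      qed simp
      then have "Re (G (cis t)) \<le> e + Re (F (cis t))"
        using complex_Re_le_cmod[of "G (cis t) - F (cis t)"] by simp
      then have "exp (Re (G (cis t))) \<le> exp (e + Re (F (cis t)))" by simp
      then show "norm (exp (G (cis t))) \<le> exp e * norm (exp (F (cis t)))" by (simp add: exp_add)
    qed
    also have "\<dots> = exp e * integral {3*r..2*pi} (\<lambda>t. norm (exp (F (cis t))))" by simp
    also have "\<dots> \<le> exp e * L0"
    proof (intro mult_left_mono)
      have "0 \<le> integral {0..3*r} (\<lambda>t. norm (exp (F (cis t))))" by (intro integral_nonneg int hol) auto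
      then show "integral {3*r..2*pi} (\<lambda>t. norm (exp (F (cis t)))) \<le> L0"
        using spl[OF int[OF hol]] by (simp add: L0_def image_length_def)
    qed simp
    also have "\<dots> \<le> (1 + 2 * e) * L0"
    proof (intro mult_right_mono L0)
      have "exp e \<le> 1 + e + e\<^sup>2" using e by (intro exp_bound) auto
      also have "e\<^sup>2 \<le> e" using e by (simp add: power2_eq_square mult_left_le)
      finally show "exp e \<le> 1 + 2 * e" by simp
    qed
    also have "\<dots> \<le> L0 + \<delta> / 2"
    proof -
      have "e * (4 * L0 + 4) \<le> \<delta>" using e(5) L0 by (simp add: field_simps)
      then show ?thesis using e by (simp add: algebra_simps)
    qed
    finally have a2: "integral {3*r..2*pi} (\<lambda>t. norm (exp (G (cis t)))) \<le> L0 + \<delta> / 2" .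
    show ?thesis using a1 a2 spl[OF int[OF Ghol]] by (simp add: image_length_def)
  qed
  have e\<delta>: "e \<le> \<delta>" using e \<delta> by simp
  show ?thesis
    by (rule exI[of _ r], rule exI[of _ G])
      (use r G(1) p1 p2 p3 p4 p5 e\<delta> in \<open>auto simp: L0_def\<close>)
qed


lemma admissible_zero: "0 < \<alpha> \<Longrightarrow> admissible \<alpha> (\<lambda>_. 0)"
  unfolding admissible_def by (auto intro!: exI[of _ 0])

text \<open>
  Blocks are performed successively with \<open>K = j\<close>.  The arc of the \<open>j\<close>-th block starts at
  \<open>r = 2 \<rho> (Suc j)\<close>, so that the following blocks, which act inside the ball of radius \<open>\<rho> (Suc j) = r / 2\<close> about
  1, hardly affect this arc or the point \<open>1 - r\<close>.
\<close>

lemma admissible_sequence: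
  fixes \<alpha> :: real
  assumes \<alpha>: "0 < \<alpha>" "\<alpha> \<le> 1 / 2"
  obtains F :: "nat \<Rightarrow> complex \<Rightarrow> complex" and \<rho> :: "nat \<Rightarrow> real"
  where "\<And>j. admissible \<alpha> (F j)" "\<And>j. 0 < \<rho> j" "\<And>j. \<rho> j \<le> 1 / 8" "\<And>j. \<rho> (Suc j) \<le> \<rho> j / 2"
    "\<And>j z. z \<in> cball 0 1 - ball 1 (\<rho> j) \<Longrightarrow> norm (F (Suc j) z - F j z) \<le> (1 / 2) ^ (j + 2)"
    "\<And>j. norm (F (Suc j) (of_real (1 - 2 * \<rho> (Suc j)))) \<le> 2"
    "\<And>j. real j * (2 * \<rho> (Suc j)) \<le> image_length (2 * \<rho> (Suc j)) (4 * \<rho> (Suc j)) (F (Suc j))"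
    "\<And>j. image_length 0 (2 * pi) (F j) \<le> 8"
    "F 0 = (\<lambda>_. 0)"
proof -
  define P where "P = (\<lambda>j (x :: (complex \<Rightarrow> complex) \<times> real). admissible \<alpha> (fst x) \<and> 0 < snd x \<and> snd x \<le> 1 / 8 \<and>
      norm (fst x 1) \<le> 1 - (1 / 2) ^ j \<and> image_length 0 (2 * pi) (fst x) \<le> 8 - (1 / 2) ^ j
      \<and> (j = 0 \<longrightarrow> fst x = (\<lambda>_. 0)))"
  define Q where "Q = (\<lambda>j (x :: (complex \<Rightarrow> complex) \<times> real) (y :: (complex \<Rightarrow> complex) \<times> real). snd y \<le> snd x / 2 \<and>
      (\<forall>z \<in> cball 0 1 - ball 1 (snd x). norm (fst y z - fst x z) \<le> (1 / 2) ^ (j + 2)) \<and>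
      norm (fst y (of_real (1 - 2 * snd y))) \<le> 2 \<and>
      real j * (2 * snd y) \<le> image_length (2 * snd y) (4 * snd y) (fst y))"
  have "\<exists>f. \<forall>n. P n (f n) \<and> Q n (f n) (f (Suc n))"
  proof (rule dependent_nat_choice)
    have "image_length 0 (2 * pi) (\<lambda>_. 0) = 2 * pi" by (simp add: image_length_def)
    then show "\<exists>x. P 0 x"
      using \<alpha> pi_approx(2) by (intro exI[of _ "(\<lambda>_. 0, 1 / 8)"]) (simp add: P_def admissible_zero)
  next
    fix x n assume x: "P n x"
    define \<delta> :: real where "\<delta> = (1 / 2) ^ (n + 2)"
    have \<delta>: "0 < \<delta>" "\<delta> \<le> 1 / 4" "2 * \<delta> = (1 / 2) ^ Suc n" "4 * \<delta> = (1 / 2) ^ n"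
      by (auto simp: \<delta>_def power_le_one)
    have x1: "norm (fst x 1) \<le> 1" using x \<delta> unfolding P_def \<delta>(4)[symmetric] by simp
    obtain r G where G: "0 < r" "r < snd x" "r \<le> 1 / 8" "admissible \<alpha> G"
      "\<And>z. z\<in>cball 0 1 - ball 1 (snd x) \<Longrightarrow> norm (G z - fst x z) \<le> \<delta>"
      "norm (G 1 - fst x 1) \<le> \<delta>" "norm (G (of_real (1 - r)) - fst x 1) \<le> \<delta>"
      "real n * r \<le> image_length r (2 * r) G"
      "image_length 0 (2 * pi) G \<le> image_length 0 (2 * pi) (fst x) + \<delta>"
      using admissible_block[of \<alpha> "fst x" "snd x" \<delta> "real n"] x \<alpha> x1 \<delta> unfolding P_def by auto
    have "norm (G 1) \<le> norm (fst x 1) + \<delta>"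
      using norm_triangle_ineq2[of "G 1" "fst x 1"] G(6) by simp
    moreover have "norm (G (of_real (1 - r))) \<le> 2"
      using norm_triangle_ineq2[of "G (of_real (1 - r))" "fst x 1"] G(7) x1 \<delta> by linarith
    ultimately have "P (Suc n) (G, r / 2) \<and> Q n x (G, r / 2)"
      unfolding P_def Q_def \<delta>_def[symmetric] \<delta>(3)[symmetric] using G x \<delta> unfolding P_def \<delta>(4)[symmetric]
      by auto
    then show "\<exists>y. P (Suc n) y \<and> Q n x y" by blast
  qed
  then obtain f where f: "\<And>n. P n (f n)" "\<And>n. Q n (f n) (f (Suc n))" by blast
  show ?thesis
  proof (rule that[of "\<lambda>j. fst (f j)" "\<lambda>j. snd (f j)"])
    show "image_length 0 (2 * pi) (fst (f j)) \<le> 8" for j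
    proof -
      have "(0::real) \<le> (1 / 2) ^ j" by simp
      then show ?thesis using f(1)[of j] unfolding P_def by linarith
    qed
    show "fst (f 0) = (\<lambda>_. 0)" using f(1)[of 0] by (simp add: P_def)
  qed (use f in \<open>unfold P_def Q_def, blast+\<close>)
qed

section \<open>The limit function and its primitive\<close>

text \<open>
  The properties of a sequence obtained from \<open>admissible_sequence\<close>, together with the bound on \<open>\<alpha>\<close>
  under which the distortion estimates apply with Bloch bound \<open>1 / 20\<close>.
\<close>

locale admissible_limit =
  fixes \<alpha> :: real and F :: "nat \<Rightarrow> complex \<Rightarrow> complex" and \<rho> :: "nat \<Rightarrow> real"
  assumes \<alpha>: "0 < \<alpha>" "\<alpha> \<le> 1 / 60"
    and adm: "admissible \<alpha> (F j)"
    and \<rho>_pos: "0 < \<rho> j" and \<rho>_le: "\<rho> j \<le> 1 / 8" and \<rho>_half: "\<rho> (Suc j) \<le> \<rho> j / 2"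
    and F_step: "z \<in> cball 0 1 - ball 1 (\<rho> j) \<Longrightarrow> norm (F (Suc j) z - F j z) \<le> (1 / 2) ^ (j + 2)"
    and F_centre: "norm (F (Suc j) (of_real (1 - 2 * \<rho> (Suc j)))) \<le> 2"
    and F_long: "real j * (2 * \<rho> (Suc j)) \<le> image_length (2 * \<rho> (Suc j)) (4 * \<rho> (Suc j)) (F (Suc j))"
    and F_length: "image_length 0 (2 * pi) (F j) \<le> 8"
    and F_0: "F 0 = (\<lambda>_. 0)"
begin

lemma F_holo: "F j holomorphic_on UNIV"
  using adm[of j] by (simp add: admissible_def)

lemma F_bloch_square:
  assumes "z \<in> ball 0 1" shows "(1 - (norm z)\<^sup>2) * norm (deriv (F j) z) \<le> 3 * \<alpha>"
proof -
  obtain b where "b < 3 * \<alpha>" "(1 - (norm z)\<^sup>2) * norm (deriv (F j) z) \<le> b"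
    using adm[of j] assms unfolding admissible_def by blast
  then show ?thesis by simp
qed

lemma F_bloch:
  assumes "z \<in> ball 0 1" shows "(1 - norm z) * norm (deriv (F j) z) \<le> 1 / 20"
proof -
  have "(norm z)\<^sup>2 \<le> norm z" using assms by (simp add: power2_eq_square mult_left_le)
  then have "(1 - norm z) * norm (deriv (F j) z) \<le> (1 - (norm z)\<^sup>2) * norm (deriv (F j) z)"
    by (intro mult_right_mono) auto
  then show ?thesis using F_bloch_square[OF assms, of j] \<alpha> by simp
qed

lemma F_Im: "z \<in> cball 0 1 \<Longrightarrow> \<bar>Im (F j z)\<bar> < 4"
  using adm[of j] by (simp add: admissible_def)

lemma \<rho>_antimono: "j \<le> k \<Longrightarrow> \<rho> k \<le> \<rho> j"
proof (rule lift_Suc_antimono_le[of \<rho>])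
  show "\<rho> (Suc n) \<le> \<rho> n" for n using \<rho>_half[of n] \<rho>_pos[of n] by simp
qed

lemma \<rho>_le_power: "\<rho> j \<le> (1 / 2) ^ j"
proof (induction j)
  case 0 then show ?case using \<rho>_le[of 0] by simp
next
  case (Suc j) then show ?case using \<rho>_half[of j] by simp
qed

lemma \<rho>_tendsto: "\<rho> \<longlonglongrightarrow> 0"
proof (rule Lim_null_comparison)
  show "\<forall>\<^sub>F j in sequentially. norm (\<rho> j) \<le> (1 / 2) ^ j"
    using \<rho>_le_power \<rho>_pos by (simp add: less_imp_le)
  show "(\<lambda>j. (1 / 2 :: real) ^ j) \<longlonglongrightarrow> 0" by (rule LIMSEQ_realpow_zero) auto
qed

text \<open>
  A geometric series: outside the ball of radius \<open>\<rho> j\<close> all later changes are summable.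
\<close>

lemma F_diff_le:
  assumes z: "z \<in> cball 0 1 - ball 1 (\<rho> j)" and jk: "j \<le> k"
  shows "norm (F k z - F j z) \<le> (1 / 2) ^ (j + 1)"
proof -
  have "norm (F k z - F j z) \<le> (1 / 2) ^ (j + 1) - (1 / 2) ^ (k + 1)"
    using jk
  proof (induction k rule: dec_induct)
    case base then show ?case by simp
  next
    case (step k)
    have "z \<in> cball 0 1 - ball 1 (\<rho> k)" using z \<rho>_antimono[OF step(1)] by auto
    then have "norm (F (Suc k) z - F k z) \<le> (1 / 2) ^ (k + 2)" by (rule F_step)
    then show ?case using step.IH norm_triangle_ineq[of "F (Suc k) z - F k z" "F k z - F j z"] by simp
  qed
  moreover have "(0::real) \<le> (1 / 2) ^ (k + 1)" by simp
  ultimately show ?thesis by linarith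
qed

text \<open>
  Only the values at points of the closed disc other than 1 are meaningful.
\<close>

definition L :: "complex \<Rightarrow> complex" where "L z = lim (\<lambda>j. F j z)"

lemma F_tendsto:
  assumes z: "z \<in> cball 0 1" "z \<noteq> 1" shows "(\<lambda>j. F j z) \<longlonglongrightarrow> L z"
proof -
  have "Cauchy (\<lambda>j. F j z)"
  proof (rule CauchyI')
    fix e :: real assume e: "0 < e"
    have "(\<lambda>j. (1 / 2 :: real) ^ (j + 1)) \<longlonglongrightarrow> 0"
      by (rule LIMSEQ_ignore_initial_segment) (rule LIMSEQ_realpow_zero, auto)
    then have "\<forall>\<^sub>F j in sequentially. (1 / 2 :: real) ^ (j + 1) < e" using e by (rule order_tendstoD)
    moreover have "\<forall>\<^sub>F j in sequentially. \<rho> j < dist 1 z"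
      using \<rho>_tendsto z by (intro order_tendstoD) auto
    ultimately have "\<forall>\<^sub>F j in sequentially. (1 / 2 :: real) ^ (j + 1) < e \<and> \<rho> j < dist 1 z"
      by (rule eventually_conj)
    then obtain j where j: "(1 / 2 :: real) ^ (j + 1) < e" "\<rho> j < dist 1 z"
      using eventually_happens'[OF sequentially_bot] by blast
    have zj: "z \<in> cball 0 1 - ball 1 (\<rho> m)" if "j \<le> m" for m
      using z j \<rho>_antimono[OF that] by auto
    have "norm (F m z - F n z) < e" if "j \<le> m" "m < n" for m n
    proof -
      have "norm (F n z - F m z) \<le> (1 / 2) ^ (m + 1)" using F_diff_le[OF zj[OF that(1)]] that by simp
      also have "\<dots> \<le> (1 / 2) ^ (j + 1)" using that by (intro power_decreasing) auto
      finally show ?thesis using j by (simp add: norm_minus_commute)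
    qed
    then show "\<exists>M. \<forall>m\<ge>M. \<forall>n>m. dist (F m z) (F n z) < e"
      unfolding dist_norm by blast
  qed
  then show ?thesis unfolding L_def by (simp add: Cauchy_convergent_iff convergent_LIMSEQ_iff)
qed

lemma L_diff_le:
  assumes z: "z \<in> cball 0 1 - ball 1 (\<rho> j)"
  shows "norm (L z - F j z) \<le> (1 / 2) ^ (j + 1)"
proof (rule Lim_norm_ubound[where f = "\<lambda>k. F k z - F j z"])
  have "z \<noteq> 1" using z \<rho>_pos[of j] by auto
  then show "(\<lambda>k. F k z - F j z) \<longlonglongrightarrow> L z - F j z"
    using z by (intro tendsto_diff F_tendsto tendsto_const) auto
  show "\<forall>\<^sub>F k in sequentially. norm (F k z - F j z) \<le> (1 / 2) ^ (j + 1)"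
    using eventually_ge_at_top[of j] by eventually_elim (rule F_diff_le[OF z])
qed simp

lemma F_uniform_limit:
  assumes e: "0 < e" and S: "S \<subseteq> cball 0 1 - ball 1 e"
  shows "uniform_limit S F L sequentially"
proof (rule uniform_limitI)
  fix d :: real assume d: "0 < d"
  have "(\<lambda>j. (1 / 2 :: real) ^ (j + 1)) \<longlonglongrightarrow> 0"
    by (rule LIMSEQ_ignore_initial_segment) (rule LIMSEQ_realpow_zero, auto)
  then have "\<forall>\<^sub>F j in sequentially. (1 / 2 :: real) ^ (j + 1) < d" using d by (rule order_tendstoD)
  moreover have "\<forall>\<^sub>F j in sequentially. \<rho> j < e"
    using \<rho>_tendsto e by (intro order_tendstoD) auto
  ultimately show "\<forall>\<^sub>F j in sequentially. \<forall>z\<in>S. dist (F j z) (L z) < d"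
  proof eventually_elim
    case (elim j)
    show ?case
    proof
      fix z assume z: "z \<in> S"
      have "ball 1 (\<rho> j) \<subseteq> ball (1::complex) e" using elim by (intro subset_ball) simp
      then have "norm (L z - F j z) \<le> (1 / 2) ^ (j + 1)" using z S by (intro L_diff_le) blast
      then show "dist (F j z) (L z) < d" using elim by (simp add: dist_norm norm_minus_commute)
    qed
  qed
qed

lemma L_continuous: "continuous_on (cball 0 1 - {1}) L"
  unfolding continuous_on_eq_continuous_within
proof
  fix z :: complex assume z: "z \<in> cball 0 1 - {1}"
  define e where "e = dist 1 z / 2"
  have e: "0 < e" "z \<in> - cball 1 e" using z by (auto simp: e_def)
  have "continuous_on (cball 0 1 - cball 1 e) L"
  proof (rule uniform_limit_theorem)
    show "uniform_limit (cball 0 1 - cball 1 e) F L sequentially"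
      by (rule F_uniform_limit[of e]) (use e in auto)
  qed (auto intro!: always_eventually entire_continuous F_holo)
  then have "continuous (at z within cball 0 1 - cball 1 e) L"
    using z e by (simp add: continuous_on_eq_continuous_within)
  moreover have "at z within cball 0 1 - {1} = at z within cball 0 1 - cball 1 e"
    by (rule at_within_nhd[of z "- cball 1 e"]) (use e in auto)
  ultimately show "continuous (at z within cball 0 1 - {1}) L" by simp
qed

lemma F_locally_uniform:
  assumes x: "x \<in> ball 0 1"
  shows "\<exists>d. 0 < d \<and> cball x d \<subseteq> ball 0 1 \<and> uniform_limit (cball x d) F L sequentially"
proof -
  define d where "d = (1 - norm x) / 2"
  have d: "0 < d" "norm x = 1 - 2 * d" using x by (auto simp: d_def field_simps)
  have b: "norm z \<le> 1 - d" if "z \<in> cball x d" for z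
    using that norm_triangle_ineq2[of z x] d by (auto simp: dist_norm norm_minus_commute)
  have c: "d \<le> norm (1 - z)" if "z \<in> cball x d" for z
    using b[OF that] norm_triangle_ineq2[of 1 z] by simp
  have "z \<in> ball 0 1" if "z \<in> cball x d" for z using b[OF that] d by simp
  then have "cball x d \<subseteq> ball 0 1" by blast
  moreover have "z \<in> cball 0 1 - ball 1 d" if "z \<in> cball x d" for z
    using b[OF that] c[OF that] d by (simp add: dist_norm)
  then have "cball x d \<subseteq> cball 0 1 - ball 1 d" by blast
  then have "uniform_limit (cball x d) F L sequentially" using d by (intro F_uniform_limit[of d])
  ultimately show ?thesis using d by blast
qed

lemma L_holo: "L holomorphic_on ball 0 1"
proof (rule holomorphic_uniform_sequence[of _ F])
  show "F n holomorphic_on ball 0 1" for n by (rule holomorphic_on_subset[OF F_holo]) simp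
qed (use F_locally_uniform in auto)

lemma L_bloch:
  assumes z: "z \<in> ball 0 1" shows "(1 - (norm z)\<^sup>2) * norm (deriv L z) \<le> 3 * \<alpha>"
proof -
  have "\<exists>g'. \<forall>x \<in> ball 0 1. (L has_field_derivative g' x) (at x) \<and> ((\<lambda>n. deriv (F n) x) \<longlongrightarrow> g' x) sequentially"
    by (rule has_complex_derivative_uniform_sequence[of "ball 0 1" F])
       (use F_locally_uniform holomorphic_derivI[OF F_holo open_UNIV] in auto)
  then obtain d where d: "(L has_field_derivative d) (at z)" "(\<lambda>n. deriv (F n) z) \<longlonglongrightarrow> d"
    using z by blast
  then have "(\<lambda>n. deriv (F n) z) \<longlonglongrightarrow> deriv L z" using DERIV_imp_deriv[OF d(1)] by simp
  then have "(\<lambda>n. (1 - (norm z)\<^sup>2) * norm (deriv (F n) z)) \<longlonglongrightarrow> (1 - (norm z)\<^sup>2) * norm (deriv L z)"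
    by (intro tendsto_intros)
  then show ?thesis by (rule LIMSEQ_le_const2) (use F_bloch_square[OF z] in auto)
qed

lemma F_at_0: "norm (F j 0) \<le> 1 / 2"
proof -
  have "0 \<in> cball 0 1 - ball (1::complex) (\<rho> 0)" using \<rho>_le[of 0] by simp
  from F_diff_le[OF this, of j] show ?thesis by (simp add: F_0)
qed

text \<open>
  The growth of Bloch functions with the small bound \<open>1 / 20\<close>, in the weaker form with exponent \<open>1 / 2\<close>,
  which is integrable along radii.
\<close>

lemma F_growth:
  assumes z: "z \<in> ball 0 1" shows "norm (exp (F j z)) \<le> 2 * (1 - norm z) powr (- (1 / 2))"
proof (cases "z = 0")
  case True
  have "norm (exp (F j 0)) \<le> exp (1 / 2)"
    using F_at_0[of j] complex_Re_le_cmod[of "F j 0"] by simp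
  also have "exp (1 / 2) \<le> (2::real)"
    using real_exp_bound_lemma[of "1 / 2"] by simp
  finally show ?thesis using True by simp
next
  case False
  define s where "s = norm z"
  have s: "0 \<le> s" "s < 1" using z by (auto simp: s_def)
  have z_eq: "0 + of_real s * (sgn z - 0) = z" using False by (simp add: s_def sgn_eq)
  have "norm (F j (0 + of_real s * (sgn z - 0)) - F j 0) \<le> - (1 * (1 / 20)) * ln (1 - s)"
    by (rule bloch_growth_along_segment[OF F_holo F_bloch]) (use False s in \<open>auto simp: norm_sgn\<close>)
  then have g: "norm (F j z - F j 0) \<le> - (1 / 20) * ln (1 - s)" unfolding z_eq by simp
  have ln: "ln (1 - s) \<le> 0" using s by simp
  have "Re (F j z) \<le> norm (F j z - F j 0) + norm (F j 0)"
    using complex_Re_le_cmod[of "F j z"] norm_triangle_ineq[of "F j z - F j 0" "F j 0"] by simp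
  also have "\<dots> \<le> - (1 / 2) * ln (1 - s) + 1 / 2" using g F_at_0[of j] ln by simp
  finally have "norm (exp (F j z)) \<le> exp (- (1 / 2) * ln (1 - s)) * exp (1 / 2)"
    by (simp add: exp_add[symmetric])
  also have "\<dots> = (1 - s) powr (- (1 / 2)) * exp (1 / 2)" using s by (simp add: powr_def)
  also have "\<dots> \<le> (1 - s) powr (- (1 / 2)) * 2"
    using real_exp_bound_lemma[of "1 / 2"] by (intro mult_left_mono) auto
  finally show ?thesis by (simp add: s_def mult.commute)
qed

lemma ex_primitive: "\<exists>\<Psi>. (\<forall>z. (\<Psi> has_field_derivative exp (F j z)) (at z)) \<and> \<Psi> 0 = 0"
proof -
  have "(\<lambda>z. exp (F j z)) holomorphic_on UNIV" by (intro holomorphic_intros F_holo)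
  then obtain K where K: "\<And>z. (K has_field_derivative exp (F j z)) (at z)"
    using holomorphic_convex_primitive'[OF convex_UNIV open_UNIV] by auto
  have "((\<lambda>z. K z - K 0) has_field_derivative exp (F j z)) (at z)" for z
    using K[of z] by (auto intro!: derivative_eq_intros)
  then show ?thesis by (intro exI[of _ "\<lambda>z. K z - K 0"]) auto
qed

definition \<Psi> :: "nat \<Rightarrow> complex \<Rightarrow> complex" where
  "\<Psi> j = (SOME \<Psi>. (\<forall>z. (\<Psi> has_field_derivative exp (F j z)) (at z)) \<and> \<Psi> 0 = 0)"

lemma \<Psi>_deriv: "(\<Psi> j has_field_derivative exp (F j z)) (at z)"
  and \<Psi>_0: "\<Psi> j 0 = 0"
  using someI_ex[OF ex_primitive[of j]] unfolding \<Psi>_def by auto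

text \<open>
  The distortion estimate between \<open>p\<close> and the point \<open>(1 - h) p\<close>, uniformly in \<open>j\<close>.
\<close>

lemma \<Psi>_radial:
  assumes h: "0 < h" "h < 1" and p: "p \<in> cball 0 1"
  shows "norm (\<Psi> j p - \<Psi> j (of_real (1 - h) * p)) \<le> 4 * h powr (1 / 2)"
proof -
  define a where "a = of_real (1 - h) * p"
  have "norm a = (1 - h) * norm p" using h by (simp add: a_def norm_mult del: of_real_diff)
  also have "\<dots> \<le> (1 - h) * 1" using h p by (intro mult_left_mono) auto
  finally have na: "norm a \<le> 1 - h" by simp
  then have a: "a \<in> ball 0 1" using h by simp
  have "p - a = of_real h * p" by (simp add: a_def algebra_simps)
  then have "norm (p - a) = h * norm p" using h by (simp add: norm_mult)
  also have "\<dots> \<le> h * 1" using h p by (intro mult_left_mono) auto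
  finally have pa: "norm (p - a) \<le> h" by simp
  have "norm (\<Psi> j p - \<Psi> j a - exp (F j a) * (p - a))
     \<le> norm (exp (F j a)) * norm (p - a) * (1 * (1 / 20) / (1 - 1 * (1 / 20)))"
    by (rule distortion_from_interior_point[OF \<Psi>_deriv F_holo F_bloch a p]) (use pa na in auto)
  also have "\<dots> \<le> norm (exp (F j a)) * norm (p - a) * 1" by (intro mult_left_mono) auto
  finally have "norm (\<Psi> j p - \<Psi> j a) \<le> 2 * (norm (exp (F j a)) * norm (p - a))"
    using norm_triangle_ineq[of "\<Psi> j p - \<Psi> j a - exp (F j a) * (p - a)" "exp (F j a) * (p - a)"]
    by (simp add: norm_mult)
  also have "\<dots> \<le> 2 * ((2 * h powr (- (1 / 2))) * h)"
  proof (intro mult_left_mono mult_mono pa)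
    have "norm (exp (F j a)) \<le> 2 * (1 - norm a) powr (- (1 / 2))" by (rule F_growth[OF a])
    also have "\<dots> \<le> 2 * h powr (- (1 / 2))" using na h by (intro mult_left_mono powr_mono2') auto
    finally show "norm (exp (F j a)) \<le> 2 * h powr (- (1 / 2))" .
  qed auto
  also have "\<dots> = 4 * h powr (1 / 2)"
  proof -
    have "h powr (1 / 2) = h powr (- (1 / 2)) * h powr 1" unfolding powr_add[symmetric] by simp
    then show ?thesis using h by simp
  qed
  finally show ?thesis by (simp add: a_def)
qed

lemma \<Psi>_inner:
  assumes h: "\<rho> j \<le> h" "h < 1" and jk: "j \<le> k" and p: "norm p \<le> 1 - h"
  shows "norm (\<Psi> k p - \<Psi> j p) \<le> 4 * h powr (- (1 / 2)) * (1 / 2) ^ j"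
proof -
  have h0: "0 < h" using \<rho>_pos[of j] h by simp
  have "norm ((\<Psi> k p - \<Psi> j p) - (\<Psi> k 0 - \<Psi> j 0)) \<le> 4 * h powr (- (1 / 2)) * (1 / 2) ^ j * norm (p - 0)"
  proof (rule field_differentiable_bound[where S = "cball 0 (1 - h)" and f = "\<lambda>z. \<Psi> k z - \<Psi> j z"
        and f' = "\<lambda>z. exp (F k z) - exp (F j z)" and x = p and y = 0])
    fix z :: complex assume z: "z \<in> cball 0 (1 - h)"
    show "((\<lambda>z. \<Psi> k z - \<Psi> j z) has_field_derivative exp (F k z) - exp (F j z)) (at z within cball 0 (1 - h))"
      by (rule DERIV_diff[OF has_field_derivative_at_within[OF \<Psi>_deriv]
            has_field_derivative_at_within[OF \<Psi>_deriv]])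
    have zb: "z \<in> ball 0 1" using z h0 by simp
    have "h \<le> norm (1 - z)" using z norm_triangle_ineq2[of 1 z] by simp
    then have "z \<in> cball 0 1 - ball 1 (\<rho> j)" using z h h0 by (simp add: dist_norm)
    then have d: "norm (F k z - F j z) \<le> (1 / 2) ^ (j + 1)" by (rule F_diff_le[OF _ jk])
    have d2: "(1 / 2 :: real) ^ (j + 1) \<le> 1 / 2" using power_decreasing[of 1 "j + 1" "1 / 2 :: real"] by simp
    have "exp (F k z) - exp (F j z) = exp (F j z) * (exp (F k z - F j z) - 1)"
      by (simp add: algebra_simps exp_diff)
    then have "norm (exp (F k z) - exp (F j z)) = norm (exp (F j z)) * norm (exp (F k z - F j z) - 1)"
      by (simp only: norm_mult)
    also have "\<dots> \<le> (2 * h powr (- (1 / 2))) * (2 * (1 / 2) ^ (j + 1))"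
    proof (intro mult_mono)
      have "norm (exp (F j z)) \<le> 2 * (1 - norm z) powr (- (1 / 2))" by (rule F_growth[OF zb])
      also have "\<dots> \<le> 2 * h powr (- (1 / 2))" using z h0 by (intro mult_left_mono powr_mono2') auto
      finally show "norm (exp (F j z)) \<le> 2 * h powr (- (1 / 2))" .
      have "norm (exp (F k z - F j z) - 1) \<le> exp (norm (F k z - F j z)) - 1"
        by (rule norm_exp_minus_one_le)
      also have "\<dots> \<le> 2 * norm (F k z - F j z)"
        using real_exp_bound_lemma[of "norm (F k z - F j z)"] d d2 by simp
      finally show "norm (exp (F k z - F j z) - 1) \<le> 2 * (1 / 2) ^ (j + 1)" using d by simp
    qed auto
    also have "\<dots> \<le> 4 * h powr (- (1 / 2)) * (1 / 2) ^ j" by simp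
    finally show "norm (exp (F k z) - exp (F j z)) \<le> 4 * h powr (- (1 / 2)) * (1 / 2) ^ j" .
  next
    show "p \<in> cball 0 (1 - h)" "0 \<in> cball 0 (1 - h)" using p h by auto
  qed (rule convex_cball)
  also have "\<dots> \<le> 4 * h powr (- (1 / 2)) * (1 / 2) ^ j * 1"
    using p h0 by (intro mult_left_mono) auto
  finally show ?thesis by (simp add: \<Psi>_0)
qed

text \<open>
  Points of the closed disc are first moved inwards by the factor \<open>1 - h\<close>, at a cost that is uniform in \<open>j\<close>; on the smaller disc
  the functions \<open>F j\<close> converge uniformly.  In particular the primitives converge at the point 1, too.
\<close>

lemma \<Psi>_uniformly_Cauchy: "uniformly_Cauchy_on (cball 0 1) \<Psi>"
proof (rule uniformly_Cauchy_onI)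
  fix e :: real assume e: "0 < e"
  have "((\<lambda>h. 4 * h powr (1 / 2)) \<longlongrightarrow> 4 * 0 powr (1 / 2)) (at_right (0::real))"
    by (intro tendsto_intros tendsto_powr') (auto simp: eventually_at_filter)
  then have "\<forall>\<^sub>F h in at_right (0::real). 4 * h powr (1 / 2) < e / 4"
    using e by (intro order_tendstoD(2)[where y = "4 * 0 powr (1 / 2)"]) auto
  moreover have "\<forall>\<^sub>F h in at_right (0::real). h \<in> {0<..<1}"
    by (rule eventually_at_right_real) simp
  ultimately have "\<forall>\<^sub>F h in at_right (0::real). 4 * h powr (1 / 2) < e / 4 \<and> h \<in> {0<..<1}"
    by (rule eventually_conj)
  then obtain h where h: "4 * h powr (1 / 2) < e / 4" "h < 1" "0 < h"
    using eventually_happens'[OF trivial_limit_at_right_real] by fastforce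
  have "(\<lambda>j. 4 * h powr (- (1 / 2)) * (1 / 2 :: real) ^ j) \<longlonglongrightarrow> 0"
    by (intro tendsto_mult_right_zero LIMSEQ_realpow_zero) auto
  then have "\<forall>\<^sub>F j in sequentially. 4 * h powr (- (1 / 2)) * (1 / 2) ^ j < e / 4"
    using e by (intro order_tendstoD(2)[where y = 0]) auto
  moreover have "\<forall>\<^sub>F j in sequentially. \<rho> j < h" using \<rho>_tendsto h by (intro order_tendstoD(2)[where y = 0]) auto
  ultimately have "\<forall>\<^sub>F j in sequentially. 4 * h powr (- (1 / 2)) * (1 / 2) ^ j < e / 4 \<and> \<rho> j < h"
    by (rule eventually_conj)
  then obtain J where J: "\<And>j. J \<le> j \<Longrightarrow> 4 * h powr (- (1 / 2)) * (1 / 2) ^ j < e / 4 \<and> \<rho> j < h"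
    unfolding eventually_sequentially by blast
  have main: "dist (\<Psi> j p) (\<Psi> k p) < e" if p: "p \<in> cball 0 1" and jk: "J \<le> j" "j \<le> k" for j k p
  proof -
    define q where "q = of_real (1 - h) * p"
    have "norm q = (1 - h) * norm p" using h by (simp add: q_def norm_mult del: of_real_diff)
    also have "\<dots> \<le> (1 - h) * 1" using h p by (intro mult_left_mono) auto
    finally have q: "norm q \<le> 1 - h" by simp
    have "norm (\<Psi> k q - \<Psi> j q) \<le> 4 * h powr (- (1 / 2)) * (1 / 2) ^ j"
      using J[OF jk(1)] h jk q by (intro \<Psi>_inner) auto
    moreover have "norm (\<Psi> j p - \<Psi> j q) \<le> 4 * h powr (1 / 2)" "norm (\<Psi> k p - \<Psi> k q) \<le> 4 * h powr (1 / 2)"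
      unfolding q_def using h p by (intro \<Psi>_radial; simp)+
    moreover have "dist (\<Psi> j p) (\<Psi> k p) \<le> dist (\<Psi> j p) (\<Psi> j q) + dist (\<Psi> j q) (\<Psi> k q) + dist (\<Psi> k p) (\<Psi> k q)"
      by metric
    ultimately show ?thesis using h(1) J[OF jk(1)] e by (simp add: dist_norm norm_minus_commute)
  qed
  have "dist (\<Psi> m p) (\<Psi> n p) < e" if "p \<in> cball 0 1" "J \<le> m" "J \<le> n" for m n p
    using main[OF that(1), of m n] main[OF that(1), of n m] that by (cases "m \<le> n") (auto simp: dist_commute)
  then show "\<exists>M. \<forall>x\<in>cball 0 1. \<forall>m\<ge>M. \<forall>n\<ge>M. dist (\<Psi> m x) (\<Psi> n x) < e" by blast
qed

definition \<Phi> :: "complex \<Rightarrow> complex" where "\<Phi> z = lim (\<lambda>j. \<Psi> j z)"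

lemma \<Psi>_uniform_limit: "uniform_limit (cball 0 1) \<Psi> \<Phi> sequentially"
  using \<Psi>_uniformly_Cauchy unfolding uniformly_convergent_eq_Cauchy[symmetric] \<Phi>_def[abs_def]
  by (simp add: uniformly_convergent_uniform_limit_iff)

lemma \<Psi>_tendsto: "z \<in> cball 0 1 \<Longrightarrow> (\<lambda>j. \<Psi> j z) \<longlonglongrightarrow> \<Phi> z"
  using tendsto_uniform_limitI[OF \<Psi>_uniform_limit] .

lemma \<Psi>_holo: "\<Psi> j holomorphic_on S"
  unfolding holomorphic_on_def field_differentiable_def
  using has_field_derivative_at_within[OF \<Psi>_deriv] by blast

lemma \<Phi>_continuous: "continuous_on (cball 0 1) \<Phi>"
  by (rule uniform_limit_theorem[OF _ \<Psi>_uniform_limit])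
     (auto intro!: always_eventually holomorphic_on_imp_continuous_on \<Psi>_holo)

lemma \<Phi>_deriv:
  assumes z: "z \<in> ball 0 1" shows "(\<Phi> has_field_derivative exp (L z)) (at z)"
proof -
  have "\<exists>g'. \<forall>x \<in> ball 0 1. (\<Phi> has_field_derivative g' x) (at x) \<and> ((\<lambda>n. exp (F n x)) \<longlongrightarrow> g' x) sequentially"
  proof (rule has_complex_derivative_uniform_sequence[of "ball 0 1" \<Psi>])
    show "\<exists>d>0. cball x d \<subseteq> ball 0 1 \<and> uniform_limit (cball x d) \<Psi> \<Phi> sequentially"
      if x: "x \<in> ball 0 1" for x
    proof -
      obtain d where "0 < d" "cball x d \<subseteq> ball 0 1" using F_locally_uniform[OF x] by blast
      then show ?thesis using uniform_limit_on_subset[OF \<Psi>_uniform_limit, of "cball x d"] ball_subset_cball[of 0 1]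
        by blast
    qed
  qed (use \<Psi>_deriv in auto)
  then obtain g' where g': "(\<Phi> has_field_derivative g') (at z)" "(\<lambda>n. exp (F n z)) \<longlonglongrightarrow> g'"
    using z by blast
  have "z \<noteq> 1" using z by auto
  then have "(\<lambda>n. exp (F n z)) \<longlonglongrightarrow> exp (L z)" using z by (intro tendsto_intros F_tendsto) auto
  then have "g' = exp (L z)" using g'(2) LIMSEQ_unique by blast
  then show ?thesis using g'(1) by simp
qed

lemma \<Phi>_chord:
  assumes zw: "z \<in> cball 0 1" "w \<in> cball 0 1" "z \<noteq> w"
  shows "norm (\<Phi> z - \<Phi> w - exp (L (whitney_point z w)) * (z - w))
     \<le> norm (exp (L (whitney_point z w))) * dist z w / 2"
proof -
  define a where "a = whitney_point z w"
  have a: "a \<in> ball 0 1" using whitney_point_props(1)[OF zw] by (simp add: a_def)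
  then have "a \<noteq> 1" by auto
  then have Fa: "(\<lambda>j. F j a) \<longlonglongrightarrow> L a" using a by (intro F_tendsto) auto
  have "(\<lambda>j. norm (\<Psi> j z - \<Psi> j w - exp (F j a) * (z - w))) \<longlonglongrightarrow> norm (\<Phi> z - \<Phi> w - exp (L a) * (z - w))"
    by (intro tendsto_intros \<Psi>_tendsto zw Fa)
  moreover have "(\<lambda>j. norm (exp (F j a)) * dist z w / 2) \<longlonglongrightarrow> norm (exp (L a)) * dist z w / 2"
    by (intro tendsto_intros Fa) simp
  ultimately show ?thesis unfolding a_def
    by (rule LIMSEQ_le) (use chord_distortion[OF \<Psi>_deriv F_holo F_bloch zw] in auto)
qed

lemma \<Phi>_chord_lower:
  assumes zw: "z \<in> cball 0 1" "w \<in> cball 0 1" "z \<noteq> w"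
  shows "norm (exp (L (whitney_point z w))) * dist z w \<le> 2 * dist (\<Phi> z) (\<Phi> w)"
  using \<Phi>_chord[OF zw] norm_triangle_ineq2[of "exp (L (whitney_point z w)) * (z - w)" "\<Phi> z - \<Phi> w"]
  by (simp add: dist_norm norm_mult norm_minus_commute)

lemma \<Phi>_inj: "inj_on \<Phi> (cball 0 1)"
proof (rule inj_onI)
  fix z w assume zw: "z \<in> cball 0 1" "w \<in> cball 0 1" "\<Phi> z = \<Phi> w"
  show "z = w"
  proof (rule ccontr)
    assume "z \<noteq> w"
    from \<Phi>_chord_lower[OF zw(1,2) this] zw(3)
    have "norm (exp (L (whitney_point z w))) * dist z w \<le> 0" by simp
    moreover have "0 < norm (exp (L (whitney_point z w))) * dist z w" using \<open>z \<noteq> w\<close> by simp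
    ultimately show False by linarith
  qed
qed

text \<open>
  Points no farther from \<open>z\<close> than \<open>w\<close> are mapped into a disc about the image of the Whitney point
  whose radius is comparable to \<open>|\<Phi> z - \<Phi> w|\<close>.
\<close>

lemma \<Phi>_quasisymmetric:
  assumes zw: "z \<in> cball 0 1" "w \<in> cball 0 1" "z \<noteq> w"
    and p: "p \<in> cball 0 1" "dist p z \<le> dist z w" and q: "q \<in> cball 0 1" "dist q z \<le> dist z w"
  shows "dist (\<Phi> p) (\<Phi> q) \<le> 12 * dist (\<Phi> z) (\<Phi> w)"
proof -
  define a where "a = whitney_point z w"
  have a: "a \<in> ball 0 1" using whitney_point_props(1)[OF zw] by (simp add: a_def)
  then have "a \<noteq> 1" by auto
  then have Fa: "(\<lambda>j. F j a) \<longlonglongrightarrow> L a" using a by (intro F_tendsto) auto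
  have near: "dist (\<Phi> u) (\<Phi> a) \<le> 3 * norm (exp (L a)) * dist z w" if u: "u \<in> cball 0 1" "dist u z \<le> dist z w" for u
  proof -
    have "(\<lambda>j. norm (\<Psi> j u - \<Psi> j a)) \<longlonglongrightarrow> norm (\<Phi> u - \<Phi> a)"
      using a by (intro tendsto_intros \<Psi>_tendsto u) auto
    moreover have "(\<lambda>j. 3 * norm (exp (F j a)) * dist z w) \<longlonglongrightarrow> 3 * norm (exp (L a)) * dist z w"
      by (intro tendsto_intros Fa)
    ultimately show ?thesis unfolding dist_norm[of "\<Phi> u"] unfolding a_def
      by (rule LIMSEQ_le) (use near_point_distortion[OF \<Psi>_deriv F_holo F_bloch zw u] in auto)
  qed
  have "dist (\<Phi> p) (\<Phi> q) \<le> dist (\<Phi> p) (\<Phi> a) + dist (\<Phi> q) (\<Phi> a)" by (rule dist_triangle2)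
  also have "\<dots> \<le> 6 * (norm (exp (L a)) * dist z w)" using near[OF p] near[OF q] by simp
  also have "\<dots> \<le> 6 * (2 * dist (\<Phi> z) (\<Phi> w))"
    unfolding a_def by (intro mult_left_mono \<Phi>_chord_lower zw) simp
  also have "\<dots> = 12 * dist (\<Phi> z) (\<Phi> w)" by simp
  finally show ?thesis .
qed

end

section \<open>Subarcs and lengths of curves\<close>

lemma affine_image:
  fixes a b :: real
  assumes "a \<le> b" shows "(\<lambda>u. a + u * (b - a)) ` {0..1} = {a..b}"
proof (intro equalityI subsetI)
  fix t assume t: "t \<in> {a..b}"
  show "t \<in> (\<lambda>u. a + u * (b - a)) ` {0..1}"
  proof (cases "a = b")
    case True then show ?thesis using t by force
  next
    case False
    then show ?thesis using t assms by (intro image_eqI[of _ _ "(t - a) / (b - a)"]) (auto simp: field_simps)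
  qed
next
  fix t assume "t \<in> (\<lambda>u. a + u * (b - a)) ` {0..1}"
  then obtain u where u: "t = a + u * (b - a)" "u \<in> {0..1}" by blast
  then have "u * (b - a) \<le> 1 * (b - a)" using assms by (intro mult_right_mono) auto
  moreover have "0 \<le> u * (b - a)" using u assms by simp
  ultimately show "t \<in> {a..b}" using u assms by auto
qed

text \<open>
  An arc without its endpoints is connected, so it lies on one side of a decomposition of the curve
  into closed parts that meet only at these endpoints.  Both arcs cannot avoid the part \<open>A\<close>.
\<close>

lemma complementary_subarcs_inside_closed_part:
  assumes h: "complementary_subarcs \<Gamma> z \<zeta> h1 h2"
    and AB: "closed A" "closed B" "A \<union> B = \<Gamma>" "A \<inter> B = {z, \<zeta>}" and A: "\<not> A \<subseteq> {z, \<zeta>}"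
  shows "path_image h1 \<subseteq> A \<or> path_image h2 \<subseteq> A"
proof (rule ccontr)
  assume no: "\<not> (path_image h1 \<subseteq> A \<or> path_image h2 \<subseteq> A)"
  have empty: "A \<inter> (path_image h - {z, \<zeta>}) = {}"
    if a: "arc h" "pathstart h = z" "pathfinish h = \<zeta>" and sub: "path_image h \<subseteq> \<Gamma>" and n: "\<not> path_image h \<subseteq> A" for h
  proof -
    have "connected (path_image h - {z, \<zeta>})"
      using connected_simple_path_endless[OF arc_imp_simple_path[OF a(1)]] a by simp
    then have "A \<inter> (path_image h - {z, \<zeta>}) = {} \<or> B \<inter> (path_image h - {z, \<zeta>}) = {}"
      by (rule connected_closedD) (use AB sub in auto)
    moreover have "B \<inter> (path_image h - {z, \<zeta>}) \<noteq> {}" using n AB sub by blast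
    ultimately show ?thesis by blast
  qed
  have "A \<inter> (path_image h1 - {z, \<zeta>}) = {}" "A \<inter> (path_image h2 - {z, \<zeta>}) = {}"
    using h no unfolding complementary_subarcs_def by (intro empty; blast)+
  moreover have "A \<subseteq> path_image h1 \<union> path_image h2"
    using h AB unfolding complementary_subarcs_def by blast
  ultimately show False using A by blast
qed

lemma path_length_ge_dist:
  assumes "u \<in> {0..1}" "v \<in> {0..1}" "u \<le> v"
  shows "ennreal (dist (h u) (h v)) \<le> path_length h"
proof -
  define t where "t = (\<lambda>i::nat. if i = 0 then u else v)"
  have "(\<Sum>i<1. ennreal (dist (h (t i)) (h (t (Suc i))))) \<le> path_length h"
    unfolding path_length_def by (rule SUP_upper2[of "(1, t)"]) (use assms in \<open>auto simp: t_def\<close>)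
  then show ?thesis by (simp add: t_def)
qed

text \<open>
  The length of a curve with continuous derivative \<open>g\<close> is not less than the integral of \<open>|g|\<close>: on a
  fine partition \<open>g\<close> is nearly constant on each piece, where chord and length then almost agree.
\<close>

lemma integral_norm_le_polygon:
  fixes \<gamma> g :: "real \<Rightarrow> complex"
  assumes ab: "a < b" and g: "continuous_on {a..b} g"
    and \<gamma>: "\<And>u v. \<lbrakk>a \<le> u; u \<le> v; v \<le> b\<rbrakk> \<Longrightarrow> (g has_integral (\<gamma> v - \<gamma> u)) {u..v}"
    and e: "0 < e"
  shows "\<exists>n::nat. 0 < n \<and> integral {a..b} (\<lambda>t. norm (g t)) - e
     \<le> (\<Sum>i<n. dist (\<gamma> (a + real i * ((b - a) / real n))) (\<gamma> (a + real (Suc i) * ((b - a) / real n))))"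
proof -
  define \<eta> where "\<eta> = e / (2 * (b - a))"
  have \<eta>: "0 < \<eta>" using e ab by (simp add: \<eta>_def)
  have "uniformly_continuous_on {a..b} g" using g by (intro compact_uniformly_continuous) auto
  then obtain d where d: "0 < d" "\<And>s t. \<lbrakk>s \<in> {a..b}; t \<in> {a..b}; dist t s < d\<rbrakk> \<Longrightarrow> dist (g t) (g s) < \<eta>"
    using \<eta> unfolding uniformly_continuous_on_def by metis
  obtain n :: nat where n: "(b - a) / d < real n" using reals_Archimedean2 by blast
  have n0: "0 < real n" using n ab d by (meson divide_pos_pos less_trans diff_gt_0_iff_gt)
  define \<Delta> where "\<Delta> = (b - a) / real n"
  have \<Delta>: "0 < \<Delta>" "\<Delta> < d" "real n * \<Delta> = b - a"
    using n n0 ab d by (auto simp: \<Delta>_def field_simps)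
  define p where "p = (\<lambda>i::nat. a + real i * \<Delta>)"
  have p_in: "a \<le> p i" "p i \<le> b" if "i \<le> n" for i
  proof -
    show "a \<le> p i" using \<Delta> by (simp add: p_def)
    have "real i * \<Delta> \<le> real n * \<Delta>" using that \<Delta> by (intro mult_right_mono) auto
    then show "p i \<le> b" using \<Delta> by (simp add: p_def)
  qed
  have p_Suc: "p (Suc i) = p i + \<Delta>" for i by (simp add: p_def algebra_simps)
  have int: "(\<lambda>t. norm (g t)) integrable_on {u..v}" if "a \<le> u" "v \<le> b" for u v
    by (intro integrable_continuous_interval continuous_intros continuous_on_subset[OF g]) (use that in auto)
  have piece: "integral {p i..p (Suc i)} (\<lambda>t. norm (g t)) \<le> dist (\<gamma> (p i)) (\<gamma> (p (Suc i))) + 2 * \<eta> * \<Delta>"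
    if i: "i < n" for i
  proof -
    have b1: "a \<le> p i" "p i \<le> p (Suc i)" "p (Suc i) \<le> b"
      using p_in[of i] p_in[of "Suc i"] i \<Delta> by (auto simp: p_Suc)
    have near: "norm (g t - g (p i)) \<le> \<eta>" if t: "t \<in> {p i..p (Suc i)}" for t
    proof -
      have "dist t (p i) < d" using t \<Delta> by (auto simp: dist_real_def p_Suc)
      then show ?thesis using d(2)[of "p i" t] t b1 by (auto simp: dist_norm less_imp_le)
    qed
    have "integral {p i..p (Suc i)} (\<lambda>t. norm (g t)) \<le> integral {p i..p (Suc i)} (\<lambda>t. norm (g (p i)) + \<eta>)"
    proof (rule integral_le[OF int[OF b1(1,3)] integrable_const_ivl])
      show "norm (g t) \<le> norm (g (p i)) + \<eta>" if "t \<in> {p i..p (Suc i)}" for t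
        using near[OF that] norm_triangle_ineq2[of "g t" "g (p i)"] by simp
    qed
    also have "\<dots> = \<Delta> * (norm (g (p i)) + \<eta>)" using \<Delta> by (simp add: p_Suc)
    finally have up: "integral {p i..p (Suc i)} (\<lambda>t. norm (g t)) \<le> \<Delta> * (norm (g (p i)) + \<eta>)" .
    have "((\<lambda>t. g t - g (p i)) has_integral (\<gamma> (p (Suc i)) - \<gamma> (p i) - \<Delta> *\<^sub>R g (p i))) {p i..p (Suc i)}"
      using has_integral_diff[OF \<gamma>[OF b1] has_integral_const_real[of "g (p i)" "p i" "p (Suc i)"]] b1(2)
      by (simp add: p_Suc)
    then have "norm (\<gamma> (p (Suc i)) - \<gamma> (p i) - \<Delta> *\<^sub>R g (p i)) \<le> \<eta> * Henstock_Kurzweil_Integration.content {p i..p (Suc i)}"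
      by (rule has_integral_bound_real[OF less_imp_le[OF \<eta>] finite.emptyI]) (use near in auto)
    then have "norm (\<gamma> (p (Suc i)) - \<gamma> (p i) - \<Delta> *\<^sub>R g (p i)) \<le> \<eta> * \<Delta>" using b1 by (simp add: p_Suc)
    then have "\<Delta> * norm (g (p i)) \<le> dist (\<gamma> (p i)) (\<gamma> (p (Suc i))) + \<eta> * \<Delta>"
      using norm_triangle_ineq2[of "\<Delta> *\<^sub>R g (p i)" "\<gamma> (p (Suc i)) - \<gamma> (p i)"] \<Delta>
      by (simp add: dist_norm norm_minus_commute)
    with up show ?thesis by (simp add: algebra_simps)
  qed
  have comb: "(\<Sum>i<m. integral {p i..p (Suc i)} (\<lambda>t. norm (g t))) = integral {a..p m} (\<lambda>t. norm (g t))" if "m \<le> n" for m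
    using that
  proof (induction m)
    case 0 then show ?case by (simp add: p_def)
  next
    case (Suc m)
    have "integral {a..p m} (\<lambda>t. norm (g t)) + integral {p m..p (Suc m)} (\<lambda>t. norm (g t)) = integral {a..p (Suc m)} (\<lambda>t. norm (g t))"
      using Suc.prems p_in[of m] p_in[of "Suc m"] \<Delta>
      by (intro Henstock_Kurzweil_Integration.integral_combine int) (auto simp: p_Suc)
    then show ?case using Suc by simp
  qed
  have "p n = b" using \<Delta> by (simp add: p_def)
  then have "integral {a..b} (\<lambda>t. norm (g t)) = (\<Sum>i<n. integral {p i..p (Suc i)} (\<lambda>t. norm (g t)))"
    using comb[of n] by simp
  also have "\<dots> \<le> (\<Sum>i<n. dist (\<gamma> (p i)) (\<gamma> (p (Suc i))) + 2 * \<eta> * \<Delta>)" by (intro sum_mono piece) auto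
  also have "\<dots> = (\<Sum>i<n. dist (\<gamma> (p i)) (\<gamma> (p (Suc i)))) + 2 * \<eta> * (real n * \<Delta>)" by (simp add: sum.distrib)
  also have "2 * \<eta> * (real n * \<Delta>) = e"
  proof -
    have "2 * (e / (2 * x)) * x = e" if "x \<noteq> 0" for x using that by simp
    then show ?thesis using ab unfolding \<Delta>(3) \<eta>_def by (metis diff_gt_0_iff_gt less_irrefl)
  qed
  finally show ?thesis using n0 by (intro exI[of _ n]) (simp add: p_def \<Delta>_def)
qed

section \<open>The quasicircle\<close>

context admissible_limit
begin

lemma \<Psi>_cis_integral:
  assumes "u \<le> v"
  shows "((\<lambda>t. exp (F j (cis t)) * (\<i> * cis t)) has_integral (\<Psi> j (cis v) - \<Psi> j (cis u))) {u..v}"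
proof (rule fundamental_theorem_of_calculus[OF assms])
  fix t
  have d: "deriv (\<Psi> j) z = exp (F j z)" for z using \<Psi>_deriv by (rule DERIV_imp_deriv)
  show "((\<lambda>t. \<Psi> j (cis t)) has_vector_derivative exp (F j (cis t)) * (\<i> * cis t)) (at t within {u..v})"
    using entire_cis_vector_derivative[OF \<Psi>_holo, of j t] unfolding d .
qed

lemma \<Psi>_cis_dist_le:
  assumes "u \<le> v" shows "dist (\<Psi> j (cis u)) (\<Psi> j (cis v)) \<le> image_length u v (F j)"
proof -
  have "norm (integral {u..v} (\<lambda>t. exp (F j (cis t)) * (\<i> * cis t))) \<le> integral {u..v} (\<lambda>t. norm (exp (F j (cis t))))"
  proof (rule integral_norm_bound_integral)
    show "(\<lambda>t. exp (F j (cis t)) * (\<i> * cis t)) integrable_on {u..v}"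
      using \<Psi>_cis_integral[OF assms] by (rule has_integral_integrable)
    show "(\<lambda>t. norm (exp (F j (cis t)))) integrable_on {u..v}"
      by (intro integrable_continuous_interval continuous_intros F_holo)
  qed (simp add: norm_mult)
  then show ?thesis
    using integral_unique[OF \<Psi>_cis_integral[OF assms]] by (simp add: image_length_def dist_norm norm_minus_commute)
qed

lemma image_length_integrable: "(\<lambda>t. norm (exp (F j (cis t)))) integrable_on {u..v}"
  by (intro integrable_continuous_interval continuous_intros F_holo)

text \<open>
  Every inscribed polygon of the image under \<open>\<Psi> j\<close> has length at most 8; for a fixed partition
  this passes to the limit.
\<close>

lemma \<Phi>_polygon_le:
  assumes s: "\<And>i. i < n \<Longrightarrow> s i \<le> s (Suc i)" and s0: "0 \<le> s 0" and sn: "s n \<le> 2 * pi"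
  shows "(\<Sum>i<n. dist (\<Phi> (cis (s i))) (\<Phi> (cis (s (Suc i))))) \<le> 8"
proof -
  have fin: "(\<Sum>i<n. dist (\<Psi> j (cis (s i))) (\<Psi> j (cis (s (Suc i))))) \<le> 8" for j
  proof -
    have "s 0 \<le> s m \<and> (\<Sum>i<m. image_length (s i) (s (Suc i)) (F j)) = image_length (s 0) (s m) (F j)" if "m \<le> n" for m
      using that
    proof (induction m)
      case 0 then show ?case by (simp add: image_length_def)
    next
      case (Suc m)
      have "image_length (s 0) (s m) (F j) + image_length (s m) (s (Suc m)) (F j) = image_length (s 0) (s (Suc m)) (F j)"
        unfolding image_length_def using Suc s[of m]
        by (intro Henstock_Kurzweil_Integration.integral_combine image_length_integrable) auto
      then show ?case using Suc s[of m] by auto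
    qed
    from this[of n] have s0n: "s 0 \<le> s n" and "(\<Sum>i<n. image_length (s i) (s (Suc i)) (F j)) = image_length (s 0) (s n) (F j)"
      by auto
    then have "(\<Sum>i<n. dist (\<Psi> j (cis (s i))) (\<Psi> j (cis (s (Suc i))))) \<le> image_length (s 0) (s n) (F j)"
      using sum_mono[of "{..<n}" "\<lambda>i. dist (\<Psi> j (cis (s i))) (\<Psi> j (cis (s (Suc i))))" "\<lambda>i. image_length (s i) (s (Suc i)) (F j)"]
        \<Psi>_cis_dist_le s by simp
    also have "\<dots> \<le> image_length 0 (2 * pi) (F j)"
      unfolding image_length_def using s0 sn s0n
      by (intro integral_subset_le image_length_integrable) auto
    also have "\<dots> \<le> 8" by (rule F_length)
    finally show ?thesis .
  qed
  have "(\<lambda>j. \<Sum>i<n. dist (\<Psi> j (cis (s i))) (\<Psi> j (cis (s (Suc i))))) \<longlonglongrightarrow> (\<Sum>i<n. dist (\<Phi> (cis (s i))) (\<Phi> (cis (s (Suc i)))))"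
    by (intro tendsto_intros \<Psi>_tendsto) auto
  then show ?thesis by (rule LIMSEQ_le_const2) (use fin in auto)
qed

definition \<Gamma> :: "complex set" where "\<Gamma> = \<Phi> ` sphere 0 1"

text \<open>
  The image of the arc from \<open>cis a\<close> to \<open>cis b\<close>, parametrised by \<open>[0, 1]\<close>.
\<close>

definition boundary_path :: "real \<Rightarrow> real \<Rightarrow> real \<Rightarrow> complex" where
  "boundary_path a b u = \<Phi> (cis (a + u * (b - a)))"

lemma boundary_path_props:
  assumes ab: "a < b" "b \<le> a + 2 * pi"
  shows path_boundary: "path (boundary_path a b)"
    and path_image_boundary: "path_image (boundary_path a b) = \<Phi> ` cis ` {a..b}"
    and "pathstart (boundary_path a b) = \<Phi> (cis a)" "pathfinish (boundary_path a b) = \<Phi> (cis b)"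
    and boundary_eq: "\<lbrakk>u \<in> {0..1}; v \<in> {0..1}; boundary_path a b u = boundary_path a b v; u < v\<rbrakk> \<Longrightarrow>
           b = a + 2 * pi \<and> u = 0 \<and> v = 1"
proof -
  have "continuous_on {0..1} (\<lambda>u. \<Phi> (cis (a + u * (b - a))))"
    by (rule continuous_on_compose2[OF \<Phi>_continuous]) (auto intro!: continuous_intros)
  then show "path (boundary_path a b)" unfolding path_def boundary_path_def[abs_def] .
  have "path_image (boundary_path a b) = (\<lambda>t. \<Phi> (cis t)) ` (\<lambda>u. a + u * (b - a)) ` {0..1}"
    by (simp add: path_image_def boundary_path_def image_image)
  then show "path_image (boundary_path a b) = \<Phi> ` cis ` {a..b}"
    using ab by (simp add: affine_image image_image)
  show "pathstart (boundary_path a b) = \<Phi> (cis a)" "pathfinish (boundary_path a b) = \<Phi> (cis b)"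
    by (simp_all add: pathstart_def pathfinish_def boundary_path_def)
  assume uv: "u \<in> {0..1}" "v \<in> {0..1}" "boundary_path a b u = boundary_path a b v" "u < v"
  have c: "cis (a + u * (b - a)) = cis (a + v * (b - a))"
    using inj_onD[OF \<Phi>_inj uv(3)[unfolded boundary_path_def]] by simp
  have pos: "0 < (v - u) * (b - a)" using uv ab by simp
  show "b = a + 2 * pi \<and> u = 0 \<and> v = 1"
  proof (rule ccontr)
    assume no: "\<not> (b = a + 2 * pi \<and> u = 0 \<and> v = 1)"
    have "(v - u) * (b - a) < 2 * pi"
    proof (cases "v - u = 1")
      case True
      then have "u = 0" "v = 1" using uv by auto
      then show ?thesis using no ab by auto
    next
      case False
      then have "v - u < 1" using uv by auto
      then have "(v - u) * (b - a) < 1 * (b - a)" using ab by (intro mult_strict_right_mono) auto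
      also have "\<dots> \<le> 2 * pi" using ab by simp
      finally show ?thesis .
    qed
    then have "a + u * (b - a) = a + v * (b - a)"
      using pos by (intro cis_eq_imp_eq[OF c]) (simp add: algebra_simps abs_if)
    then show False using pos by (simp add: algebra_simps)
  qed
qed

lemma arc_boundary:
  assumes ab: "a < b" "b < a + 2 * pi" shows "arc (boundary_path a b)"
  unfolding arc_def
proof (intro conjI path_boundary inj_onI)
  fix u v assume uv: "u \<in> {0..1}" "v \<in> {0..1}" "boundary_path a b u = boundary_path a b v"
  show "u = v"
  proof (rule linorder_cases[of u v])
    assume "u < v" then show ?thesis using boundary_eq[of a b u v] uv ab by auto
  next
    assume "v < u" then show ?thesis using boundary_eq[of a b v u] uv ab by auto
  qed
qed (use ab in auto)

lemma simple_closed_boundary: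
  "simple_path (boundary_path 0 (2 * pi))" "pathfinish (boundary_path 0 (2 * pi)) = pathstart (boundary_path 0 (2 * pi))"
  "path_image (boundary_path 0 (2 * pi)) = \<Gamma>"
proof -
  have b: "(0::real) < 2 * pi" "2 * pi \<le> 0 + 2 * pi" by auto
  have "loop_free (boundary_path 0 (2 * pi))"
    unfolding loop_free_def
  proof (intro ballI impI)
    fix u v :: real assume uv: "u \<in> {0..1}" "v \<in> {0..1}" "boundary_path 0 (2 * pi) u = boundary_path 0 (2 * pi) v"
    show "u = v \<or> u = 0 \<and> v = 1 \<or> u = 1 \<and> v = 0"
      using boundary_eq[OF b uv(1,2,3)] boundary_eq[OF b uv(2,1) uv(3)[symmetric]] by linarith
  qed
  then show "simple_path (boundary_path 0 (2 * pi))" using path_boundary[OF b] by (simp add: simple_path_def)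
  show "pathfinish (boundary_path 0 (2 * pi)) = pathstart (boundary_path 0 (2 * pi))"
    using boundary_path_props(3,4)[OF b] by simp
  show "path_image (boundary_path 0 (2 * pi)) = \<Gamma>"
    using path_image_boundary[OF b] sphere_eq_cis_image[of 0] by (simp add: \<Gamma>_def)
qed

lemma \<Gamma>_jordan: "jordan_curve \<Gamma>"
  unfolding jordan_curve_def using simple_closed_boundary by blast

lemma \<Gamma>_rectifiable: "rectifiable_jordan_curve \<Gamma>"
  unfolding rectifiable_jordan_curve_def
proof (intro exI[of _ "boundary_path 0 (2 * pi)"] conjI simple_closed_boundary)
  have "path_length (boundary_path 0 (2 * pi)) \<le> ennreal 8"
    unfolding path_length_def
  proof (rule SUP_least, clarify)
    fix n :: nat and t :: "nat \<Rightarrow> real"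
    assume t: "\<forall>i\<le>n. t i \<in> {0..1}" "\<forall>i<n. t i \<le> t (Suc i)"
    have "(\<Sum>i<n. dist (\<Phi> (cis (2 * pi * t i))) (\<Phi> (cis (2 * pi * t (Suc i))))) \<le> 8"
      by (rule \<Phi>_polygon_le[of n "\<lambda>i. 2 * pi * t i"]) (use t in auto)
    then show "(\<Sum>i<n. ennreal (dist (boundary_path 0 (2 * pi) (t i)) (boundary_path 0 (2 * pi) (t (Suc i))))) \<le> ennreal 8"
      by (subst sum_ennreal, simp, intro ennreal_leI) (simp add: boundary_path_def mult.commute)
  qed
  also have "\<dots> < \<infinity>" by simp
  finally show "path_length (boundary_path 0 (2 * pi)) < \<infinity>" .
qed

lemma \<Phi>_holo: "\<Phi> holomorphic_on ball 0 1"
  unfolding holomorphic_on_def field_differentiable_def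
  using has_field_derivative_at_within[OF \<Phi>_deriv] by blast

lemma \<Phi>_inj_ball: "inj_on \<Phi> (ball 0 1)"
  by (rule inj_on_subset[OF \<Phi>_inj ball_subset_cball])

text \<open>
  The image \<open>U\<close> of the disc is open, and relatively closed in the complement of \<open>\<Gamma>\<close> because the image of
  the closed disc is compact and \<open>\<Phi>\<close> is injective on it.  So \<open>U\<close> is a union of components of the complement; being bounded,
  it does not meet the outer one, and the inner one is connected by the Jordan curve theorem.
\<close>

lemma inside_\<Gamma>: "\<Phi> ` ball 0 1 = inside \<Gamma>"
proof -
  define U where "U = \<Phi> ` ball 0 1"
  note J = Jordan_inside_outside[OF simple_closed_boundary(1,2), unfolded simple_closed_boundary(3)]
  have U_open: "open U" unfolding U_def by (rule open_mapping_thm3[OF \<Phi>_holo open_ball \<Phi>_inj_ball])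
  have U_conn: "connected U" unfolding U_def
    by (intro connected_continuous_image holomorphic_on_imp_continuous_on \<Phi>_holo) simp
  have compact: "compact (\<Phi> ` cball 0 1)" by (intro compact_continuous_image \<Phi>_continuous) simp
  have cb: "cball 0 1 = ball 0 1 \<union> sphere (0::complex) 1" by auto
  have un: "\<Phi> ` cball 0 1 = U \<union> \<Gamma>" unfolding cb image_Un U_def \<Gamma>_def ..
  have disj: "U \<inter> \<Gamma> = {}"
    unfolding U_def \<Gamma>_def by (subst inj_on_image_Int[OF \<Phi>_inj, symmetric]) auto
  have U_bdd: "bounded U" by (rule bounded_subset[OF compact_imp_bounded[OF compact]]) (use un in auto)
  have U_ne: "U \<noteq> {}" by (simp add: U_def)
  have op: "open (- \<Phi> ` cball 0 1)" using compact by (simp add: compact_imp_closed open_Compl)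
  have alt: "U \<inter> S = {} \<or> S \<subseteq> U" if S: "connected S" "S \<subseteq> - \<Gamma>" for S
  proof -
    have "U \<inter> S = {} \<or> - \<Phi> ` cball 0 1 \<inter> S = {}"
      by (rule connectedD[OF S(1) U_open op]) (use un S in auto)
    then show ?thesis using un S by blast
  qed
  have Jc: "connected (inside \<Gamma>)" "connected (outside \<Gamma>)" "\<not> bounded (outside \<Gamma>)"
    and Ju: "inside \<Gamma> \<union> outside \<Gamma> = - \<Gamma>"
    using J by simp_all
  have sub: "inside \<Gamma> \<subseteq> - \<Gamma>" "outside \<Gamma> \<subseteq> - \<Gamma>" using Ju by blast+
  have "U \<inter> outside \<Gamma> = {}"
    using alt[OF Jc(2) sub(2)] Jc(3) bounded_subset[OF U_bdd] by auto
  then have "U \<subseteq> inside \<Gamma>" using Ju disj by blast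
  moreover have "inside \<Gamma> \<subseteq> U" using calculation alt[OF Jc(1) sub(1)] U_ne by blast
  ultimately show ?thesis unfolding U_def by (rule equalityI)
qed

lemma \<Gamma>_riemann: "riemann_mapping \<Phi> (inside \<Gamma>)"
  unfolding riemann_mapping_def using \<Phi>_holo \<Phi>_inj_ball inside_\<Gamma> by blast

lemma \<Phi>_log_deriv: "log_deriv_branch \<Phi> L"
  unfolding log_deriv_branch_def using L_holo \<Phi>_deriv DERIV_imp_deriv by metis

lemma boundary_arcs_cover:
  assumes st: "s < t" "t < s + 2 * pi"
  defines "A \<equiv> \<Phi> ` cis ` {s..t}" and "B \<equiv> \<Phi> ` cis ` {t..s + 2 * pi}"
  shows "A \<union> B = \<Gamma>" and "A \<inter> B = {\<Phi> (cis s), \<Phi> (cis t)}"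
proof -
  show un: "A \<union> B = \<Gamma>"
  proof -
    have "{s..s + 2 * pi} = {s..t} \<union> {t..s + 2 * pi}" using st by auto
    then show ?thesis unfolding A_def B_def \<Gamma>_def sphere_eq_cis_image[of s] by (simp only: image_Un)
  qed
  have cis_s: "cis (s + 2 * pi) = cis s" by (rule cis_add_2pi)
  show int: "A \<inter> B = {\<Phi> (cis s), \<Phi> (cis t)}"
  proof (intro equalityI subsetI)
    fix p assume "p \<in> A \<inter> B"
    then have pA: "p \<in> A" and pB: "p \<in> B" by auto
    from pA obtain u where u: "p = \<Phi> (cis u)" "s \<le> u" "u \<le> t" unfolding A_def by auto
    from pB obtain v where v: "p = \<Phi> (cis v)" "t \<le> v" "v \<le> s + 2 * pi" unfolding B_def by auto
    then have c: "cis u = cis v" using inj_onD[OF \<Phi>_inj, of "cis u" "cis v"] u(1) v(1) by simp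
    show "p \<in> {\<Phi> (cis s), \<Phi> (cis t)}"
    proof (cases "v = s + 2 * pi")
      case True then show ?thesis using v cis_s by simp
    next
      case False
      then have "u = v" using u v st by (intro cis_eq_imp_eq[OF c]) (auto simp: abs_if)
      then show ?thesis using u v by simp
    qed
  next
    fix p assume p: "p \<in> {\<Phi> (cis s), \<Phi> (cis t)}"
    have "\<Phi> (cis s) \<in> B" unfolding B_def cis_s[symmetric] using st by auto
    moreover have "\<Phi> (cis s) \<in> A" "\<Phi> (cis t) \<in> A" "\<Phi> (cis t) \<in> B" unfolding A_def B_def using st by auto
    ultimately show "p \<in> A \<inter> B" using p by auto
  qed
qed

text \<open>
  Of the two circular arcs between \<open>cis s\<close> and \<open>cis t\<close> one spans an angle of at most \<open>pi\<close>.  Its points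
  are no farther from one endpoint than the other endpoint is, so that the quasisymmetry estimate
  bounds the diameter of its image.
\<close>

lemma \<Gamma>_quasicircle_bound:
  assumes st: "s < t" "t < s + 2 * pi"
    and h: "complementary_subarcs \<Gamma> (\<Phi> (cis s)) (\<Phi> (cis t)) h1 h2"
  shows "min (diameter (path_image h1)) (diameter (path_image h2)) \<le> 12 * dist (\<Phi> (cis s)) (\<Phi> (cis t))"
proof -
  define A where "A = \<Phi> ` cis ` {s..t}"
  define B where "B = \<Phi> ` cis ` {t..s + 2 * pi}"
  have cont: "continuous_on UNIV (\<lambda>t. \<Phi> (cis t))"
    by (rule continuous_on_compose2[OF \<Phi>_continuous]) (auto intro!: continuous_intros)
  have closed: "closed (\<Phi> ` cis ` {a..b})" for a b
    unfolding image_image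
    by (intro compact_imp_closed compact_continuous_image continuous_on_subset[OF cont]) auto
  have un: "A \<union> B = \<Gamma>" and int: "A \<inter> B = {\<Phi> (cis s), \<Phi> (cis t)}"
    using boundary_arcs_cover[OF st] by (simp_all only: A_def B_def)
  have cis_s: "cis (s + 2 * pi) = cis s" by (rule cis_add_2pi)
  have extra: "\<not> \<Phi> ` cis ` {a..b} \<subseteq> {\<Phi> (cis a), \<Phi> (cis b)}" if ab: "a < b" "b < a + 2 * pi" for a b
  proof
    assume sub: "\<Phi> ` cis ` {a..b} \<subseteq> {\<Phi> (cis a), \<Phi> (cis b)}"
    define m where "m = (a + b) / 2"
    have m: "a < m" "m < b" using ab by (auto simp: m_def)
    have "cis m \<in> cis ` {a..b}" using m by auto
    then have "\<Phi> (cis m) \<in> {\<Phi> (cis a), \<Phi> (cis b)}" using sub by blast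
    then have "cis m = cis a \<or> cis m = cis b"
      using inj_onD[OF \<Phi>_inj, of "cis m" "cis a"] inj_onD[OF \<Phi>_inj, of "cis m" "cis b"] by auto
    then have "m = a \<or> m = b" using m ab cis_eq_imp_eq[of m a] cis_eq_imp_eq[of m b] by (auto simp: abs_if)
    then show False using m by simp
  qed
  have diam: "diameter S \<le> 12 * dist (\<Phi> (cis s)) (\<Phi> (cis t))"
    if S: "S \<subseteq> \<Phi> ` cis ` {a..b}" and ab: "a < b" "b - a \<le> pi"
      and ends: "cis a = cis s \<and> cis b = cis t \<or> cis a = cis t \<and> cis b = cis s" for S a b
  proof (rule diameter_le)
    fix p q assume "p \<in> S" "q \<in> S"
    then have pq: "p \<in> \<Phi> ` cis ` {a..b}" "q \<in> \<Phi> ` cis ` {a..b}" by (auto dest: subsetD[OF S])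
    from pq(1) obtain u where u: "p = \<Phi> (cis u)" "a \<le> u" "u \<le> b" by auto
    from pq(2) obtain v where v: "q = \<Phi> (cis v)" "a \<le> v" "v \<le> b" by auto
    have ne: "cis b \<noteq> cis a" using cis_eq_imp_eq[of b a] ab pi_gt_zero by auto
    have "dist (\<Phi> (cis u)) (\<Phi> (cis v)) \<le> 12 * dist (\<Phi> (cis b)) (\<Phi> (cis a))"
      using u v ab norm_cis_diff_mono(2)[of a _ b]
      by (intro \<Phi>_quasisymmetric ne) auto
    also have "dist (\<Phi> (cis b)) (\<Phi> (cis a)) = dist (\<Phi> (cis s)) (\<Phi> (cis t))" using ends by (auto simp: dist_commute)
    finally show "norm (p - q) \<le> 12 * dist (\<Phi> (cis s)) (\<Phi> (cis t))" using u v by (simp add: dist_norm)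
  qed simp
  show ?thesis
  proof (cases "t - s \<le> pi")
    case True
    have "path_image h1 \<subseteq> A \<or> path_image h2 \<subseteq> A"
      by (rule complementary_subarcs_inside_closed_part[OF h _ _ un int])
        (use closed extra[OF st] in \<open>auto simp: A_def B_def\<close>)
    then show ?thesis using diam[of _ s t] True st unfolding A_def by (auto simp: min_le_iff_disj)
  next
    case False
    have un': "B \<union> A = \<Gamma>" and int': "B \<inter> A = {\<Phi> (cis s), \<Phi> (cis t)}" using un int by auto
    have ex: "\<not> B \<subseteq> {\<Phi> (cis s), \<Phi> (cis t)}"
      using extra[of t "s + 2 * pi"] st unfolding B_def cis_s by (simp add: insert_commute)
    have "path_image h1 \<subseteq> B \<or> path_image h2 \<subseteq> B"
      by (rule complementary_subarcs_inside_closed_part[OF h _ _ un' int' ex])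
        (use closed in \<open>auto simp: A_def B_def\<close>)
    then show ?thesis using diam[of _ t "s + 2 * pi"] False st cis_s unfolding B_def by (auto simp: min_le_iff_disj)
  qed
qed

lemma \<Gamma>_quasicircle: "quasicircle \<Gamma>"
  unfolding quasicircle_def
proof (intro conjI \<Gamma>_jordan exI[of _ 12] ballI allI impI)
  fix z \<zeta> h1 h2
  assume z: "z \<in> \<Gamma>" "\<zeta> \<in> \<Gamma>" and h: "complementary_subarcs \<Gamma> z \<zeta> h1 h2"
  have "z \<noteq> \<zeta>" using h arc_distinct_ends unfolding complementary_subarcs_def by metis
  obtain s where s: "z = \<Phi> (cis s)" using z unfolding \<Gamma>_def sphere_eq_cis_image[of 0] by auto
  obtain t where t: "\<zeta> = \<Phi> (cis t)" "s \<le> t" "t \<le> s + 2 * pi"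
    using z unfolding \<Gamma>_def sphere_eq_cis_image[of s] by auto
  have "s < t" "t < s + 2 * pi" using \<open>z \<noteq> \<zeta>\<close> s t cis_add_2pi[of s] by (auto simp: less_le)
  from \<Gamma>_quasicircle_bound[OF this] h s t
  show "min (diameter (path_image h1)) (diameter (path_image h2)) \<le> 12 * dist z \<zeta>" by simp
qed simp

section \<open>Failure of the chord-arc condition\<close>

text \<open>
  The \<open>j\<close>-th arc is \<open>{cis t | r j \<le> t \<le> 2 r j}\<close>.
\<close>

definition r :: "nat \<Rightarrow> real" where "r j = 2 * \<rho> (Suc j)"

lemma r_bounds: "0 < r j" "r j \<le> 1 / 4"
  using \<rho>_pos[of "Suc j"] \<rho>_le[of "Suc j"] by (auto simp: r_def)

lemma r_tendsto: "r \<longlonglongrightarrow> 0"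
proof -
  have "(\<lambda>j. 2 * \<rho> (Suc j)) \<longlonglongrightarrow> 2 * 0" by (intro tendsto_intros LIMSEQ_Suc \<rho>_tendsto)
  then show ?thesis by (simp add: r_def[abs_def])
qed

lemma cis_one_dist:
  assumes "0 < u" "u \<le> t" "t \<le> 1" shows "u / 2 \<le> norm (1 - cis t)"
  using norm_cis_diff_ge[of u t 0] assms pi_gt3 by (simp add: norm_minus_commute)

text \<open>
  At the point \<open>a = 1 - r j\<close> the functions \<open>F k\<close> with \<open>k > j\<close> are bounded by 3, and the points of the arc are at
  distance at most \<open>3 (1 - |a|)\<close> from \<open>a\<close>.  So the images of the endpoints of the arc are at distance
  at most a constant times \<open>r j\<close>.
\<close>

lemma \<Phi>_near_centre:
  assumes t: "0 \<le> t" "t \<le> 2 * r j"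
  shows "dist (\<Phi> (cis t)) (\<Phi> (of_real (1 - r j))) \<le> 162 * r j"
proof -
  define a where "a = complex_of_real (1 - r j)"
  have na: "norm a = 1 - r j" using r_bounds[of j] by (simp add: a_def del: of_real_diff)
  have a: "a \<in> ball 0 1" using na r_bounds[of j] by simp
  have "1 - a = of_real (r j)" by (simp add: a_def)
  then have a1: "norm (1 - a) = r j" using r_bounds[of j] by simp
  have out: "a \<in> cball 0 1 - ball 1 (\<rho> (Suc j))"
    using a a1 \<rho>_pos[of "Suc j"] by (simp add: dist_norm r_def)
  have "cis t - a = (cis t - cis 0) + (1 - a)" by simp
  then have "norm (cis t - a) \<le> norm (cis t - cis 0) + norm (1 - a)" by (simp only: norm_triangle_ineq)
  also have "\<dots> \<le> 3 * r j" using norm_cis_diff_le[of t 0] t a1 by simp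
  finally have pa: "norm (cis t - a) \<le> 3 * r j" .
  have bd: "dist (\<Psi> k (cis t)) (\<Psi> k a) \<le> 162 * r j" if k: "Suc j \<le> k" for k
  proof -
    have "norm (F k a - F (Suc j) a) \<le> (1 / 2) ^ (Suc j + 1)" by (rule F_diff_le[OF out k])
    also have "\<dots> \<le> (1 / 2) ^ 0" by (rule power_decreasing) auto
    finally have "norm (F k a) \<le> 3"
      using F_centre[of j] norm_triangle_ineq[of "F k a - F (Suc j) a" "F (Suc j) a"]
      by (simp add: a_def r_def)
    then have "norm (exp (F k a)) \<le> exp 3" using complex_Re_le_cmod[of "F k a"] by simp
    also have "exp (3::real) = exp 1 * exp 1 * exp 1" by (simp add: exp_add[symmetric])
    also have "\<dots> \<le> 3 * 3 * 3" by (intro mult_mono exp_le) auto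
    finally have e: "norm (exp (F k a)) \<le> 27" by simp
    have "norm (\<Psi> k (cis t) - \<Psi> k a - exp (F k a) * (cis t - a))
       \<le> norm (exp (F k a)) * norm (cis t - a) * (3 * (1 / 20) / (1 - 3 * (1 / 20)))"
      by (rule distortion_from_interior_point[OF \<Psi>_deriv F_holo F_bloch a]) (use pa na in auto)
    also have "\<dots> \<le> norm (exp (F k a)) * norm (cis t - a) * 1" by (intro mult_left_mono) auto
    finally have "norm (\<Psi> k (cis t) - \<Psi> k a) \<le> 2 * (norm (exp (F k a)) * norm (cis t - a))"
      using norm_triangle_ineq[of "\<Psi> k (cis t) - \<Psi> k a - exp (F k a) * (cis t - a)" "exp (F k a) * (cis t - a)"]
      by (simp add: norm_mult)
    also have "\<dots> \<le> 2 * (27 * (3 * r j))" by (intro mult_left_mono mult_mono e pa) auto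
    finally show ?thesis by (simp add: dist_norm)
  qed
  have "(\<lambda>k. dist (\<Psi> k (cis t)) (\<Psi> k a)) \<longlonglongrightarrow> dist (\<Phi> (cis t)) (\<Phi> a)"
    using a by (intro tendsto_intros \<Psi>_tendsto) auto
  then show ?thesis unfolding a_def[symmetric]
    by (rule LIMSEQ_le_const2) (use bd in auto)
qed

lemma \<Phi>_cis_integral:
  assumes u: "0 < u" "u \<le> v" "v \<le> 1"
  shows "((\<lambda>t. exp (L (cis t)) * (\<i> * cis t)) has_integral (\<Phi> (cis v) - \<Phi> (cis u))) {u..v}"
proof -
  have out: "cis t \<in> cball 0 1 - ball 1 (u / 2)" if "t \<in> {u..v}" for t
    using cis_one_dist[of u t] u that by (simp add: dist_norm)
  have ulF: "uniform_limit {u..v} (\<lambda>k t. F k (cis t)) (\<lambda>t. L (cis t)) sequentially"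
    by (rule uniform_limit_compose'[OF F_uniform_limit[of "u / 2" "cball 0 1 - ball 1 (u / 2)"]])
       (use out u in auto)
  have contL: "continuous_on {u..v} (\<lambda>t. L (cis t))"
    by (rule uniform_limit_theorem[OF _ ulF]) (auto intro!: always_eventually continuous_intros F_holo)
  have ulE: "uniform_limit {u..v} (\<lambda>k t. exp (F k (cis t))) (\<lambda>t. exp (L (cis t))) sequentially"
  proof (rule uniform_limitI)
    fix e :: real assume e: "0 < e"
    have "bounded ((\<lambda>t. exp (L (cis t))) ` {u..v})"
      by (intro compact_imp_bounded compact_continuous_image continuous_intros contL) auto
    then obtain C where C: "0 < C" "\<forall>x\<in>(\<lambda>t. exp (L (cis t))) ` {u..v}. norm x \<le> C" unfolding bounded_pos by blast
    define d where "d = min (1 / 2) (e / (3 * C))"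
    have d: "0 < d" "d \<le> 1 / 2" "d \<le> e / (3 * C)" using e C by (auto simp: d_def)
    from uniform_limitD[OF ulF d(1)]
    show "\<forall>\<^sub>F k in sequentially. \<forall>t\<in>{u..v}. dist (exp (F k (cis t))) (exp (L (cis t))) < e"
    proof eventually_elim
      case (elim k)
      show ?case
      proof
        fix t assume t: "t \<in> {u..v}"
        define w where "w = F k (cis t) - L (cis t)"
        have w: "norm w < d" using elim t by (simp add: w_def dist_norm)
        have "exp (F k (cis t)) - exp (L (cis t)) = exp (L (cis t)) * (exp w - 1)"
          by (simp add: w_def exp_diff algebra_simps)
        then have "dist (exp (F k (cis t))) (exp (L (cis t))) = norm (exp (L (cis t))) * norm (exp w - 1)"
          by (simp only: dist_norm norm_mult)
        also have "\<dots> \<le> C * (2 * d)"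
        proof (intro mult_mono)
          show "norm (exp (L (cis t))) \<le> C" using C t by blast
          have "exp (norm w) \<le> 1 + 2 * norm w" using w d by (intro real_exp_bound_lemma) auto
          then show "norm (exp w - 1) \<le> 2 * d" using norm_exp_minus_one_le[of w] w by linarith
        qed (use C in auto)
        also have "\<dots> \<le> C * (2 * (e / (3 * C)))" using d C by (intro mult_left_mono) auto
        also have "\<dots> < e" using C e by simp
        finally show "dist (exp (F k (cis t))) (exp (L (cis t))) < e" .
      qed
    qed
  qed
  have ul: "uniform_limit {u..v} (\<lambda>k t. exp (F k (cis t)) * (\<i> * cis t)) (\<lambda>t. exp (L (cis t)) * (\<i> * cis t)) sequentially"
  proof (rule uniform_limitI)
    fix e :: real assume e: "0 < e"
    from uniform_limitD[OF ulE e]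
    show "\<forall>\<^sub>F k in sequentially. \<forall>t\<in>{u..v}. dist (exp (F k (cis t)) * (\<i> * cis t)) (exp (L (cis t)) * (\<i> * cis t)) < e"
    proof eventually_elim
      case (elim k)
      then show ?case by (simp add: dist_norm left_diff_distrib[symmetric] norm_mult)
    qed
  qed
  have cont: "continuous_on {u..v} (\<lambda>t. exp (F k (cis t)) * (\<i> * cis t))" for k
    by (intro continuous_on_mult continuous_on_exp entire_cis_continuous[OF F_holo] continuous_on_const continuous_on_cis continuous_on_id)
  obtain I J where IJ: "\<And>k. ((\<lambda>t. exp (F k (cis t)) * (\<i> * cis t)) has_integral I k) {u..v}"
    "((\<lambda>t. exp (L (cis t)) * (\<i> * cis t)) has_integral J) {u..v}" "I \<longlonglongrightarrow> J"
    using uniform_limit_integral[OF ul cont] by auto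
  have "I k = \<Psi> k (cis v) - \<Psi> k (cis u)" for k
    using has_integral_unique[OF IJ(1) \<Psi>_cis_integral[OF u(2)]] .
  then have "(\<lambda>k. \<Psi> k (cis v) - \<Psi> k (cis u)) \<longlonglongrightarrow> J" using IJ(3) by presburger
  moreover have "(\<lambda>k. \<Psi> k (cis v) - \<Psi> k (cis u)) \<longlonglongrightarrow> \<Phi> (cis v) - \<Phi> (cis u)"
    by (intro tendsto_intros \<Psi>_tendsto) auto
  ultimately have "J = \<Phi> (cis v) - \<Phi> (cis u)" by (rule LIMSEQ_unique)
  then show ?thesis using IJ(2) by simp
qed

text \<open>
  On the \<open>j\<close>-th arc \<open>L\<close> differs from \<open>F (Suc j)\<close> by at most \<open>1 / 2\<close>, so at least half of the length produced
  in the \<open>j\<close>-th block survives.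
\<close>

lemma short_arc_long:
  "ennreal ((real j - 1) / 2 * r j) \<le> path_length (boundary_path (r j) (2 * r j))"
proof -
  have r: "0 < r j" "r j < 2 * r j" "2 * r j \<le> 1" using r_bounds[of j] by auto
  define g where "g = (\<lambda>t. exp (L (cis t)) * (\<i> * cis t))"
  have out: "cis t \<in> cball 0 1 - ball 1 (\<rho> (Suc j))" if "t \<in> {r j..2 * r j}" for t
    using cis_one_dist[of "r j" t] r that by (simp add: dist_norm r_def)
  have contL: "continuous_on {r j..2 * r j} (\<lambda>t. L (cis t))"
  proof (rule continuous_on_compose2[OF L_continuous])
    show "cis ` {r j..2 * r j} \<subseteq> cball 0 1 - {1}" using out \<rho>_pos[of "Suc j"] by fastforce
  qed (intro continuous_intros)
  have contg: "continuous_on {r j..2 * r j} g" unfolding g_def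
    by (intro continuous_on_mult continuous_on_exp contL continuous_on_const continuous_on_cis continuous_on_id)
  have contN: "continuous_on {r j..2 * r j} (\<lambda>t. norm (g t))" by (intro continuous_on_norm contg)
  have "real j * r j \<le> image_length (r j) (2 * r j) (F (Suc j))"
    using F_long[of j] by (simp add: r_def)
  also have "\<dots> \<le> integral {r j..2 * r j} (\<lambda>t. 2 * norm (g t))"
    unfolding image_length_def
  proof (rule integral_le[OF image_length_integrable])
    show "(\<lambda>t. 2 * norm (g t)) integrable_on {r j..2 * r j}"
      by (intro integrable_continuous_interval continuous_on_mult continuous_on_const contN)
    fix t assume t: "t \<in> {r j..2 * r j}"
    define w where "w = F (Suc j) (cis t) - L (cis t)"
    have "norm w \<le> (1 / 2) ^ (Suc j + 1)" using L_diff_le[OF out[OF t]] by (simp add: w_def norm_minus_commute)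
    also have "\<dots> \<le> (1 / 2) ^ 1" by (rule power_decreasing) auto
    finally have w: "norm w \<le> 1 / 2" by simp
    have "norm (exp (F (Suc j) (cis t))) = norm (exp (L (cis t))) * norm (exp w)"
      unfolding norm_mult[symmetric] exp_add[symmetric] by (simp add: w_def)
    also have "\<dots> \<le> norm (exp (L (cis t))) * 2"
    proof (intro mult_left_mono)
      have "norm (exp w) \<le> exp (1 / 2)" using complex_Re_le_cmod[of w] w by simp
      also have "\<dots> \<le> 2" using real_exp_bound_lemma[of "1 / 2"] by simp
      finally show "norm (exp w) \<le> 2" .
    qed simp
    finally show "norm (exp (F (Suc j) (cis t))) \<le> 2 * norm (g t)" by (simp add: g_def norm_mult)
  qed
  also have "\<dots> = 2 * integral {r j..2 * r j} (\<lambda>t. norm (g t))" by simp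
  finally have I: "real j * r j / 2 \<le> integral {r j..2 * r j} (\<lambda>t. norm (g t))" by simp
  have \<gamma>: "(g has_integral (\<Phi> (cis v) - \<Phi> (cis u))) {u..v}" if "r j \<le> u" "u \<le> v" "v \<le> 2 * r j" for u v
    unfolding g_def by (rule \<Phi>_cis_integral) (use that r in auto)
  have e: "0 < r j / 2" using r by simp
  obtain n :: nat where n: "0 < n" "integral {r j..2 * r j} (\<lambda>t. norm (g t)) - r j / 2
     \<le> (\<Sum>i<n. dist (\<Phi> (cis (r j + real i * ((2 * r j - r j) / real n)))) (\<Phi> (cis (r j + real (Suc i) * ((2 * r j - r j) / real n)))))"
    using integral_norm_le_polygon[OF r(2) contg \<gamma> e] by blast
  define t where "t = (\<lambda>i::nat. real i / real n)"
  have bp: "boundary_path (r j) (2 * r j) (t i) = \<Phi> (cis (r j + real i * ((2 * r j - r j) / real n)))" for i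
    by (simp add: boundary_path_def t_def)
  have "(real j - 1) / 2 * r j \<le> (\<Sum>i<n. dist (boundary_path (r j) (2 * r j) (t i)) (boundary_path (r j) (2 * r j) (t (Suc i))))"
    unfolding bp using n(2) I by (simp add: algebra_simps)
  then have "ennreal ((real j - 1) / 2 * r j) \<le> ennreal (\<Sum>i<n. dist (boundary_path (r j) (2 * r j) (t i)) (boundary_path (r j) (2 * r j) (t (Suc i))))"
    by (rule ennreal_leI)
  also have "\<dots> = (\<Sum>i<n. ennreal (dist (boundary_path (r j) (2 * r j) (t i)) (boundary_path (r j) (2 * r j) (t (Suc i)))))"
    by (rule sum_ennreal[symmetric]) simp
  also have "\<dots> \<le> path_length (boundary_path (r j) (2 * r j))"
    unfolding path_length_def
    by (rule SUP_upper2[of "(n, t)"]) (use n(1) in \<open>auto simp: t_def divide_simps\<close>)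
  finally show ?thesis .
qed

text \<open>
  The endpoints of the \<open>j\<close>-th arc have images at distance at most \<open>324 r j\<close>.  The image of the arc has length at
  least \<open>(j - 1) r j / 2\<close>.  The complementary arc contains the fixed point \<open>\<Phi> (-1)\<close>, so that its length
  is bounded below whereas \<open>r j\<close> tends to 0.
\<close>

lemma \<Gamma>_not_chord_arc: "\<not> chord_arc_curve \<Gamma>"
proof
  assume "chord_arc_curve \<Gamma>"
  then obtain C where C: "0 < C" "\<And>z \<zeta> h1 h2. \<lbrakk>z \<in> \<Gamma>; \<zeta> \<in> \<Gamma>; complementary_subarcs \<Gamma> z \<zeta> h1 h2\<rbrakk> \<Longrightarrow>
        min (path_length h1) (path_length h2) \<le> ennreal (C * dist z \<zeta>)"
    unfolding chord_arc_curve_def by metis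
  define d where "d = dist (\<Phi> (cis pi)) (\<Phi> (cis 0))"
  have "cis pi \<noteq> cis 0" by simp
  then have d: "0 < d" using inj_onD[OF \<Phi>_inj, of "cis pi" "cis 0"] by (auto simp: d_def)
  have contcis: "isCont (\<lambda>t. \<Phi> (cis t)) 0"
  proof -
    have "continuous_on UNIV (\<lambda>t. \<Phi> (cis t))"
      by (rule continuous_on_compose2[OF \<Phi>_continuous]) (auto intro!: continuous_intros)
    then show ?thesis by (simp add: continuous_on_eq_continuous_at)
  qed
  have "(\<lambda>j. 2 * r j) \<longlonglongrightarrow> 2 * 0" by (intro tendsto_intros r_tendsto)
  then have "(\<lambda>j. 2 * r j) \<longlonglongrightarrow> 0" by (simp only: mult_zero_right)
  then have "(\<lambda>j. \<Phi> (cis (2 * r j))) \<longlonglongrightarrow> \<Phi> (cis 0)"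
    by (rule isCont_tendsto_compose[OF contcis])
  then have "(\<lambda>j. dist (\<Phi> (cis pi)) (\<Phi> (cis (2 * r j)))) \<longlonglongrightarrow> d"
    unfolding d_def by (intro tendsto_intros)
  then have ev1: "\<forall>\<^sub>F j in sequentially. d / 2 < dist (\<Phi> (cis pi)) (\<Phi> (cis (2 * r j)))"
    using d by (intro order_tendstoD(1)) auto
  have "(\<lambda>j. C * (324 * r j)) \<longlonglongrightarrow> C * (324 * 0)" by (intro tendsto_intros r_tendsto)
  then have ev2: "\<forall>\<^sub>F j in sequentially. C * (324 * r j) < d / 2"
    using d by (intro order_tendstoD(2)[where y = "C * (324 * 0)"]) auto
  obtain J :: nat where J: "C * 648 + 1 < real J" using reals_Archimedean2 by blast
  obtain j where j: "d / 2 < dist (\<Phi> (cis pi)) (\<Phi> (cis (2 * r j)))" "C * (324 * r j) < d / 2" "J \<le> j"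
    using eventually_happens'[OF sequentially_bot eventually_conj[OF ev1 eventually_conj[OF ev2 eventually_ge_at_top[of J]]]] by auto
  have Jj: "C * 648 + 1 < real j" using J j(3) by linarith
  define x where "x = \<Phi> (cis (r j))"
  define y where "y = \<Phi> (cis (2 * r j))"
  have r: "0 < r j" "r j \<le> 1 / 4" by (rule r_bounds)+
  have "dist x y \<le> 324 * r j"
    using \<Phi>_near_centre[of "r j" j] \<Phi>_near_centre[of "2 * r j" j] r
      dist_triangle2[of x y "\<Phi> (of_real (1 - r j))"] by (simp add: x_def y_def)
  then have "C * dist x y \<le> C * (324 * r j)" using C by (intro mult_left_mono) auto
  note Cxy = this
  define h1 where "h1 = boundary_path (r j) (2 * r j)"
  define h where "h = boundary_path (2 * r j) (r j + 2 * pi)"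
  define h2 where "h2 = reversepath h"
  have st: "r j < 2 * r j" "2 * r j < r j + 2 * pi" using r pi_gt3 by auto
  have st2: "2 * r j < r j + 2 * pi" "r j + 2 * pi < 2 * r j + 2 * pi" using r pi_gt3 by auto
  have h1: "arc h1" "pathstart h1 = x" "pathfinish h1 = y" "path_image h1 = \<Phi> ` cis ` {r j..2 * r j}"
    unfolding h1_def x_def y_def using st r arc_boundary boundary_path_props[of "r j" "2 * r j"] by auto
  have h: "arc h" "pathstart h = y" "pathfinish h = x" "path_image h = \<Phi> ` cis ` {2 * r j..r j + 2 * pi}"
    unfolding h_def x_def y_def using st2 arc_boundary boundary_path_props[of "2 * r j" "r j + 2 * pi"]
    by (auto simp: cis_add_2pi)
  have comp: "complementary_subarcs \<Gamma> x y h1 h2"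
    unfolding complementary_subarcs_def h2_def
    using h1 h boundary_arcs_cover[OF st] by (auto simp: arc_reversepath x_def y_def)
  have "x \<in> \<Gamma>" "y \<in> \<Gamma>" by (auto simp: x_def y_def \<Gamma>_def)
  then have le: "min (path_length h1) (path_length h2) \<le> ennreal (C * (324 * r j))"
    using C(2)[OF _ _ comp] ennreal_leI[OF Cxy] by (meson order_trans)
  have l1: "ennreal (C * (324 * r j)) < path_length h1"
  proof -
    have "C * 324 < (real j - 1) / 2" using Jj by simp
    then have lt: "C * 324 * r j < (real j - 1) / 2 * r j" using r by (intro mult_strict_right_mono)
    have "0 < C * 324 * r j" using C r by simp
    then have "ennreal (C * 324 * r j) < ennreal ((real j - 1) / 2 * r j)"
      using lt by (intro ennreal_lessI) auto
    then have "ennreal (C * (324 * r j)) < ennreal ((real j - 1) / 2 * r j)" by (simp only: mult.assoc)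
    then show ?thesis using short_arc_long[of j] unfolding h1_def by (rule less_le_trans)
  qed
  have l2: "ennreal (C * (324 * r j)) < path_length h2"
  proof -
    have "cis pi \<in> cis ` {2 * r j..r j + 2 * pi}" using r pi_gt3 by (intro imageI) auto
    then have "\<Phi> (cis pi) \<in> path_image h2" unfolding h2_def path_image_reversepath h(4) by (rule imageI)
    then obtain u where u: "u \<in> {0..1}" "h2 u = \<Phi> (cis pi)" unfolding path_image_def by auto
    have "h2 1 = y" using h(2) by (simp add: h2_def reversepath_def pathstart_def)
    have "ennreal (C * (324 * r j)) < ennreal (dist (\<Phi> (cis pi)) y)"
    proof (rule ennreal_lessI)
      show "C * (324 * r j) < dist (\<Phi> (cis pi)) y" using j(1,2) unfolding y_def by linarith
      show "0 < dist (\<Phi> (cis pi)) y" using j(1) d unfolding y_def by linarith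
    qed
    also have "\<dots> \<le> path_length h2"
      using path_length_ge_dist[of u 1 h2] u \<open>h2 1 = y\<close> by simp
    finally show ?thesis .
  qed
  show False using le l1 l2 by (auto simp: min_le_iff_disj)
qed

end

section \<open>Bounded imaginary part implies BMOA\<close>

text \<open>
  Cauchy's integral formula for \<open>Q u / (1 - cnj z * u)\<close>.  On the circle the conjugate of \<open>u\<close> is
  \<open>1 / u\<close>, and the two denominators combine to \<open>|u - z|\<^sup>2\<close>.
\<close>

lemma Poisson_formula_circle:
  fixes Q :: "complex \<Rightarrow> complex"
  assumes Q: "Q holomorphic_on UNIV" and z: "norm z < 1"
  shows "((\<lambda>t. Q (cis t) * of_real ((1 - (norm z)\<^sup>2) / (norm (cis t - z))\<^sup>2)) has_integral
            2 * of_real pi * Q z) {0..2 * pi}"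
proof -
  define q where "q = (\<lambda>u. Q u / (1 - cnj z * u))"
  have nz: "1 - cnj z * u \<noteq> 0" if "norm u \<le> 1" for u
  proof
    assume "1 - cnj z * u = 0"
    then have "norm (cnj z * u) = 1" by (metis norm_one right_minus_eq)
    moreover have "norm (cnj z * u) \<le> norm z * 1" unfolding norm_mult using that by (intro mult_mono) auto
    ultimately show False using z by simp
  qed
  have q: "q holomorphic_on cball 0 1"
    unfolding q_def using nz by (intro holomorphic_intros holomorphic_on_subset[OF Q]) auto
  have "((\<lambda>u. q u / (u - z)) has_contour_integral (2 * of_real pi * \<i> * q z)) (part_circlepath 0 1 0 (2 * pi))"
    using Cauchy_integral_circlepath_simple[OF q, of z] z by (simp add: circlepath_def)
  then have "((\<lambda>t. q (cis t) / (cis t - z) * \<i> * cis t) has_integral (2 * of_real pi * \<i> * q z)) {0..2 * pi}"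
    by (subst (asm) has_contour_integral_part_circlepath_iff) auto
  from has_integral_mult_right[OF this, of "of_real (1 - (norm z)\<^sup>2) / \<i>"]
  have h: "((\<lambda>t. of_real (1 - (norm z)\<^sup>2) / \<i> * (q (cis t) / (cis t - z) * \<i> * cis t)) has_integral
      (of_real (1 - (norm z)\<^sup>2) / \<i> * (2 * of_real pi * \<i> * q z))) {0..2 * pi}" .
  have zz: "of_real (1 - (norm z)\<^sup>2) = 1 - cnj z * z"
    by (simp only: of_real_diff of_real_1 complex_norm_square mult.commute)
  have "of_real (1 - (norm z)\<^sup>2) / \<i> * (2 * of_real pi * \<i> * q z) = 2 * of_real pi * Q z"
    unfolding zz q_def using nz[of z] z by simp
  moreover have "of_real (1 - (norm z)\<^sup>2) / \<i> * (q (cis t) / (cis t - z) * \<i> * cis t)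
      = Q (cis t) * of_real ((1 - (norm z)\<^sup>2) / (norm (cis t - z))\<^sup>2)" for t
  proof -
    define c where "c = cis t"
    have c: "cnj c * c = 1" using complex_norm_square[of c] by (simp add: c_def mult.commute)
    have cz: "c - z \<noteq> 0" using z norm_cis[of t] by (auto simp: c_def)
    have fac: "1 - cnj z * c = cnj (c - z) * c" using c by (simp add: algebra_simps)
    have c0: "c \<noteq> 0" by (simp add: c_def)
    have "of_real ((1 - (norm z)\<^sup>2) / (norm (c - z))\<^sup>2) = of_real (1 - (norm z)\<^sup>2) / ((c - z) * cnj (c - z))"
      by (simp only: of_real_divide complex_norm_square)
    moreover have "of_real (1 - (norm z)\<^sup>2) / \<i> * (q c / (c - z) * \<i> * c)
        = Q c * (of_real (1 - (norm z)\<^sup>2) / ((c - z) * cnj (c - z)))"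
    proof -
      have alg: "N / \<i> * (v / (y * w) / x * \<i> * w) = v * (N / (x * y))"
        if "w \<noteq> 0" "x \<noteq> 0" "y \<noteq> 0" for N v w x y :: complex
        using that by (simp add: field_simps)
      have "cnj (c - z) \<noteq> 0" using cz by simp
      then show ?thesis unfolding q_def fac using cz c0 by (intro alg)
    qed
    ultimately show ?thesis by (simp only: c_def)
  qed
  ultimately show ?thesis using h by (simp only:)
qed

text \<open>
  The Poisson mean of \<open>(G - G z)\<^sup>2\<close> at \<open>z\<close> is 0, and the real part of a square is the difference of the squares of
  real and imaginary part.  So the Poisson mean of \<open>|G - G z|\<^sup>2\<close> is twice that of the imaginary part,
  hence at most \<open>2 * 8\<^sup>2\<close>.  The point \<open>z\<close> lies below the middle of the arc at a height comparable to the
  length \<open>l\<close>, so that the Poisson kernel is at least \<open>1 / (4 pi l)\<close> on the arc.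
\<close>

lemma oscillation_of_bounded_Im:
  fixes G :: "complex \<Rightarrow> complex"
  assumes G: "G holomorphic_on UNIV" and Im: "\<And>z. z \<in> cball 0 1 \<Longrightarrow> \<bar>Im (G z)\<bar> \<le> 4"
    and l: "0 < l" "l \<le> 2 * pi"
  defines "z \<equiv> of_real (1 - l / (4 * pi)) * cis (l / 2)"
  shows "integral {0..l} (\<lambda>t. (norm (G (cis t) - G z))\<^sup>2) \<le> 1024 * pi\<^sup>2 * l"
proof -
  define h where "h = l / (4 * pi)"
  have h: "0 < h" "h \<le> 1 / 2" using l by (auto simp: h_def field_simps)
  have hl: "h \<le> l / 2"
  proof -
    have "l * 1 \<le> l * (2 * pi)" using l pi_gt3 by (intro mult_left_mono) auto
    then show ?thesis by (simp add: h_def field_simps)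
  qed
  have zh: "z = of_real (1 - h) * cis (l / 2)" by (simp add: z_def h_def)
  have nz: "norm z = 1 - h" unfolding zh norm_mult norm_of_real using h by simp
  have z1: "norm z < 1" using nz h by simp
  define P where "P = (\<lambda>t. (1 - (norm z)\<^sup>2) / (norm (cis t - z))\<^sup>2)"
  have nzc: "norm (cis t - z) \<noteq> 0" for t
    using z1 norm_cis[of t] by auto
  have "(norm z)\<^sup>2 \<le> norm z" using z1 by (simp add: power2_eq_square mult_left_le)
  then have P_num: "h \<le> 1 - (norm z)\<^sup>2" using nz by simp
  have P0: "0 \<le> P t" for t unfolding P_def using P_num h by simp
  have Pc: "continuous_on S P" for S unfolding P_def
    by (intro continuous_intros) (use nzc in auto)
  define D where "D = (\<lambda>w. G w - G z)"
  have D: "D holomorphic_on UNIV" unfolding D_def by (intro holomorphic_intros G)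
  have H: "(\<lambda>w. (D w)\<^sup>2) holomorphic_on UNIV" by (intro holomorphic_intros D)
  have "((\<lambda>t. (D (cis t))\<^sup>2 * of_real (P t)) has_integral 2 * of_real pi * (D z)\<^sup>2) {0..2 * pi}"
    using Poisson_formula_circle[OF H z1] unfolding P_def .
  then have "((\<lambda>t. Re ((D (cis t))\<^sup>2 * of_real (P t))) has_integral Re (2 * of_real pi * (D z)\<^sup>2)) {0..2 * pi}"
    by (rule has_integral_Re)
  then have I1: "((\<lambda>t. ((Re (D (cis t)))\<^sup>2 - (Im (D (cis t)))\<^sup>2) * P t) has_integral 0) {0..2 * pi}"
    by (simp add: D_def power2_eq_square)
  have "((\<lambda>t. 1 * complex_of_real (P t)) has_integral 2 * of_real pi * 1) {0..2 * pi}"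
    using Poisson_formula_circle[of "\<lambda>_. 1", OF _ z1] unfolding P_def by simp
  then have "((\<lambda>t. Re (1 * complex_of_real (P t))) has_integral Re (2 * of_real pi * 1)) {0..2 * pi}"
    by (rule has_integral_Re)
  then have I2: "(P has_integral 2 * pi) {0..2 * pi}" by simp
  have contD: "continuous_on S (\<lambda>t. D (cis t))" for S by (rule entire_cis_continuous[OF D])
  have I3: "(\<lambda>t. (norm (D (cis t)))\<^sup>2 * P t) integrable_on {0..2 * pi}"
    by (intro integrable_continuous_interval continuous_on_mult continuous_on_power continuous_on_norm contD Pc)
  have ptw: "(norm (D (cis t)))\<^sup>2 * P t - ((Re (D (cis t)))\<^sup>2 - (Im (D (cis t)))\<^sup>2) * P t \<le> 128 * P t" for t
  proof -
    have "\<bar>Im (D (cis t))\<bar> \<le> 8"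
      using Im[of "cis t"] Im[of z] z1 abs_triangle_ineq4[of "Im (G (cis t))" "Im (G z)"] by (simp add: D_def)
    then have "\<bar>Im (D (cis t))\<bar>\<^sup>2 \<le> 8\<^sup>2" by (intro power_mono) auto
    then have "2 * (Im (D (cis t)))\<^sup>2 * P t \<le> 128 * P t" using P0 by (intro mult_right_mono) auto
    then show ?thesis by (simp add: cmod_power2 algebra_simps)
  qed
  have "integral {0..2 * pi} (\<lambda>t. (norm (D (cis t)))\<^sup>2 * P t) - 0 \<le> 128 * (2 * pi)"
    by (rule has_integral_le[OF has_integral_diff[OF integrable_integral[OF I3] I1] has_integral_mult_right[OF I2] ptw])
  then have full: "integral {0..2 * pi} (\<lambda>t. (norm (D (cis t)))\<^sup>2 * P t) \<le> 256 * pi" by simp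
  have lower: "(norm (D (cis t)))\<^sup>2 \<le> (4 * pi * l) * ((norm (D (cis t)))\<^sup>2 * P t)" if t: "t \<in> {0..l}" for t
  proof -
    have "norm (cis t - z) \<le> norm (cis t - cis (l / 2)) + norm (cis (l / 2) - z)"
      using norm_triangle_ineq[of "cis t - cis (l / 2)" "cis (l / 2) - z"] by simp
    also have "cis (l / 2) - z = of_real h * cis (l / 2)" by (simp add: zh algebra_simps)
    also have "norm (of_real h * cis (l / 2)) = h" using h by (simp add: norm_mult)
    also have "norm (cis t - cis (l / 2)) \<le> l / 2" using norm_cis_diff_le[of t "l / 2"] t by auto
    finally have "norm (cis t - z) \<le> l" using hl by simp
    then have "(norm (cis t - z))\<^sup>2 \<le> l\<^sup>2" by (intro power_mono) auto
    moreover have "0 < (norm (cis t - z))\<^sup>2" using nzc[of t] by simp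
    ultimately have "h / l\<^sup>2 \<le> P t" unfolding P_def using P_num h by (intro frac_le) auto
    then have "(4 * pi * l) * (h / l\<^sup>2) \<le> (4 * pi * l) * P t" using l by (intro mult_left_mono) auto
    moreover have "(4 * pi * l) * (h / l\<^sup>2) = 1" using l by (simp add: h_def power2_eq_square)
    ultimately have "1 \<le> 4 * pi * l * P t" by (simp only:)
    then have "(norm (D (cis t)))\<^sup>2 * 1 \<le> (norm (D (cis t)))\<^sup>2 * (4 * pi * l * P t)" by (intro mult_left_mono) auto
    then show ?thesis by (simp add: mult_ac)
  qed
  have "integral {0..l} (\<lambda>t. (norm (D (cis t)))\<^sup>2) \<le> integral {0..l} (\<lambda>t. (4 * pi * l) * ((norm (D (cis t)))\<^sup>2 * P t))"
    by (rule integral_le[OF _ _ lower])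
      (intro integrable_continuous_interval continuous_on_mult continuous_on_const continuous_on_power continuous_on_norm contD Pc)+
  also have "\<dots> = (4 * pi * l) * integral {0..l} (\<lambda>t. (norm (D (cis t)))\<^sup>2 * P t)" by simp
  also have "\<dots> \<le> (4 * pi * l) * integral {0..2 * pi} (\<lambda>t. (norm (D (cis t)))\<^sup>2 * P t)"
    using l P0 by (intro mult_left_mono integral_subset_le I3 integrable_continuous_interval continuous_on_mult
        continuous_on_power continuous_on_norm contD Pc) auto
  also have "\<dots> \<le> (4 * pi * l) * (256 * pi)" using l by (intro mult_left_mono full) auto
  also have "\<dots> = 1024 * pi\<^sup>2 * l" by (simp add: power2_eq_square)
  finally show ?thesis by (simp add: D_def)
qed

lemma oscillation_on_arc:
  fixes G :: "complex \<Rightarrow> complex"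
  assumes G: "G holomorphic_on UNIV" and Im: "\<And>z. z \<in> cball 0 1 \<Longrightarrow> \<bar>Im (G z)\<bar> \<le> 4"
    and ab: "a < b" "b \<le> a + 2 * pi"
  defines "z \<equiv> cis a * (of_real (1 - (b - a) / (4 * pi)) * cis ((b - a) / 2))"
  shows "integral {a..b} (\<lambda>t. (norm (G (cis t) - G z))\<^sup>2) \<le> 1024 * pi\<^sup>2 * (b - a)"
proof -
  have hol: "(\<lambda>w. G (cis a * w)) holomorphic_on UNIV"
    using holomorphic_on_compose_gen[OF _ G, of "\<lambda>w. cis a * w" UNIV] by (simp add: o_def holomorphic_intros)
  have "integral {0..b - a} (\<lambda>t. (norm (G (cis a * cis t) - G z))\<^sup>2) \<le> 1024 * pi\<^sup>2 * (b - a)"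
    unfolding z_def by (rule oscillation_of_bounded_Im[OF hol]) (use ab Im in \<open>auto simp: norm_mult\<close>)
  moreover have "integral {0..b - a} (\<lambda>t. (norm (G (cis a * cis t) - G z))\<^sup>2) = integral {a..b} (\<lambda>t. (norm (G (cis t) - G z))\<^sup>2)"
    using integral_shift_Icc_real[of 0 "b - a" "\<lambda>t. (norm (G (cis t) - G z))\<^sup>2" a]
    by (simp add: o_def cis_mult)
  ultimately show ?thesis by simp
qed

text \<open>
  Square integrals are passed to the limit by Fatou's lemma, because no bound independent of \<open>k\<close> is
  available for the functions \<open>g k\<close>; the integral of the modulus is then controlled by \<open>2 x \<le> 1 + x\<^sup>2\<close>.
\<close>

lemma Fatou_square_integral:
  fixes g :: "nat \<Rightarrow> real \<Rightarrow> complex" and f :: "real \<Rightarrow> complex"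
  assumes g: "\<And>k. continuous_on UNIV (g k)" and f: "f \<in> borel_measurable borel"
    and B: "\<And>k. integral {a..b} (\<lambda>t. (norm (g k t))\<^sup>2) \<le> B" and ab: "a \<le> b"
    and lim: "AE t in lebesgue. (\<lambda>k. g k t) \<longlonglongrightarrow> f t"
  shows "set_integrable lebesgue {a..b} (\<lambda>t. (norm (f t))\<^sup>2)"
    and "(LINT t:{a..b}|lebesgue. (norm (f t))\<^sup>2) \<le> B"
    and "set_integrable lebesgue {a..b} f"
    and "(LINT t:{a..b}|lebesgue. norm (f t)) \<le> ((b - a) + B) / 2"
proof -
  have f_leb: "f \<in> borel_measurable lebesgue"
    using f by (intro measurable_completion) simp
  have ind: "indicator {a..b} \<in> borel_measurable lebesgue" for a b :: real
    by (intro borel_measurable_indicator) auto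
  define \<phi> where "\<phi> = (\<lambda>t. indicat_real {a..b} t * (norm (f t))\<^sup>2)"
  define \<psi> where "\<psi> = (\<lambda>k t. indicat_real {a..b} t * (norm (g k t))\<^sup>2)"
  have nf: "(\<lambda>t. norm (f t)) \<in> borel_measurable lebesgue"
    using f_leb by measurable
  have \<phi>_meas: "\<phi> \<in> borel_measurable lebesgue" unfolding \<phi>_def
    by (intro borel_measurable_times ind borel_measurable_power nf)
  have g_leb: "g k \<in> borel_measurable lebesgue" for k
    using borel_measurable_continuous_onI[OF g[of k]] by (intro measurable_completion) simp
  have ng: "(\<lambda>t. norm (g k t)) \<in> borel_measurable lebesgue" for k
    using g_leb[of k] by measurable
  have \<psi>_meas: "\<psi> k \<in> borel_measurable lebesgue" for k unfolding \<psi>_def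
    by (intro borel_measurable_times ind borel_measurable_power ng)
  have intg: "(\<lambda>t. (norm (g k t))\<^sup>2) integrable_on {a..b}" for k
    by (intro integrable_continuous_interval continuous_on_power continuous_on_norm continuous_on_subset[OF g]) auto
  have B0: "0 \<le> B" by (rule order_trans[OF integral_nonneg[OF intg[of 0]] B[of 0]]) simp
  have "(\<integral>\<^sup>+t. ennreal (\<phi> t) \<partial>lebesgue) \<le> (\<integral>\<^sup>+t. liminf (\<lambda>k. ennreal (\<psi> k t)) \<partial>lebesgue)"
  proof (rule nn_integral_mono_AE)
    show "AE t in lebesgue. ennreal (\<phi> t) \<le> liminf (\<lambda>k. ennreal (\<psi> k t))"
      using lim
    proof eventually_elim
      case (elim t)
      then have "(\<lambda>k. ennreal (\<psi> k t)) \<longlonglongrightarrow> ennreal (\<phi> t)"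
        unfolding \<phi>_def \<psi>_def by (intro tendsto_ennrealI tendsto_intros)
      then show ?case using lim_imp_Liminf[OF sequentially_bot] by fastforce
    qed
  qed
  also have "\<dots> \<le> liminf (\<lambda>k. \<integral>\<^sup>+t. ennreal (\<psi> k t) \<partial>lebesgue)"
    by (rule nn_integral_liminf) (intro measurable_compose[OF \<psi>_meas] measurable_ennreal)
  also have "\<dots> \<le> limsup (\<lambda>k. \<integral>\<^sup>+t. ennreal (\<psi> k t) \<partial>lebesgue)"
    by (rule Liminf_le_Limsup) simp
  also have "\<dots> \<le> ennreal B"
  proof (rule Limsup_bounded, rule always_eventually, rule allI)
    fix k
    have "(\<integral>\<^sup>+t. ennreal (\<psi> k t) \<partial>lebesgue) = (\<integral>\<^sup>+t. ennreal (\<psi> k t) \<partial>lborel)" by (rule nn_integral_completion)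
    also have "\<dots> = ennreal (integral {a..b} (\<lambda>t. (norm (g k t))\<^sup>2))"
      unfolding \<psi>_def by (rule nn_integral_has_integral_lebesgue[OF _ integrable_integral[OF intg]]) simp
    also have "\<dots> \<le> ennreal B" by (rule ennreal_leI[OF B])
    finally show "(\<integral>\<^sup>+t. ennreal (\<psi> k t) \<partial>lebesgue) \<le> ennreal B" .
  qed
  finally have nn: "(\<integral>\<^sup>+t. ennreal (\<phi> t) \<partial>lebesgue) \<le> ennreal B" .
  have \<phi>0: "0 \<le> \<phi> t" for t by (simp add: \<phi>_def)
  have \<phi>_int: "integrable lebesgue \<phi>"
  proof (rule integrableI_bounded[OF \<phi>_meas])
    have "(\<integral>\<^sup>+t. ennreal (norm (\<phi> t)) \<partial>lebesgue) = (\<integral>\<^sup>+t. ennreal (\<phi> t) \<partial>lebesgue)" using \<phi>0 by simp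
    also have "\<dots> < \<infinity>" using nn le_less_trans ennreal_less_top by fastforce
    finally show "(\<integral>\<^sup>+t. ennreal (norm (\<phi> t)) \<partial>lebesgue) < \<infinity>" .
  qed
  then show s1: "set_integrable lebesgue {a..b} (\<lambda>t. (norm (f t))\<^sup>2)"
    by (simp add: set_integrable_def \<phi>_def)
  have "ennreal (integral\<^sup>L lebesgue \<phi>) \<le> ennreal B"
    using nn nn_integral_eq_integral[OF \<phi>_int] \<phi>0 by simp
  then have "integral\<^sup>L lebesgue \<phi> \<le> B" using B0 by (simp add: ennreal_le_iff)
  then show LB: "(LINT t:{a..b}|lebesgue. (norm (f t))\<^sup>2) \<le> B"
    by (simp add: set_lebesgue_integral_def \<phi>_def)
  have c1: "set_integrable lebesgue {a..b} (\<lambda>t. 1 :: real)"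
    by (rule absolutely_integrable_continuous_real) simp
  have half: "set_integrable lebesgue {a..b} (\<lambda>t. (1 + (norm (f t))\<^sup>2) / 2)"
    using set_integral_add(1)[OF c1 s1] by (rule set_integrable_divide)
  have amgm: "norm w \<le> (1 + (norm w)\<^sup>2) / 2" for w :: complex
    using zero_le_power2[of "norm w - 1"] by (simp add: power2_eq_square algebra_simps)
  show s3: "set_integrable lebesgue {a..b} f"
    unfolding set_integrable_def
  proof (rule Bochner_Integration.integrable_bound[OF half[unfolded set_integrable_def]])
    show "(\<lambda>t. indicat_real {a..b} t *\<^sub>R f t) \<in> borel_measurable lebesgue"
      by (intro borel_measurable_scaleR ind f_leb)
    show "AE t in lebesgue. norm (indicat_real {a..b} t *\<^sub>R f t) \<le> norm (indicat_real {a..b} t *\<^sub>R ((1 + (norm (f t))\<^sup>2) / 2))"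
      using amgm by (intro always_eventually allI) (simp add: indicator_def)
  qed
  have "(LINT t:{a..b}|lebesgue. norm (f t)) \<le> (LINT t:{a..b}|lebesgue. (1 + (norm (f t))\<^sup>2) / 2)"
    by (rule set_integral_mono[OF set_integrable_norm[OF s3] half]) (use amgm in auto)
  also have "\<dots> = (LINT t:{a..b}|lebesgue. 1 + (norm (f t))\<^sup>2) / 2"
    by simp
  also have "(LINT t:{a..b}|lebesgue. 1 + (norm (f t))\<^sup>2) = (LINT t:{a..b}|lebesgue. 1) + (LINT t:{a..b}|lebesgue. (norm (f t))\<^sup>2)"
    by (rule set_integral_add(2)[OF c1 s1])
  also have "(LINT t:{a..b}|lebesgue. 1::real) = b - a"
    using ab by (simp add: set_lebesgue_integral_def)
  also have "(b - a + (LINT t:{a..b}|lebesgue. (norm (f t))\<^sup>2)) / 2 \<le> ((b - a) + B) / 2" using LB by simp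
  finally show "(LINT t:{a..b}|lebesgue. norm (f t)) \<le> ((b - a) + B) / 2" .
qed


text \<open>
  In the definition of mean oscillation the mean may be replaced by any constant, at the cost of a
  factor 2.
\<close>

lemma mean_oscillation_le:
  fixes u :: "real \<Rightarrow> complex"
  assumes ab: "a < b" and u: "set_integrable lebesgue {a..b} (\<lambda>t. u t - c)"
    and K: "(LINT t:{a..b}|lebesgue. norm (u t - c)) \<le> K * (b - a)"
  shows "set_integrable lebesgue {a..b} u"
    and "(LINT t:{a..b}|lebesgue. norm (u t - (LINT t:{a..b}|lebesgue. u t) / of_real (b - a))) / (b - a) \<le> 2 * K"
proof -
  have cint: "set_integrable lebesgue {a..b} (\<lambda>t. w)" for w :: "'x :: euclidean_space"
    by (rule absolutely_integrable_continuous_real) simp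
  have clint: "(LINT t:{a..b}|lebesgue. w) = (b - a) *\<^sub>R w" for w :: "'x :: euclidean_space"
    using ab by (simp add: set_lebesgue_integral_def)
  have "set_integrable lebesgue {a..b} (\<lambda>t. (u t - c) + c)" by (rule set_integral_add(1)[OF u cint])
  then show ui: "set_integrable lebesgue {a..b} u" by simp
  define m where "m = (LINT t:{a..b}|lebesgue. u t) / of_real (b - a)"
  have "(LINT t:{a..b}|lebesgue. u t - c) = (LINT t:{a..b}|lebesgue. u t) - (b - a) *\<^sub>R c"
    using set_integral_diff(2)[OF ui cint] clint by simp
  then have mc: "of_real (b - a) * (m - c) = (LINT t:{a..b}|lebesgue. u t - c)"
    using ab by (simp add: m_def right_diff_distrib scaleR_conv_of_real del: of_real_diff)
  have "(b - a) * norm (m - c) = norm (of_real (b - a) * (m - c))"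
    unfolding norm_mult norm_of_real using ab by simp
  also have "\<dots> \<le> (LINT t:{a..b}|lebesgue. norm (u t - c))"
    unfolding mc by (rule set_integral_norm_bound[OF u])
  finally have mb: "(b - a) * norm (m - c) \<le> K * (b - a)" using K by simp
  have n1: "set_integrable lebesgue {a..b} (\<lambda>t. norm (u t - m))"
    by (rule set_integrable_norm[OF set_integral_diff(1)[OF ui cint]])
  have n2: "set_integrable lebesgue {a..b} (\<lambda>t. norm (u t - c) + norm (m - c))"
    by (rule set_integral_add(1)[OF set_integrable_norm[OF u] cint])
  have "(LINT t:{a..b}|lebesgue. norm (u t - m)) \<le> (LINT t:{a..b}|lebesgue. norm (u t - c) + norm (m - c))"
  proof (rule set_integral_mono[OF n1 n2])
    show "norm (u t - m) \<le> norm (u t - c) + norm (m - c)" for t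
      using norm_triangle_ineq4[of "u t - c" "m - c"] by simp
  qed
  also have "\<dots> = (LINT t:{a..b}|lebesgue. norm (u t - c)) + (LINT t:{a..b}|lebesgue. norm (m - c))"
    by (rule set_integral_add(2)[OF set_integrable_norm[OF u] cint])
  also have "(LINT t:{a..b}|lebesgue. norm (m - c)) = (b - a) * norm (m - c)" by (simp add: clint)
  finally have "(LINT t:{a..b}|lebesgue. norm (u t - m)) \<le> 2 * K * (b - a)" using K mb by simp
  then show "(LINT t:{a..b}|lebesgue. norm (u t - (LINT t:{a..b}|lebesgue. u t) / of_real (b - a))) / (b - a) \<le> 2 * K"
    using ab by (simp add: m_def pos_divide_le_eq)
qed

context admissible_limit
begin

lemma L_cis_measurable: "(\<lambda>t. L (w * cis t)) \<in> borel_measurable borel"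
  unfolding L_def
proof (rule borel_measurable_lim_metric)
  fix k
  have "continuous_on UNIV (\<lambda>t. F k (w * cis t))"
    by (rule continuous_on_compose2[OF entire_continuous[OF F_holo, of UNIV]]) (auto intro!: continuous_intros)
  then show "(\<lambda>t. F k (w * cis t)) \<in> borel_measurable borel" by (rule borel_measurable_continuous_onI)
qed

text \<open>
  Away from the point 1 the function \<open>L\<close> is continuous up to the boundary.
\<close>

lemma L_boundary: "boundary_function L L"
  unfolding boundary_function_def
  using AE_cis_neq_1
proof eventually_elim
  case (elim t)
  show ?case
  proof (rule continuous_on_tendsto_compose[OF L_continuous])
    have "((\<lambda>r. of_real r * cis t) \<longlongrightarrow> of_real 1 * cis t) (at_left (1::real))" by (intro tendsto_intros)
    then show "((\<lambda>r. of_real r * cis t) \<longlongrightarrow> cis t) (at_left (1::real))" by simp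
    show "cis t \<in> cball 0 1 - {1}" using elim by simp
    have "\<forall>\<^sub>F r in at_left (1::real). r \<in> {0<..<1}" by (rule eventually_at_left_real) simp
    then show "\<forall>\<^sub>F r in at_left (1::real). of_real r * cis t \<in> cball 0 1 - {1}"
    proof eventually_elim
      case (elim r)
      then have "norm (of_real r * cis t) < 1" by (simp add: norm_mult)
      then show ?case by auto
    qed
  qed
qed

definition osc_const :: real where "osc_const = 1024 * pi\<^sup>2"

lemma L_bmo: "bmo_circle L"
proof -
  have arcs: "\<exists>c. set_integrable lebesgue {a..b} (\<lambda>t. L (cis t) - c) \<and>
      (LINT t:{a..b}|lebesgue. norm (L (cis t) - c)) \<le> ((1 + osc_const) / 2) * (b - a)"
    if ab: "a < b" "b \<le> a + 2 * pi" for a b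
  proof -
    define z where "z = cis a * (of_real (1 - (b - a) / (4 * pi)) * cis ((b - a) / 2))"
    have h: "0 < (b - a) / (4 * pi)" "(b - a) / (4 * pi) < 1" using ab by (auto simp: field_simps)
    have "norm z = \<bar>1 - (b - a) / (4 * pi)\<bar>" unfolding z_def norm_mult norm_of_real norm_cis by simp
    then have z1: "norm z < 1" using h by simp
    then have zn: "z \<noteq> 1" by auto
    have osc: "integral {a..b} (\<lambda>t. (norm (F k (cis t) - F k z))\<^sup>2) \<le> osc_const * (b - a)" for k
      unfolding osc_const_def z_def by (rule oscillation_on_arc[OF F_holo _ ab]) (use F_Im in \<open>auto simp: less_imp_le\<close>)
    have m: "(\<lambda>t. L (cis t) - L z) \<in> borel_measurable borel"
      using L_cis_measurable[of 1] by simp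
    have lim: "AE t in lebesgue. (\<lambda>k. F k (cis t) - F k z) \<longlonglongrightarrow> L (cis t) - L z"
      using AE_cis_neq_1
    proof eventually_elim
      case (elim t)
      then show ?case using z1 zn by (intro tendsto_diff F_tendsto) auto
    qed
    have c: "continuous_on UNIV (\<lambda>t. F k (cis t) - F k z)" for k
      by (intro continuous_on_diff continuous_on_const entire_cis_continuous F_holo)
    note Fat = Fatou_square_integral[OF c m osc less_imp_le[OF ab(1)] lim]
    have "(LINT t:{a..b}|lebesgue. norm (L (cis t) - L z)) \<le> ((b - a) + osc_const * (b - a)) / 2" by (rule Fat(4))
    then show ?thesis using Fat(3) by (intro exI[of _ "L z"]) (simp add: algebra_simps)
  qed
  have "bdd_above {(LINT t:{a..b}|lebesgue. norm (L (cis t) - arc_mean L a b)) / (b - a) | a b. a < b \<and> b \<le> a + 2 * pi}"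
  proof (rule bdd_aboveI[of _ "1 + osc_const"], clarify)
    fix a b :: real assume ab: "a < b" "b \<le> a + 2 * pi"
    obtain c where c: "set_integrable lebesgue {a..b} (\<lambda>t. L (cis t) - c)"
      "(LINT t:{a..b}|lebesgue. norm (L (cis t) - c)) \<le> ((1 + osc_const) / 2) * (b - a)" using arcs[OF ab] by blast
    have "2 * ((1 + osc_const) / 2) = 1 + osc_const" by simp
    then show "(LINT t:{a..b}|lebesgue. norm (L (cis t) - arc_mean L a b)) / (b - a) \<le> 1 + osc_const"
      using mean_oscillation_le(2)[OF ab(1) c] by (simp only: arc_mean_def)
  qed
  moreover have "set_integrable lebesgue {0..2 * pi} (\<lambda>t. L (cis t))"
  proof -
    have ab: "(0::real) < 2 * pi" "2 * pi \<le> 0 + 2 * pi" by auto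
    obtain c where c: "set_integrable lebesgue {0..2 * pi} (\<lambda>t. L (cis t) - c)"
      "(LINT t:{0..2 * pi}|lebesgue. norm (L (cis t) - c)) \<le> ((1 + osc_const) / 2) * (2 * pi - 0)" using arcs[OF ab] by blast
    show ?thesis by (rule mean_oscillation_le(1)[OF ab(1) c])
  qed
  ultimately show ?thesis unfolding bmo_circle_def by blast
qed

text \<open>
  The oscillation bound on the full circle, for the dilated functions \<open>F k (s z)\<close>; the reference point
  then has modulus at most \<open>1 / 2\<close>, where \<open>L\<close> is bounded.
\<close>

lemma L_H2: "hardy_H2 L"
  unfolding hardy_H2_def
proof (intro conjI L_holo)
  have "continuous_on (cball 0 (1 / 2)) L"
    by (rule continuous_on_subset[OF L_continuous]) auto
  then have "bounded (L ` cball 0 (1 / 2))" by (intro compact_imp_bounded compact_continuous_image) auto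
  then obtain C where C: "\<forall>x\<in>L ` cball 0 (1 / 2). norm x \<le> C" unfolding bounded_iff by blast
  have two: "(norm x)\<^sup>2 \<le> 2 * (norm (x - y))\<^sup>2 + 2 * C\<^sup>2" if "norm y \<le> C" for x y :: complex
  proof -
    have "norm x \<le> norm (x - y) + C" using norm_triangle_ineq[of "x - y" y] that by simp
    then have "(norm x)\<^sup>2 \<le> (norm (x - y) + C)\<^sup>2" by (intro power_mono) auto
    also have "\<dots> \<le> 2 * (norm (x - y))\<^sup>2 + 2 * C\<^sup>2"
      using zero_le_power2[of "norm (x - y) - C"] by (simp add: power2_eq_square algebra_simps)
    finally show ?thesis .
  qed
  have "(LINT t:{0..2 * pi}|lebesgue. (norm (L (of_real s * cis t)))\<^sup>2) \<le> 2 * (osc_const * (2 * pi)) + 2 * C\<^sup>2 * (2 * pi)"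
    if s: "0 \<le> s" "s < 1" for s
  proof -
    define z where "z = of_real (1 - 2 * pi / (4 * pi)) * cis (2 * pi / 2)"
    have nz: "norm z = 1 / 2" unfolding z_def norm_mult norm_of_real norm_cis by simp
    have hol: "(\<lambda>w. F k (of_real s * w)) holomorphic_on UNIV" for k
      using holomorphic_on_compose_gen[OF _ F_holo, of "\<lambda>w. of_real s * w" UNIV k] by (simp add: o_def holomorphic_intros)
    have sw: "norm (of_real s * w) < 1" if "norm w \<le> 1" for w :: complex
    proof -
      have "norm (of_real s * w) = s * norm w" using s by (simp add: norm_mult)
      also have "\<dots> \<le> s * 1" using s that by (intro mult_left_mono) auto
      finally show ?thesis using s by simp
    qed
    have osc: "integral {0..2 * pi} (\<lambda>t. (norm (F k (of_real s * cis t) - F k (of_real s * z)))\<^sup>2) \<le> osc_const * (2 * pi)" for k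
      unfolding osc_const_def z_def
      by (rule oscillation_of_bounded_Im[OF hol]) (use F_Im sw in \<open>auto simp: less_imp_le\<close>)
    have m: "(\<lambda>t. L (of_real s * cis t) - L (of_real s * z)) \<in> borel_measurable borel"
      using L_cis_measurable[of "of_real s"] by simp
    have conv: "(\<lambda>k. F k (of_real s * w)) \<longlonglongrightarrow> L (of_real s * w)" if "norm w \<le> 1" for w
      using sw[OF that] by (intro F_tendsto) auto
    have lim: "AE t in lebesgue. (\<lambda>k. F k (of_real s * cis t) - F k (of_real s * z)) \<longlonglongrightarrow> L (of_real s * cis t) - L (of_real s * z)"
      using nz by (intro always_eventually allI tendsto_diff conv) auto
    have c: "continuous_on UNIV (\<lambda>t. F k (of_real s * cis t) - F k (of_real s * z))" for k
      by (intro continuous_on_diff continuous_on_const entire_cis_continuous[OF hol])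
    have pos: "(0::real) \<le> 2 * pi" by simp
    note Fat = Fatou_square_integral[OF c m osc pos lim]
    have "continuous_on {0..2 * pi} (\<lambda>t. L (of_real s * cis t))"
    proof (rule continuous_on_compose2[OF L_continuous])
      show "(\<lambda>t. of_real s * cis t) ` {0..2 * pi} \<subseteq> cball 0 1 - {1}"
      proof clarify
        fix t :: real
        have "norm (of_real s * cis t) < 1" by (rule sw) simp
        then show "of_real s * cis t \<in> cball 0 1 - {1}" by auto
      qed
    qed (intro continuous_intros)
    then have i1: "set_integrable lebesgue {0..2 * pi} (\<lambda>t. (norm (L (of_real s * cis t)))\<^sup>2)"
      by (intro absolutely_integrable_continuous_real continuous_on_power continuous_on_norm)
    have c1: "set_integrable lebesgue {0..2 * pi} (\<lambda>t. 2 * C\<^sup>2)"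
      by (rule absolutely_integrable_continuous_real) simp
    have i2: "set_integrable lebesgue {0..2 * pi} (\<lambda>t. 2 * (norm (L (of_real s * cis t) - L (of_real s * z)))\<^sup>2)"
      using Fat(1) by (intro set_integrable_mult_right) auto
    have "norm (of_real s * z) \<le> 1 / 2" unfolding norm_mult norm_of_real nz using s by simp
    then have Cz: "norm (L (of_real s * z)) \<le> C" using C by auto
    have "(LINT t:{0..2 * pi}|lebesgue. (norm (L (of_real s * cis t)))\<^sup>2)
      \<le> (LINT t:{0..2 * pi}|lebesgue. 2 * (norm (L (of_real s * cis t) - L (of_real s * z)))\<^sup>2 + 2 * C\<^sup>2)"
      by (rule set_integral_mono[OF i1 set_integral_add(1)[OF i2 c1]]) (rule two[OF Cz])
    also have "\<dots> = (LINT t:{0..2 * pi}|lebesgue. 2 * (norm (L (of_real s * cis t) - L (of_real s * z)))\<^sup>2)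
        + (LINT t:{0..2 * pi}|lebesgue. 2 * C\<^sup>2)" by (rule set_integral_add(2)[OF i2 c1])
    also have "(LINT t:{0..2 * pi}|lebesgue. 2 * C\<^sup>2) = 2 * C\<^sup>2 * (2 * pi)" by (simp add: set_lebesgue_integral_def)
    also have "(LINT t:{0..2 * pi}|lebesgue. 2 * (norm (L (of_real s * cis t) - L (of_real s * z)))\<^sup>2)
        = 2 * (LINT t:{0..2 * pi}|lebesgue. (norm (L (of_real s * cis t) - L (of_real s * z)))\<^sup>2)" by simp
    finally show ?thesis using Fat(2) by simp
  qed
  then show "bdd_above ((\<lambda>r. LINT t:{0..2 * pi}|lebesgue. (norm (L (of_real r * cis t)))\<^sup>2) ` {0..<1})"
    by (intro bdd_aboveI2[where M = "2 * (osc_const * (2 * pi)) + 2 * C\<^sup>2 * (2 * pi)"]) auto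
qed

lemma L_bmoa: "bmoa L"
  unfolding bmoa_def using L_H2 L_boundary L_bmo by blast

lemma L_bloch_norm: "bloch_norm L \<le> ennreal (3 * \<alpha>)"
  unfolding bloch_norm_def by (intro SUP_least ennreal_leI L_bloch)

end

theorem theorem3:
  fixes \<epsilon> :: real
  assumes "\<epsilon> > 0"
  shows "\<exists>\<Gamma> \<Phi> L.
           quasicircle \<Gamma> \<and> rectifiable_jordan_curve \<Gamma> \<and>
           riemann_mapping \<Phi> (inside \<Gamma>) \<and>
           log_deriv_branch \<Phi> L \<and> bmoa L \<and> bloch_norm L < ennreal \<epsilon> \<and>
           \<not> chord_arc_curve \<Gamma>"
proof -
  define \<alpha> where "\<alpha> = min (1 / 60) (\<epsilon> / 4)"
  have small: "0 < \<alpha>" "\<alpha> \<le> 1 / 60" "3 * \<alpha> < \<epsilon>" using assms by (auto simp: \<alpha>_def min_def)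
  have "\<alpha> \<le> 1 / 2" using small by simp
  from admissible_sequence[OF small(1) this] obtain F :: "nat \<Rightarrow> complex \<Rightarrow> complex" and \<rho> :: "nat \<Rightarrow> real"
    where "admissible_limit \<alpha> F \<rho>"
    unfolding admissible_limit_def using small by metis
  then interpret admissible_limit \<alpha> F \<rho> .
  have "bloch_norm L < ennreal \<epsilon>"
    by (rule le_less_trans[OF L_bloch_norm ennreal_lessI[OF assms small(3)]])
  then show ?thesis
    using \<Gamma>_quasicircle \<Gamma>_rectifiable \<Gamma>_riemann \<Phi>_log_deriv L_bmoa \<Gamma>_not_chord_arc by blast
qed

end
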